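(* Let $\phi\in\mathcal{A}_1$ and let $\sigma:(0,\infty)\times\mathbb{R}^d\to[0,1]$ be measurable and thin. Then there exists $c>0$ such that $$\langle T_{1-\sigma}f,f\rangle=\int_{(0,\infty)\times\mathbb{R}^d}(1-\sigma)\,|W_\phi f|^2\,d\lambda\ge c\|f\|^2$$ for all $f\in L^2(\mathbb{R}^d)$.
   Context: For $\phi\in L^2(\mathbb{R}^d)$, $a\in(0,\infty)$, $b\in\mathbb{R}^d$, put $\phi_{a,b}(x)=a^{-d/2}\phi(a^{-1}x-b)$ and $W_\phi f(a,b)=\langle f,\phi_{a,b}\rangle_{L^2(\mathbb{R}^d)}$. The index set is the group $(0,\infty)\times\mathbb{R}^d$ with operation $(a_1,b_1)(a_2,b_2)=(a_1a_2,\,a_2^{-1}b_1+b_2)$ and left Haar measure $d\lambda(a,b)=a^{-1}\,da\,db$. For bounded measurable $\rho\ge0$, $T_\rho f=\int\rho(a,b)W_\phi f(a,b)\phi_{a,b}\,d\lambda(a,b)$ (weak integral). With $\hat\phi$ the unitarily normalized Fourier transform, $\mathcal{A}$ is the set of admissible $\phi\in L^2(\mathbb{R}^d)$, i.e. those with $\int_0^\infty\frac{|\hat\phi(x\xi)|^2}{\xi}\,d\xi=1$ for a.e. $x\in\mathbb{R}^d$. For a weight $w$ on the group, $\mathcal{B}^1_w=\{\phi\in L^2(\mathbb{R}^d):W_\phi\phi\in L^1(w\,d\lambda)\}$. For $\varepsilon>0$ let $w_\varepsilon(a,b)=a^{d/2+\varepsilon}$, and set $\mathcal{A}_1=\left(\bigcup_{0<\varepsilon<1}\mathcal{B}^1_{w_\varepsilon}\right)\cap\mathcal{A}$.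 Fix a proper (balls are precompact) left-invariant metric on the group inducing its topology; $(a',b')\to\infty$ means that the distance from $(a',b')$ to $(1,0)$ tends to infinity. A function $\sigma$ is thin if $\int\sigma(a,b)\,|\langle\phi_{a,b},\phi_{a',b'}\rangle|^2\,d\lambda(a,b)\to0$ as $(a',b')\to\infty$. *)

theory Defs
  imports "HOL-Analysis.Analysis"
begin

section \<open>The space \<open>L\<^sup>2(\<real>\<^sup>d)\<close>\<close>

text \<open>
  Elements of \<open>L\<^sup>2(\<real>\<^sup>d)\<close> are represented by Borel functions; nothing below depends on
  the choice of a representative modulo null sets.
\<close>

definition L2 :: "(real ^ 'd \<Rightarrow> complex) set" where
  "L2 = {f. f \<in> borel_measurable lborel \<and> integrable lborel (\<lambda>x. (cmod (f x))\<^sup>2)}"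

definition L2_inner :: "(real ^ 'd \<Rightarrow> complex) \<Rightarrow> (real ^ 'd \<Rightarrow> complex) \<Rightarrow> complex" where
  "L2_inner f g = (LINT x|lborel. f x * cnj (g x))"

definition L2_norm :: "(real ^ 'd \<Rightarrow> complex) \<Rightarrow> real" where
  "L2_norm f = sqrt (LINT x|lborel. (cmod (f x))\<^sup>2)"


section \<open>The Fourier transform on \<open>L\<^sup>2(\<real>\<^sup>d)\<close>\<close>

text \<open>
  The factor \<open>2\<pi>\<close> is put into the exponent. This is the unitary normalization for which
  admissible functions (below) give \<open>\<integral> \<bar>W\<^sub>\<phi> f\<bar>\<^sup>2 d\<lambda> = \<parallel>f\<parallel>\<^sup>2\<close> without an extra constant.
\<close>

definition fourier_integral :: "(real ^ 'd \<Rightarrow> complex) \<Rightarrow> real ^ 'd \<Rightarrow> complex" where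
  "fourier_integral f \<xi> = (LINT x|lborel. cis (- 2 * pi * (x \<bullet> \<xi>)) * f x)"

text \<open>
  On \<open>L\<^sup>2\<close> the transform is the limit in \<open>L\<^sup>2\<close> of the Fourier integrals of the truncations
  to balls. It is a relation because it determines \<open>\<psi>\<close> only up to a null set.
\<close>

definition is_L2_fourier :: "(real ^ 'd \<Rightarrow> complex) \<Rightarrow> (real ^ 'd \<Rightarrow> complex) \<Rightarrow> bool" where
  "is_L2_fourier f \<psi> \<longleftrightarrow> \<psi> \<in> L2 \<and>
     ((\<lambda>R::real. \<integral>\<^sup>+\<xi>. ennreal ((cmod (\<psi> \<xi> -
          fourier_integral (\<lambda>x. indicator (cball 0 R) x * f x) \<xi>))\<^sup>2) \<partial>lborel)
        \<longlongrightarrow> 0) at_top"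


section \<open>The index group\<close>

definition grp :: "(real \<times> (real ^ 'd)) set" where
  "grp = {0<..} \<times> UNIV"

fun grp_mult :: "real \<times> (real ^ 'd) \<Rightarrow> real \<times> (real ^ 'd) \<Rightarrow> real \<times> (real ^ 'd)" where
  "grp_mult (a\<^sub>1, b\<^sub>1) (a\<^sub>2, b\<^sub>2) = (a\<^sub>1 * a\<^sub>2, inverse a\<^sub>2 *\<^sub>R b\<^sub>1 + b\<^sub>2)"

definition grp_one :: "real \<times> (real ^ 'd)" where
  "grp_one = (1, 0)"

definition haar :: "(real \<times> (real ^ 'd)) measure" where
  "haar = density (restrict_space lborel grp) (\<lambda>(a, b). ennreal (inverse a))"

definition proper_left_invariant_metric ::
    "(real \<times> (real ^ 'd) \<Rightarrow> real \<times> (real ^ 'd) \<Rightarrow> real) \<Rightarrow> bool" where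
  "proper_left_invariant_metric D \<longleftrightarrow>
     Metric_space grp D \<and>
     Metric_space.mtopology grp D = top_of_set grp \<and>
     (\<forall>g\<in>grp. \<forall>p\<in>grp. \<forall>q\<in>grp. D (grp_mult g p) (grp_mult g q) = D p q) \<and>
     (\<forall>p\<in>grp. \<forall>r. compactin (top_of_set grp)
        (top_of_set grp closure_of (Metric_space.mball grp D p r)))"

definition at_grp_infinity ::
    "(real \<times> (real ^ 'd) \<Rightarrow> real \<times> (real ^ 'd) \<Rightarrow> real) \<Rightarrow> (real \<times> (real ^ 'd)) filter" where
  "at_grp_infinity D = inf (filtercomap (\<lambda>p. D p grp_one) at_top) (principal grp)"


section \<open>Wavelet transform and localization operators\<close>

fun wavelet :: "(real ^ 'd \<Rightarrow> complex) \<Rightarrow> real \<times> (real ^ 'd) \<Rightarrow> real ^ 'd \<Rightarrow> complex" where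
  "wavelet \<phi> (a, b) x =
     complex_of_real (a powr (- (real CARD('d) / 2))) * \<phi> (inverse a *\<^sub>R x - b)"

definition wavelet_transform ::
    "(real ^ 'd \<Rightarrow> complex) \<Rightarrow> (real ^ 'd \<Rightarrow> complex) \<Rightarrow> real \<times> (real ^ 'd) \<Rightarrow> complex" where
  "wavelet_transform \<phi> f p = L2_inner f (wavelet \<phi> p)"

text \<open>
  The weak integral of \<open>\<rho>(p) W\<^sub>\<phi> f(p) \<phi>\<^sub>p\<close>: the element \<open>h\<close> of \<open>L\<^sup>2\<close>, unique modulo null
  sets, whose inner product with every \<open>g\<close> is the integral of the inner products.
\<close>

definition is_localization ::
    "(real ^ 'd \<Rightarrow> complex) \<Rightarrow> (real \<times> (real ^ 'd) \<Rightarrow> real) \<Rightarrow>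
     (real ^ 'd \<Rightarrow> complex) \<Rightarrow> (real ^ 'd \<Rightarrow> complex) \<Rightarrow> bool" where
  "is_localization \<phi> \<rho> f h \<longleftrightarrow> h \<in> L2 \<and>
     (\<forall>g\<in>L2.
        integrable haar (\<lambda>p. of_real (\<rho> p) * wavelet_transform \<phi> f p * L2_inner (wavelet \<phi> p) g) \<and>
        L2_inner h g =
          (LINT p|haar. of_real (\<rho> p) * wavelet_transform \<phi> f p * L2_inner (wavelet \<phi> p) g))"

definition localization_op ::
    "(real ^ 'd \<Rightarrow> complex) \<Rightarrow> (real \<times> (real ^ 'd) \<Rightarrow> real) \<Rightarrow>
     (real ^ 'd \<Rightarrow> complex) \<Rightarrow> real ^ 'd \<Rightarrow> complex" where
  "localization_op \<phi> \<rho> f = (SOME h. is_localization \<phi> \<rho> f h)"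


section \<open>Admissible windows and thin functions\<close>

definition admissible :: "(real ^ 'd \<Rightarrow> complex) set" where
  "admissible = {\<phi>\<in>L2. \<exists>\<psi>. is_L2_fourier \<phi> \<psi> \<and>
     (AE x in lborel. (\<integral>\<^sup>+\<xi>\<in>{0<..}. ennreal ((cmod (\<psi> (\<xi> *\<^sub>R x)))\<^sup>2 / \<xi>) \<partial>lborel) = 1)}"

definition B1 :: "(real \<times> (real ^ 'd) \<Rightarrow> real) \<Rightarrow> (real ^ 'd \<Rightarrow> complex) set" where
  "B1 w = {\<phi>\<in>L2. integrable (density haar (\<lambda>p. ennreal (w p))) (wavelet_transform \<phi> \<phi>)}"

definition weight :: "real \<Rightarrow> real \<times> (real ^ 'd) \<Rightarrow> real" where
  "weight \<epsilon> = (\<lambda>(a, b). a powr (real CARD('d) / 2 + \<epsilon>))"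

definition A1 :: "(real ^ 'd \<Rightarrow> complex) set" where
  "A1 = (\<Union>\<epsilon>\<in>{0<..<1}. B1 (weight \<epsilon>)) \<inter> admissible"

definition thin ::
    "(real \<times> (real ^ 'd) \<Rightarrow> real \<times> (real ^ 'd) \<Rightarrow> real) \<Rightarrow> (real ^ 'd \<Rightarrow> complex) \<Rightarrow>
     (real \<times> (real ^ 'd) \<Rightarrow> real) \<Rightarrow> bool" where
  "thin D \<phi> \<sigma> \<longleftrightarrow>
     ((\<lambda>q. \<integral>\<^sup>+p. ennreal (\<sigma> p * (cmod (L2_inner (wavelet \<phi> p) (wavelet \<phi> q)))\<^sup>2) \<partial>haar)
        \<longlongrightarrow> 0) (at_grp_infinity D)"

end

theory Submission
  imports Defs "HOL-Probability.Probability" "HOL-Complex_Analysis.Great_Picard"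
begin

text \<open>
  By Plancherel's identity the wavelet transform \<open>W\<close> of an admissible window is an isometry, so
  \<open>\<langle>T\<^sub>1\<^sub>-\<^sub>\<sigma> f, f\<rangle> = \<parallel>f\<parallel>\<^sup>2 - \<integral> \<sigma> |W f|\<^sup>2\<close> and the bound says that \<open>1 - T\<^sub>\<sigma>\<close> is bounded below.

  The matrix entries \<open>m(q,q') = \<integral> \<sigma> |\<langle>\<phi>\<^sub>p,\<phi>\<^sub>q\<rangle>| |\<langle>\<phi>\<^sub>p,\<phi>\<^sub>q\<^sub>'\<rangle>| d\<lambda>(p)\<close> of \<open>T\<^sub>\<sigma>\<close> are small outside a compact set by
  Cauchy-Schwarz and thinness, and they are dominated by a left-invariant symmetric kernel for which
  \<open>a\<^sup>s\<close> with \<open>s = d/2 + \<epsilon>\<close> is a Schur weight. Hence \<open>T\<^sub>\<sigma>\<close> is compact, uniformly for uniformly thin \<open>\<sigma>\<close>,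
  and it remains to exclude \<open>f \<noteq> 0\<close> with \<open>W f = 0\<close> almost everywhere on \<open>{\<sigma> < 1}\<close>. The space \<open>V\<close> of such
  \<open>f\<close> has a compact unit ball. As in the argument of Amrein and Berthier, a small translation maps \<open>V\<close>
  into the corresponding space of a slightly enlarged thin function, which by compactness is not larger
  than \<open>V\<close>. So \<open>V\<close> is invariant under some translation, but the iterated translates of \<open>f\<close>
  escape to infinity, where thinness makes \<open>\<integral> \<sigma> |W f|\<^sup>2 \<le> \<parallel>f\<parallel>\<^sup>2 / 2\<close>.
\<close>

section \<open>Square integrable functions\<close>

text \<open>The symbol \<open>\<sigma>\<close> is not assumed to have compact support and the window
  is an arbitrary element of \<open>A1\<close>, so uniqueness cannot be drawn from analyticity of
  the wavelet transform; this forces the translation argument. Left translations by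
  \<open>(1, b)\<close> preserve Haar measure, act on functions as ordinary translations, and for
  \<open>norm b \<le> 1\<close> keep points off box \<open>2 * m\<close> off box \<open>m\<close>.
  Hence the maximum of \<open>\<sigma>\<close> and its shift is thin at a rate independent of
  \<open>b\<close>, and compactness can be used along a sequence of different symbols.

  Compactness itself comes from an inequality. Away from \<open>K \<times> K\<close> the entries
  have a small Schur norm; on \<open>K \<times> K\<close> only the L1 norm of \<open>W f\<close>
  over \<open>K\<close> enters, and it converges once the transforms converge pointwise with a
  common bound. A diagonal sequence provides this, because the wavelet depends norm continuously on
  the group element. The Schur weight is dictated by \<open>A1\<close>, which controls the kernel
  only against a power of the scale; such a power is multiplicative on the group, and left
  invariance asks for no more.\<close>

lemma borel_measurable_cnj [measurable]:
  "f \<in> borel_measurable M \<Longrightarrow> (\<lambda>x. cnj (f x)) \<in> borel_measurable M"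
  using borel_measurable_continuous_onI[of cnj] by (rule measurable_compose[rotated]) (auto intro: continuous_intros)

text \<open>Squared norm with values in \<open>ennreal\<close>: comparison, Fatou and limit
  arguments then need no integrability side conditions, and finiteness is asked for only where a
  difference or a real norm is formed.\<close>

definition esq :: "'a measure \<Rightarrow> ('a \<Rightarrow> complex) \<Rightarrow> ennreal" where
  "esq M f = (\<integral>\<^sup>+x. ennreal ((cmod (f x))\<^sup>2) \<partial>M)"

text \<open>Young's inequality for the cross term. The parameter \<open>\<eta>\<close> is kept free
  because optimizing it after integration yields the triangle inequality, while
  \<open>\<eta> = 1\<close> gives the crude factor 2 used elsewhere.\<close>

lemma cmod_add_sq_le:
  fixes u v :: complex
  assumes "\<eta> > 0"
  shows "(cmod (u + v))\<^sup>2 \<le> (1 + \<eta>) * (cmod u)\<^sup>2 + (1 + 1 / \<eta>) * (cmod v)\<^sup>2"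
proof -
  let ?x = "cmod u" and ?y = "cmod v"
  have "(cmod (u + v))\<^sup>2 \<le> (?x + ?y)\<^sup>2"
    by (intro power_mono norm_triangle_ineq) auto
  moreover have "2 * ?x * ?y \<le> \<eta> * ?x\<^sup>2 + ?y\<^sup>2 / \<eta>"
  proof -
    have "0 \<le> (\<eta> * ?x - ?y)\<^sup>2 / \<eta>" using assms by simp
    also have "\<dots> = \<eta> * ?x\<^sup>2 + ?y\<^sup>2 / \<eta> - 2 * ?x * ?y"
      using assms by (simp add: field_simps power2_eq_square)
    finally show ?thesis by simp
  qed
  ultimately show ?thesis
    by (simp add: power2_sum algebra_simps)
qed

lemma esq_add_le:
  assumes [measurable]: "f \<in> borel_measurable M" "g \<in> borel_measurable M" and "\<eta> > 0"
  shows "esq M (\<lambda>x. f x + g x) \<le> ennreal (1 + \<eta>) * esq M f + ennreal (1 + 1 / \<eta>) * esq M g"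
proof -
  have "esq M (\<lambda>x. f x + g x) \<le>
      (\<integral>\<^sup>+x. ennreal (1 + \<eta>) * ennreal ((cmod (f x))\<^sup>2) + ennreal (1 + 1 / \<eta>) * ennreal ((cmod (g x))\<^sup>2) \<partial>M)"
    unfolding esq_def
  proof (intro nn_integral_mono)
    fix x
    show "ennreal ((cmod (f x + g x))\<^sup>2) \<le> ennreal (1 + \<eta>) * ennreal ((cmod (f x))\<^sup>2) +
        ennreal (1 + 1 / \<eta>) * ennreal ((cmod (g x))\<^sup>2)"
      using cmod_add_sq_le[OF assms(3), of "f x" "g x"] assms(3)
      by (simp flip: ennreal_mult ennreal_plus)
  qed
  also have "\<dots> = ennreal (1 + \<eta>) * esq M f + ennreal (1 + 1 / \<eta>) * esq M g"
    unfolding esq_def by (simp add: nn_integral_add nn_integral_cmult)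
  finally show ?thesis .
qed

lemma esq_add_le2:
  assumes "f \<in> borel_measurable M" "g \<in> borel_measurable M"
  shows "esq M (\<lambda>x. f x + g x) \<le> 2 * esq M f + 2 * esq M g"
  using esq_add_le[OF assms, of 1] by simp

lemma esq_uminus [simp]: "esq M (\<lambda>x. - f x) = esq M f"
  by (simp add: esq_def)

lemma esq_diff_commute: "esq M (\<lambda>x. f x - g x) = esq M (\<lambda>x. g x - f x)"
  by (simp add: esq_def norm_minus_commute)

lemma esq_diff_le2:
  assumes [measurable]: "f \<in> borel_measurable M" "g \<in> borel_measurable M"
  shows "esq M (\<lambda>x. f x - g x) \<le> 2 * esq M f + 2 * esq M g"
  using esq_add_le2[of f M "\<lambda>x. - g x"] by simp

lemma esq_zero [simp]: "esq M (\<lambda>x. 0) = 0"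
  by (simp add: esq_def)

lemma esq_cmult:
  assumes [measurable]: "f \<in> borel_measurable M"
  shows "esq M (\<lambda>x. c * f x) = ennreal ((cmod c)\<^sup>2) * esq M f"
  unfolding esq_def by (simp add: norm_mult power_mult_distrib ennreal_mult nn_integral_cmult)

lemma esq_cong: "(\<And>x. x \<in> space M \<Longrightarrow> f x = g x) \<Longrightarrow> esq M f = esq M g"
  unfolding esq_def by (intro nn_integral_cong) simp

lemma esq_cong_AE: "AE x in M. f x = g x \<Longrightarrow> esq M f = esq M g"
  unfolding esq_def by (intro nn_integral_cong_AE) auto

lemma esq_mono: "(\<And>x. x \<in> space M \<Longrightarrow> cmod (f x) \<le> cmod (g x)) \<Longrightarrow> esq M f \<le> esq M g"
  unfolding esq_def by (intro nn_integral_mono ennreal_leI power_mono) auto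

text \<open>Lower semicontinuity of the norm under almost everywhere convergence; a bound on a tail
  of the sequence suffices.\<close>

lemma esq_fatou_le:
  assumes [measurable]: "\<And>n. F n \<in> borel_measurable M"
    and lim: "AE x in M. (\<lambda>n. F n x) \<longlonglongrightarrow> G x"
    and bd: "\<forall>\<^sub>F n in sequentially. esq M (F n) \<le> c"
  shows "esq M G \<le> c"
proof -
  have "esq M G = (\<integral>\<^sup>+x. liminf (\<lambda>n. ennreal ((cmod (F n x))\<^sup>2)) \<partial>M)"
    unfolding esq_def
  proof (intro nn_integral_cong_AE, use lim in eventually_elim)
    fix x assume "(\<lambda>n. F n x) \<longlonglongrightarrow> G x"
    then have "(\<lambda>n. ennreal ((cmod (F n x))\<^sup>2)) \<longlonglongrightarrow> ennreal ((cmod (G x))\<^sup>2)"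
      by (intro tendsto_ennrealI tendsto_intros)
    from lim_imp_Liminf[OF sequentially_bot this]
    show "ennreal ((cmod (G x))\<^sup>2) = liminf (\<lambda>n. ennreal ((cmod (F n x))\<^sup>2))" by simp
  qed
  also have "\<dots> \<le> liminf (\<lambda>n. esq M (F n))"
    unfolding esq_def by (intro nn_integral_liminf) simp
  also have "\<dots> \<le> c"
    using bd by (intro Liminf_le) (auto elim: eventually_mono)
  finally show ?thesis .
qed

text \<open>\<open>enn2real\<close> sends infinity to 0, so this is the norm only for functions with
  finite \<open>esq\<close>; the finiteness hypotheses below guard against that value.\<close>

definition nrm :: "'a measure \<Rightarrow> ('a \<Rightarrow> complex) \<Rightarrow> real" where
  "nrm M f = sqrt (enn2real (esq M f))"

lemma nrm_nonneg [simp]: "nrm M f \<ge> 0"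
  by (simp add: nrm_def)

lemma esq_eq_nrm: "esq M f < \<infinity> \<Longrightarrow> esq M f = ennreal ((nrm M f)\<^sup>2)"
  by (simp add: nrm_def)

lemma nrm_le: "esq M f \<le> ennreal (c\<^sup>2) \<Longrightarrow> c \<ge> 0 \<Longrightarrow> nrm M f \<le> c"
  unfolding nrm_def by (rule real_le_lsqrt) (auto intro: enn2real_leI)

lemma esq_zero_AE:
  assumes [measurable]: "f \<in> borel_measurable M" and "esq M f = 0"
  shows "AE x in M. f x = 0"
proof -
  have "AE x in M. ennreal ((cmod (f x))\<^sup>2) = 0"
    using assms(2) unfolding esq_def by (subst (asm) nn_integral_0_iff_AE) auto
  then show ?thesis by eventually_elim (simp add: ennreal_eq_0_iff)
qed

lemma esq_add_finite:
  assumes "f \<in> borel_measurable M" "g \<in> borel_measurable M" "esq M f < \<infinity>" "esq M g < \<infinity>"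
  shows "esq M (\<lambda>x. f x + g x) < \<infinity>"
proof -
  have "2 * esq M f + 2 * esq M g < \<infinity>"
    using assms(3,4) by (simp add: ennreal_mult_less_top)
  then show ?thesis using esq_add_le2[OF assms(1,2)] by (rule le_less_trans[rotated])
qed

lemma esq_diff_finite:
  assumes [measurable]: "f \<in> borel_measurable M" "g \<in> borel_measurable M"
    and "esq M f < \<infinity>" "esq M g < \<infinity>"
  shows "esq M (\<lambda>x. f x - g x) < \<infinity>"
  using esq_add_finite[of f M "\<lambda>x. - g x"] assms by simp

lemma nrm_triangle:
  assumes [measurable]: "f \<in> borel_measurable M" "g \<in> borel_measurable M"
    and fin: "esq M f < \<infinity>" "esq M g < \<infinity>"
  shows "nrm M (\<lambda>x. f x + g x) \<le> nrm M f + nrm M g"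
proof (cases "nrm M f = 0 \<or> nrm M g = 0")
  case True
  then have "esq M f = 0 \<or> esq M g = 0" using fin esq_eq_nrm by fastforce
  then have "esq M (\<lambda>x. f x + g x) = esq M g \<or> esq M (\<lambda>x. f x + g x) = esq M f"
    using esq_zero_AE[of f M] esq_zero_AE[of g M]
    by (auto intro!: esq_cong_AE elim!: eventually_mono)
  then show ?thesis by (auto simp: nrm_def)
next
  case False
  define x where "x = nrm M f"
  define y where "y = nrm M g"
  have pos: "x > 0" "y > 0" using False by (auto simp: x_def y_def less_le)
  \<comment> \<open>The value \<open>\<eta> = y / x\<close> minimizes
    \<open>(1 + \<eta>) * x^2 + (1 + 1 / \<eta>) * y^2\<close>, and the minimum is
    \<open>(x + y)^2\<close>. It needs both norms positive, hence the separate case above.\<close>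
  have "esq M (\<lambda>x. f x + g x) \<le> ennreal (1 + y / x) * esq M f + ennreal (1 + 1 / (y / x)) * esq M g"
    using pos by (intro esq_add_le) auto
  also have "\<dots> = ennreal ((1 + y / x) * x\<^sup>2 + (1 + 1 / (y / x)) * y\<^sup>2)"
    using fin pos by (simp add: esq_eq_nrm x_def[symmetric] y_def[symmetric] flip: ennreal_mult ennreal_plus)
  also have "(1 + y / x) * x\<^sup>2 + (1 + 1 / (y / x)) * y\<^sup>2 = (x + y)\<^sup>2"
    using pos by (simp add: field_simps power2_eq_square)
  finally show ?thesis
    using pos by (intro nrm_le) (auto simp: x_def y_def)
qed

lemma nrm_diff_triangle:
  assumes [measurable]: "f \<in> borel_measurable M" "g \<in> borel_measurable M"
    and fin: "esq M f < \<infinity>" "esq M g < \<infinity>"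
  shows "\<bar>nrm M f - nrm M g\<bar> \<le> nrm M (\<lambda>x. f x - g x)"
proof -
  have d: "esq M (\<lambda>x. f x - g x) < \<infinity>" by (intro esq_diff_finite fin) measurable
  have "nrm M f \<le> nrm M (\<lambda>x. f x - g x) + nrm M g"
    using nrm_triangle[of "\<lambda>x. f x - g x" M g] d fin by simp
  moreover have "nrm M g \<le> nrm M (\<lambda>x. g x - f x) + nrm M f"
    using nrm_triangle[of "\<lambda>x. g x - f x" M f] d fin by (simp add: esq_diff_commute[of M g f])
  ultimately show ?thesis by (simp add: nrm_def esq_diff_commute[of M g f])
qed

lemma nrm_diff_tendsto_0:
  assumes "(\<lambda>n. esq M (F n)) \<longlonglongrightarrow> 0"
  shows "(\<lambda>n. nrm M (F n)) \<longlonglongrightarrow> 0"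
proof -
  have "(\<lambda>n. enn2real (esq M (F n))) \<longlonglongrightarrow> enn2real 0"
    using assms by (intro tendsto_enn2real) auto
  from tendsto_real_sqrt[OF this] show ?thesis by (simp add: nrm_def)
qed

lemma esq_tendsto:
  assumes [measurable]: "\<And>n. F n \<in> borel_measurable M" "G \<in> borel_measurable M"
    and lim: "(\<lambda>n. esq M (\<lambda>x. F n x - G x)) \<longlonglongrightarrow> 0" and fin: "esq M G < \<infinity>"
  shows "(\<lambda>n. esq M (F n)) \<longlonglongrightarrow> esq M G"
proof -
  have ev: "\<forall>\<^sub>F n in sequentially. esq M (F n) < \<infinity>"
  proof -
    have "\<forall>\<^sub>F n in sequentially. esq M (\<lambda>x. F n x - G x) < 1"
      using lim by (rule order_tendstoD) auto
    then show ?thesis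
    proof eventually_elim
      fix n assume "esq M (\<lambda>x. F n x - G x) < 1"
      then have "esq M (\<lambda>x. (F n x - G x) + G x) < \<infinity>"
        using fin by (intro esq_add_finite) (auto intro: less_trans simp: less_top)
      then show "esq M (F n) < \<infinity>" by simp
    qed
  qed
  have "(\<lambda>n. nrm M (F n) - nrm M G) \<longlonglongrightarrow> 0"
  proof (rule Lim_null_comparison)
    show "(\<lambda>n. nrm M (\<lambda>x. F n x - G x)) \<longlonglongrightarrow> 0" by (rule nrm_diff_tendsto_0) fact
    show "\<forall>\<^sub>F n in sequentially. norm (nrm M (F n) - nrm M G) \<le> nrm M (\<lambda>x. F n x - G x)"
      using ev by eventually_elim (use fin in \<open>auto intro!: nrm_diff_triangle\<close>)
  qed
  then have "(\<lambda>n. nrm M (F n)) \<longlonglongrightarrow> nrm M G" by (simp add: LIM_zero_iff)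
  then have "(\<lambda>n. ennreal ((nrm M (F n))\<^sup>2)) \<longlonglongrightarrow> ennreal ((nrm M G)\<^sup>2)"
    by (intro tendsto_intros)
  then show ?thesis unfolding esq_eq_nrm[OF fin]
    by (rule Lim_transform_eventually) (use ev in eventually_elim, simp add: esq_eq_nrm)
qed

lemma tendsto_0_ennrealI:
  fixes X :: "'a \<Rightarrow> ennreal"
  assumes "\<And>\<epsilon>::real. \<epsilon> > 0 \<Longrightarrow> \<forall>\<^sub>F n in F. X n \<le> ennreal \<epsilon>"
  shows "(X \<longlongrightarrow> 0) F"
proof (rule order_tendstoI)
  fix a :: ennreal assume "0 < a"
  then obtain e where e: "0 < e" "e < a" using dense by blast
  then obtain r where r: "e = ennreal r" "r \<ge> 0" by (cases e) auto
  with e have "r > 0" by (auto simp: less_le)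
  from assms[OF this] show "\<forall>\<^sub>F n in F. X n < a"
    by eventually_elim (use e r in auto)
qed auto

text \<open>Fatou in the second index: \<open>F n - F (k m)\<close> is small in norm for large
  \<open>n\<close> and \<open>m\<close> and converges pointwise to \<open>F n - G\<close>. Thus a
  Cauchy sequence converges in norm to any pointwise limit of a subsequence.\<close>

lemma esq_limit_of_Cauchy:
  assumes [measurable]: "\<And>n. F n \<in> borel_measurable M" "G \<in> borel_measurable M"
    and lim: "AE x in M. (\<lambda>n. F (k n) x) \<longlonglongrightarrow> G x" and k: "filterlim k at_top sequentially"
    and cauchy: "\<And>\<epsilon>::real. \<epsilon> > 0 \<Longrightarrow> \<exists>N. \<forall>m\<ge>N. \<forall>n\<ge>N. esq M (\<lambda>x. F m x - F n x) \<le> ennreal \<epsilon>"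
  shows "(\<lambda>n. esq M (\<lambda>x. F n x - G x)) \<longlonglongrightarrow> 0"
proof (rule tendsto_0_ennrealI)
  fix \<epsilon> :: real assume "\<epsilon> > 0"
  then obtain N where N: "\<And>m n. m \<ge> N \<Longrightarrow> n \<ge> N \<Longrightarrow> esq M (\<lambda>x. F m x - F n x) \<le> ennreal \<epsilon>"
    using cauchy by meson
  show "\<forall>\<^sub>F n in sequentially. esq M (\<lambda>x. F n x - G x) \<le> ennreal \<epsilon>"
    using eventually_ge_at_top[of N]
  proof eventually_elim
    fix n assume n: "N \<le> n"
    show "esq M (\<lambda>x. F n x - G x) \<le> ennreal \<epsilon>"
    proof (rule esq_fatou_le)
      show "AE x in M. (\<lambda>m. F n x - F (k m) x) \<longlonglongrightarrow> F n x - G x"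
        using lim by eventually_elim (intro tendsto_intros)
      have "\<forall>\<^sub>F m in sequentially. k m \<ge> N"
        using k by (simp add: filterlim_at_top)
      then show "\<forall>\<^sub>F m in sequentially. esq M (\<lambda>x. F n x - F (k m) x) \<le> ennreal \<epsilon>"
        by eventually_elim (use N n in auto)
    qed measurable
  qed
qed

theorem Riesz_Fischer_esq:
  assumes [measurable]: "\<And>n. F n \<in> borel_measurable M"
    and cauchy: "\<And>\<epsilon>::real. \<epsilon> > 0 \<Longrightarrow> \<exists>N. \<forall>m\<ge>N. \<forall>n\<ge>N. esq M (\<lambda>x. F m x - F n x) \<le> ennreal \<epsilon>"
  obtains G where "G \<in> borel_measurable M" "(\<lambda>n. esq M (\<lambda>x. F n x - G x)) \<longlonglongrightarrow> 0"
proof -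
  have "\<forall>i. \<exists>N. \<forall>m\<ge>N. \<forall>n\<ge>N. esq M (\<lambda>x. F m x - F n x) \<le> ennreal ((1/4) ^ i)"
    by (intro allI cauchy) simp
  then obtain N where N: "\<And>i m n. m \<ge> N i \<Longrightarrow> n \<ge> N i \<Longrightarrow> esq M (\<lambda>x. F m x - F n x) \<le> ennreal ((1/4) ^ i)"
    by metis
  \<comment> \<open>Partial sums make \<open>k\<close> increasing, so that both \<open>k n\<close>
    and \<open>k (Suc n)\<close> lie beyond \<open>N n\<close>; the summand \<open>n\<close> makes
    \<open>k\<close> tend to infinity.\<close>
  define k where "k n = n + (\<Sum>i\<le>n. N i)" for n
  have kN: "k n \<ge> N n" for n
    unfolding k_def by (rule order.trans[OF member_le_sum[of n "{..n}" N]]) auto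
  have kS: "k (Suc n) \<ge> N n" for n
    using kN[of n] by (simp add: k_def)
  have klim: "filterlim k at_top sequentially"
    by (rule filterlim_at_top_mono[OF filterlim_ident]) (simp add: k_def)
  \<comment> \<open>The increments decay like \<open>4^-n\<close> in \<open>esq\<close>, so even
    \<open>2^n * |D n x|^2\<close> is summable after integration. Hence it is bounded in
    \<open>n\<close> for almost every \<open>x\<close>, and the increments are dominated by a
    geometric series of ratio \<open>1 / sqrt 2\<close>.\<close>
  define D where "D n x = F (k (Suc n)) x - F (k n) x" for n x
  have [measurable]: "D n \<in> borel_measurable M" for n
    unfolding D_def[abs_def] by measurable
  have D: "esq M (D n) \<le> ennreal ((1/4) ^ n)" for n
    unfolding D_def[abs_def] by (intro N kN kS)
  have "(\<integral>\<^sup>+x. (\<Sum>n. ennreal (2 ^ n * (cmod (D n x))\<^sup>2)) \<partial>M) = (\<Sum>n. ennreal (2 ^ n) * esq M (D n))"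
    unfolding esq_def by (subst nn_integral_suminf) (auto simp: ennreal_mult nn_integral_cmult)
  also have "\<dots> \<le> (\<Sum>n. ennreal ((1/2) ^ n))"
  proof (intro suminf_le allI)
    fix n
    have "ennreal (2 ^ n) * esq M (D n) \<le> ennreal (2 ^ n) * ennreal ((1/4) ^ n)"
      by (intro mult_left_mono D) auto
    also have "\<dots> = ennreal ((1/2) ^ n)"
      by (simp flip: ennreal_mult power_mult_distrib)
    finally show "ennreal (2 ^ n) * esq M (D n) \<le> ennreal ((1/2) ^ n)" .
  qed auto
  also have "\<dots> = ennreal 2"
    using geometric_sums[of "1/2::real"] by (intro suminf_ennreal_eq) auto
  also have "\<dots> < \<infinity>" by simp
  finally have fin: "AE x in M. (\<Sum>n. ennreal (2 ^ n * (cmod (D n x))\<^sup>2)) \<noteq> \<infinity>"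
    by (intro nn_integral_PInf_AE) auto
  have conv: "AE x in M. convergent (\<lambda>n. F (k n) x)"
    using fin
  proof eventually_elim
    fix x assume "(\<Sum>n. ennreal (2 ^ n * (cmod (D n x))\<^sup>2)) \<noteq> \<infinity>"
    then have sm: "summable (\<lambda>n. 2 ^ n * (cmod (D n x))\<^sup>2)"
      by (intro summable_suminf_not_top) auto
    have "Bseq (\<lambda>n. 2 ^ n * (cmod (D n x))\<^sup>2)"
      by (rule convergent_imp_Bseq, rule convergentI, rule summable_LIMSEQ_zero[OF sm])
    then obtain C where C: "C > 0" "\<And>n. norm (2 ^ n * (cmod (D n x))\<^sup>2) \<le> C"
      by (rule BseqE) blast
    have "cmod (D n x) \<le> sqrt C * (1 / sqrt 2) ^ n" for n
    proof -
      have "(cmod (D n x))\<^sup>2 \<le> C / 2 ^ n"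
        using C(2)[of n] by (simp add: abs_mult pos_le_divide_eq mult.commute)
      then have "cmod (D n x) \<le> sqrt (C / 2 ^ n)" by (rule real_le_rsqrt)
      also have "\<dots> = sqrt C * (1 / sqrt 2) ^ n"
        by (simp only: real_sqrt_divide real_sqrt_power power_one_over) (simp only: times_divide_eq_right mult_1_right)
      finally show ?thesis .
    qed
    moreover have "summable (\<lambda>n. sqrt C * (1 / sqrt 2) ^ n)"
      by (rule summable_mult, rule summable_geometric) simp
    ultimately have "summable (\<lambda>n. D n x)"
      using summable_comparison_test'[of "\<lambda>n. sqrt C * (1 / sqrt 2) ^ n" 0 "\<lambda>n. D n x"] by blast
    then have conv: "convergent (\<lambda>n. F (k 0) x + (\<Sum>i<n. D i x))"
      by (intro convergent_add convergent_const) (simp only: summable_iff_convergent)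
    have eq: "(\<Sum>i<n. D i x) = F (k n) x - F (k 0) x" for n
      unfolding D_def by (rule sum_lessThan_telescope)
    from conv show "convergent (\<lambda>n. F (k n) x)" by (simp add: eq)
  qed
  define G where "G x = lim (\<lambda>n. F (k n) x)" for x
  have [measurable]: "G \<in> borel_measurable M"
    unfolding G_def[abs_def] by measurable
  have "AE x in M. (\<lambda>n. F (k n) x) \<longlonglongrightarrow> G x"
    using conv by eventually_elim (simp add: G_def convergent_LIMSEQ_iff)
  then have "(\<lambda>n. esq M (\<lambda>x. F n x - G x)) \<longlonglongrightarrow> 0"
    using cauchy by (intro esq_limit_of_Cauchy[where k = k] klim) auto
  then show ?thesis by (intro that[of G]) auto
qed

section \<open>The space \<open>L2\<close>\<close>

lemma L2_iff: "f \<in> L2 \<longleftrightarrow> f \<in> borel_measurable lborel \<and> esq lborel f < \<infinity>"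
  unfolding L2_def esq_def by (auto simp: integrable_iff_bounded)

lemma L2_measurable [measurable_dest]: "f \<in> L2 \<Longrightarrow> f \<in> borel_measurable borel"
  by (simp add: L2_def)

lemma L2_esq: "f \<in> L2 \<Longrightarrow> esq lborel f < \<infinity>"
  by (simp add: L2_iff)

lemma esq_L2: "f \<in> L2 \<Longrightarrow> esq lborel f = ennreal ((L2_norm f)\<^sup>2)"
  unfolding L2_norm_def L2_def esq_def by (subst nn_integral_eq_integral) auto

lemma L2_norm_nonneg [simp]: "L2_norm f \<ge> 0"
  by (simp add: L2_norm_def)

lemma L2_norm_eq_nrm: "f \<in> L2 \<Longrightarrow> L2_norm f = nrm lborel f"
  by (simp add: nrm_def esq_L2)

lemma L2_add [intro]: "f \<in> L2 \<Longrightarrow> g \<in> L2 \<Longrightarrow> (\<lambda>x. f x + g x) \<in> L2"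
  using esq_add_finite[of f lborel g] by (auto simp: L2_iff)

lemma L2_diff [intro]: "f \<in> L2 \<Longrightarrow> g \<in> L2 \<Longrightarrow> (\<lambda>x. f x - g x) \<in> L2"
  using esq_diff_finite[of f lborel g] by (auto simp: L2_iff)

lemma L2_cmult [intro]: "f \<in> L2 \<Longrightarrow> (\<lambda>x. c * f x) \<in> L2"
  unfolding L2_iff by (auto simp: esq_cmult ennreal_mult_less_top)

lemma L2_norm_cmult: "f \<in> L2 \<Longrightarrow> L2_norm (\<lambda>x. c * f x) = cmod c * L2_norm f"
  by (simp add: L2_norm_def norm_mult power_mult_distrib real_sqrt_mult)

lemma L2_complete:
  assumes F: "\<And>n. F n \<in> L2"
    and cauchy: "\<And>\<epsilon>::real. \<epsilon> > 0 \<Longrightarrow> \<exists>N. \<forall>m\<ge>N. \<forall>n\<ge>N. esq lborel (\<lambda>x. F m x - F n x) \<le> ennreal \<epsilon>"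
  obtains G where "G \<in> L2" "(\<lambda>n. esq lborel (\<lambda>x. F n x - G x)) \<longlonglongrightarrow> 0"
proof -
  have [measurable]: "F n \<in> borel_measurable lborel" for n using F by (simp add: L2_iff)
  obtain G where [measurable]: "G \<in> borel_measurable lborel" and G: "(\<lambda>n. esq lborel (\<lambda>x. F n x - G x)) \<longlonglongrightarrow> 0"
    by (rule Riesz_Fischer_esq[OF _ cauchy]) auto
  from order_tendstoD(2)[OF G, of 1] obtain n where "esq lborel (\<lambda>x. F n x - G x) < 1"
    by (auto simp: eventually_sequentially)
  then have "esq lborel (\<lambda>x. F n x - G x) < \<infinity>" by (rule less_trans) simp
  then have "esq lborel (\<lambda>x. F n x - (F n x - G x)) < \<infinity>"
    using L2_esq[OF F, of n] by - (rule esq_diff_finite, simp_all)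
  then have "G \<in> L2" by (simp add: L2_iff)
  with G show ?thesis by (rule that[rotated])
qed

lemma nn_integral_mult_le_esq:
  assumes [measurable]: "f \<in> borel_measurable M" "g \<in> borel_measurable M"
  shows "(\<integral>\<^sup>+x. ennreal (cmod (f x)) * ennreal (cmod (g x)) \<partial>M)\<^sup>2 \<le> esq M f * esq M g"
  using Cauchy_Schwarz_nn_integral[of "\<lambda>x. ennreal (cmod (f x))" M "\<lambda>x. ennreal (cmod (g x))"]
  by (simp add: esq_def ennreal_power)

lemma integrable_mult_cnj:
  assumes [measurable]: "f \<in> borel_measurable M" "g \<in> borel_measurable M"
    and "esq M f < \<infinity>" "esq M g < \<infinity>"
  shows "integrable M (\<lambda>x. f x * cnj (g x))"
proof -
  have "(\<integral>\<^sup>+x. ennreal (cmod (f x)) * ennreal (cmod (g x)) \<partial>M)\<^sup>2 < \<infinity>"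
    by (rule le_less_trans[OF nn_integral_mult_le_esq]) (use assms in \<open>auto simp: ennreal_mult_less_top\<close>)
  then have "(\<integral>\<^sup>+x. ennreal (cmod (f x)) * ennreal (cmod (g x)) \<partial>M) < \<infinity>"
    by (auto simp: less_top[symmetric] ennreal_top_mult power2_eq_square)
  moreover have "(\<lambda>x. f x * cnj (g x)) \<in> borel_measurable M" by measurable
  ultimately show ?thesis
    by (intro integrableI_bounded) (auto simp: norm_mult ennreal_mult)
qed

lemma L2_integrable_mult: "f \<in> L2 \<Longrightarrow> g \<in> L2 \<Longrightarrow> integrable lborel (\<lambda>x. f x * cnj (g x))"
  by (intro integrable_mult_cnj) (auto simp: L2_iff)

lemma L2_inner_add_left: "f \<in> L2 \<Longrightarrow> g \<in> L2 \<Longrightarrow> h \<in> L2 \<Longrightarrow> L2_inner (\<lambda>x. f x + g x) h = L2_inner f h + L2_inner g h"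
  unfolding L2_inner_def by (simp add: distrib_right L2_integrable_mult)

lemma L2_inner_diff_left: "f \<in> L2 \<Longrightarrow> g \<in> L2 \<Longrightarrow> h \<in> L2 \<Longrightarrow> L2_inner (\<lambda>x. f x - g x) h = L2_inner f h - L2_inner g h"
  unfolding L2_inner_def by (simp add: left_diff_distrib L2_integrable_mult)

lemma L2_inner_cmult_left: "L2_inner (\<lambda>x. c * f x) h = c * L2_inner f h"
  unfolding L2_inner_def by (simp add: mult.assoc)

lemma L2_inner_commute: "L2_inner f g = cnj (L2_inner g f)"
  unfolding L2_inner_def Bochner_Integration.integral_cnj[symmetric] by (simp add: mult.commute)

lemma cmod_L2_inner_commute: "cmod (L2_inner f g) = cmod (L2_inner g f)"
  by (subst L2_inner_commute) simp

lemma L2_inner_add_right: "f \<in> L2 \<Longrightarrow> g \<in> L2 \<Longrightarrow> h \<in> L2 \<Longrightarrow> L2_inner h (\<lambda>x. f x + g x) = L2_inner h f + L2_inner h g"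
  by (simp add: L2_inner_commute[of h] L2_inner_add_left)

lemma L2_inner_diff_right: "f \<in> L2 \<Longrightarrow> g \<in> L2 \<Longrightarrow> h \<in> L2 \<Longrightarrow> L2_inner h (\<lambda>x. f x - g x) = L2_inner h f - L2_inner h g"
  by (simp add: L2_inner_commute[of h] L2_inner_diff_left)

lemma L2_inner_cmult_right: "L2_inner h (\<lambda>x. c * f x) = cnj c * L2_inner h f"
  by (simp add: L2_inner_commute[of h] L2_inner_cmult_left)

lemma L2_inner_self: "L2_inner f f = of_real ((L2_norm f)\<^sup>2)"
  unfolding L2_inner_def L2_norm_def
  by (simp add: complex_norm_square[symmetric] flip: integral_complex_of_real of_real_power)

lemma cmod_L2_inner_le: "f \<in> L2 \<Longrightarrow> g \<in> L2 \<Longrightarrow> cmod (L2_inner f g) \<le> L2_norm f * L2_norm g"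
proof -
  assume f: "f \<in> L2" and g: "g \<in> L2"
  note [measurable] = f g
  have "ennreal (cmod (L2_inner f g)) \<le> (\<integral>\<^sup>+x. ennreal (cmod (f x)) * ennreal (cmod (g x)) \<partial>lborel)"
    unfolding L2_inner_def using integral_norm_bound_ennreal[OF L2_integrable_mult[OF f g]]
    by (simp add: norm_mult ennreal_mult)
  then have "(ennreal (cmod (L2_inner f g)))\<^sup>2 \<le> esq lborel f * esq lborel g"
    by (intro order.trans[OF power_mono nn_integral_mult_le_esq]) auto
  then have "(cmod (L2_inner f g))\<^sup>2 \<le> (L2_norm f * L2_norm g)\<^sup>2"
    by (simp add: esq_L2 f g ennreal_power power_mult_distrib flip: ennreal_mult)
  then show ?thesis by (rule power2_le_imp_le) simp
qed

section \<open>Strong continuity of dilations and translations\<close>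

lemma esq_dominated_convergence:
  assumes [measurable]: "\<And>n. F n \<in> borel_measurable M" "w \<in> borel_measurable M"
    and lim: "AE x in M. (\<lambda>n. F n x) \<longlonglongrightarrow> 0"
    and bd: "\<And>n. AE x in M. ennreal ((cmod (F n x))\<^sup>2) \<le> w x"
    and fin: "(\<integral>\<^sup>+x. w x \<partial>M) < \<infinity>"
  shows "(\<lambda>n. esq M (F n)) \<longlonglongrightarrow> 0"
proof -
  have "(\<lambda>n. \<integral>\<^sup>+x. ennreal ((cmod (F n x))\<^sup>2) \<partial>M) \<longlonglongrightarrow> (\<integral>\<^sup>+x. 0 \<partial>M)"
  proof (rule nn_integral_dominated_convergence[where w = w])
    show "AE x in M. (\<lambda>n. ennreal ((cmod (F n x))\<^sup>2)) \<longlonglongrightarrow> 0"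
      using lim
    proof eventually_elim
      fix x assume "(\<lambda>n. F n x) \<longlonglongrightarrow> 0"
      then have "(\<lambda>n. ennreal ((cmod (F n x))\<^sup>2)) \<longlonglongrightarrow> ennreal ((cmod 0)\<^sup>2)"
        by (intro tendsto_ennrealI tendsto_intros)
      then show "(\<lambda>n. ennreal ((cmod (F n x))\<^sup>2)) \<longlonglongrightarrow> 0" by simp
    qed
  qed (use bd fin in auto)
  then show ?thesis by (simp add: esq_def)
qed

lemma esq_truncate_tendsto:
  fixes f :: "'a::euclidean_space \<Rightarrow> complex"
  assumes [measurable]: "f \<in> borel_measurable borel" and fin: "esq lborel f < \<infinity>"
  shows "(\<lambda>n. esq lborel (\<lambda>x. f x - (if norm x \<le> real n \<and> cmod (f x) \<le> real n then f x else 0))) \<longlonglongrightarrow> 0"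
proof (rule esq_dominated_convergence)
  show "AE x in lborel. (\<lambda>n. f x - (if norm x \<le> real n \<and> cmod (f x) \<le> real n then f x else 0)) \<longlonglongrightarrow> 0"
  proof (rule AE_I2, rule tendsto_eventually)
    fix x
    show "\<forall>\<^sub>F n in sequentially. f x - (if norm x \<le> real n \<and> cmod (f x) \<le> real n then f x else 0) = 0"
      using eventually_ge_at_top[of "nat \<lceil>max (norm x) (cmod (f x))\<rceil>"]
      by eventually_elim auto
  qed
  show "(\<integral>\<^sup>+x. ennreal ((cmod (f x))\<^sup>2) \<partial>lborel) < \<infinity>" using fin by (simp add: esq_def)
qed (auto intro!: AE_I2)

lemma cball_sets_borel [measurable]: "cball a r \<in> sets borel" for a :: "'a::metric_space"
  by (intro borel_closed closed_cball)

lemma nn_integral_const_cball: "(\<integral>\<^sup>+x. ennreal c * indicator (cball a r) x \<partial>lborel) < \<infinity>"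
  for a :: "'a::euclidean_space"
  using emeasure_bounded_finite[of "cball a r"]
  by (subst nn_integral_cmult_indicator) (auto simp: ennreal_mult_less_top less_top)

lemma continuous_cutoff_approx:
  fixes f :: "'a::euclidean_space \<Rightarrow> complex"
  assumes [measurable]: "f \<in> borel_measurable borel" and R: "R > 0"
    and bd: "\<And>x. cmod (f x) \<le> R" and supp: "\<And>x. norm x > R \<Longrightarrow> f x = 0"
  obtains h where "\<And>n::nat. continuous_on UNIV (h n)" "\<And>n x. norm x > R + 1 \<Longrightarrow> h n x = 0"
    "\<And>n x. cmod (h n x) \<le> R" "(\<lambda>n. esq lborel (\<lambda>x. f x - h n x)) \<longlonglongrightarrow> 0"
proof -
  have "f \<in> borel_measurable lebesgue" by (simp add: measurable_completion)
  then have "f measurable_on UNIV" by (intro lebesgue_measurable_imp_measurable_on) auto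
  then obtain N g where N: "negligible N" and g: "\<And>n::nat. continuous_on UNIV (g n)"
    and lim: "\<And>x. x \<notin> N \<Longrightarrow> (\<lambda>n. g n x) \<longlonglongrightarrow> f x"
    unfolding measurable_on_def by auto
  \<comment> \<open>\<open>c\<close> is the radial projection onto the disc of radius
    \<open>R\<close>, and \<open>cut\<close> is a continuous cutoff equal to 1 on the ball of radius
    \<open>R\<close>. Both leave \<open>f\<close> unchanged; to the approximants \<open>g n\<close>,
    which come from measurability alone, they give the common bound and support that dominated
    convergence asks for.\<close>
  define c where "c z = z * complex_of_real (R / max R (cmod z))" for z :: complex
  define cut where "cut x = max 0 (min 1 (R + 1 - norm x))" for x :: 'a
  define h where "h n x = complex_of_real (cut x) * c (g n x)" for n x
  have c_cont: "continuous_on UNIV c"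
    unfolding c_def[abs_def] using R by (intro continuous_intros) auto
  have c_bd: "cmod (c z) \<le> R" for z
    using R by (auto simp: c_def norm_mult max_def abs_of_pos norm_divide field_simps)
  have cut01: "0 \<le> cut x" "cut x \<le> 1" for x by (auto simp: cut_def)
  have h_cont: "continuous_on UNIV (h n)" for n
    unfolding h_def[abs_def] cut_def[abs_def]
    by (intro continuous_intros continuous_on_compose2[OF c_cont g]) auto
  then have [measurable]: "h n \<in> borel_measurable borel" for n by (rule borel_measurable_continuous_onI)
  have h_supp: "h n x = 0" if "norm x > R + 1" for n x
    using that by (simp add: h_def cut_def)
  have h_bd: "cmod (h n x) \<le> R" for n x
  proof -
    have "cmod (h n x) = cut x * cmod (c (g n x))"
      using cut01 by (simp add: h_def norm_mult)
    also have "\<dots> \<le> 1 * R" using cut01 c_bd by (intro mult_mono) auto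
    finally show ?thesis by simp
  qed
  have "(\<lambda>n. esq lborel (\<lambda>x. f x - h n x)) \<longlonglongrightarrow> 0"
  proof (rule esq_dominated_convergence)
    have "N \<in> null_sets lebesgue" using N by (simp add: negligible_iff_null_sets)
    then have "AE x in lebesgue. x \<notin> N" by (rule AE_not_in)
    then have "AE x in lborel. x \<notin> N" by (simp add: AE_completion_iff)
    then show "AE x in lborel. (\<lambda>n. f x - h n x) \<longlonglongrightarrow> 0"
    proof eventually_elim
      fix x assume "x \<notin> N"
      then have "(\<lambda>n. g n x) \<longlonglongrightarrow> f x" by (rule lim)
      moreover have "isCont c (f x)" using c_cont by (simp add: continuous_on_eq_continuous_at)
      ultimately have "(\<lambda>n. c (g n x)) \<longlonglongrightarrow> c (f x)"
        by (rule isCont_tendsto_compose[rotated])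
      then have "(\<lambda>n. h n x) \<longlonglongrightarrow> complex_of_real (cut x) * c (f x)"
        unfolding h_def by (rule tendsto_mult[OF tendsto_const])
      also have "complex_of_real (cut x) * c (f x) = f x"
      proof (cases "norm x > R")
        case False
        then have "cut x = 1" by (simp add: cut_def)
        moreover have "c (f x) = f x" using bd[of x] R by (simp add: c_def max_def)
        ultimately show ?thesis by simp
      qed (simp add: supp c_def)
      finally have "(\<lambda>n. f x - h n x) \<longlonglongrightarrow> f x - f x" by (intro tendsto_intros)
      then show "(\<lambda>n. f x - h n x) \<longlonglongrightarrow> 0" by simp
    qed
    show "AE x in lborel. ennreal ((cmod (f x - h n x))\<^sup>2) \<le> ennreal ((2 * R)\<^sup>2) * indicator (cball 0 (R + 1)) x" for n
    proof (rule AE_I2)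
      fix x
      have "cmod (f x - h n x) \<le> 2 * R"
        using norm_triangle_ineq4[of "f x" "h n x"] bd[of x] h_bd[of n x] by simp
      then have "(cmod (f x - h n x))\<^sup>2 \<le> (2 * R)\<^sup>2" by (intro power_mono) auto
      then show "ennreal ((cmod (f x - h n x))\<^sup>2) \<le> ennreal ((2 * R)\<^sup>2) * indicator (cball 0 (R + 1)) x"
        using h_supp[of x n] supp[of x] R by (auto split: split_indicator intro!: ennreal_leI)
    qed
    show "(\<integral>\<^sup>+x. ennreal ((2 * R)\<^sup>2) * indicator (cball 0 (R + 1)) x \<partial>(lborel :: 'a measure)) < \<infinity>"
      by (rule nn_integral_const_cball)
  qed measurable
  then show ?thesis using that[of h] h_cont h_supp h_bd by blast
qed

text \<open>Truncation in domain and range first, then approximation of the bounded, compactly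
  supported function. The choice \<open>4 * \<delta> < \<epsilon>\<close> pays for the factors 2 of
  \<open>esq_add_le2\<close>.\<close>

lemma esq_dense_compact_support:
  fixes f :: "'a::euclidean_space \<Rightarrow> complex"
  assumes [measurable]: "f \<in> borel_measurable borel" and fin: "esq lborel f < \<infinity>" and e: "\<epsilon> > 0"
  obtains h R where "continuous_on UNIV h" "R > 0" "\<And>x. norm x > R \<Longrightarrow> h x = 0"
    "\<And>x. cmod (h x) \<le> R" "esq lborel (\<lambda>x. f x - h x) < \<epsilon>"
proof -
  obtain \<delta> where \<delta>: "\<delta> > 0" "4 * \<delta> < \<epsilon>"
  proof -
    obtain e' where e': "0 < e'" "e' < \<epsilon>" using dense[OF e] by blast
    then obtain r where r: "e' = ennreal r" "r > 0" by (cases e') auto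
    have "4 * ennreal (r / 4) = ennreal r"
      using ennreal_mult[of 4 "r / 4"] r by simp
    then show ?thesis using that[of "ennreal (r / 4)"] r e' by simp
  qed
  define T where "T n x = (if norm x \<le> real n \<and> cmod (f x) \<le> real n then f x else 0)" for n :: nat and x
  have [measurable]: "T n \<in> borel_measurable borel" for n unfolding T_def[abs_def] by measurable
  have "\<forall>\<^sub>F n in sequentially. esq lborel (\<lambda>x. f x - T n x) < \<delta>"
    using esq_truncate_tendsto[OF assms(1) fin] \<delta>(1) unfolding T_def by (rule order_tendstoD)
  then have "\<forall>\<^sub>F n in sequentially. esq lborel (\<lambda>x. f x - T n x) < \<delta> \<and> n > 0"
    using eventually_gt_at_top[of 0] by eventually_elim simp
  then obtain n where n: "esq lborel (\<lambda>x. f x - T n x) < \<delta>" "n > 0"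
    using eventually_happens'[OF sequentially_bot] by blast
  obtain h where h: "\<And>k::nat. continuous_on UNIV (h k)" "\<And>k x. norm x > real n + 1 \<Longrightarrow> h k x = 0"
    "\<And>k x. cmod (h k x) \<le> real n" "(\<lambda>k. esq lborel (\<lambda>x. T n x - h k x)) \<longlonglongrightarrow> 0"
  proof (rule continuous_cutoff_approx[of "T n" "real n"])
    show "cmod (T n x) \<le> real n" for x by (simp add: T_def)
    show "norm x > real n \<Longrightarrow> T n x = 0" for x by (simp add: T_def)
  qed (use n in auto)
  have [measurable]: "h k \<in> borel_measurable borel" for k using h(1) by (rule borel_measurable_continuous_onI)
  obtain k where k: "esq lborel (\<lambda>x. T n x - h k x) < \<delta>"
    using order_tendstoD(2)[OF h(4) \<delta>(1)] by (auto simp: eventually_sequentially)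
  have "esq lborel (\<lambda>x. (f x - T n x) + (T n x - h k x)) \<le>
      2 * esq lborel (\<lambda>x. f x - T n x) + 2 * esq lborel (\<lambda>x. T n x - h k x)"
    by (rule esq_add_le2) measurable
  also have "\<dots> \<le> 2 * \<delta> + 2 * \<delta>"
    using n k by (intro add_mono mult_left_mono) auto
  also have "\<dots> = 4 * \<delta>" by (simp flip: distrib_right)
  finally have "esq lborel (\<lambda>x. f x - h k x) < \<epsilon>" using \<delta>(2) by simp
  moreover have "cmod (h k x) \<le> real n + 1" for x using h(3)[of k x] by simp
  ultimately show ?thesis using h(1,2) by (intro that[of "h k" "real n + 1"]) auto
qed

lemma nn_integral_lborel_affine:
  fixes F :: "'a::euclidean_space \<Rightarrow> ennreal"
  assumes [measurable]: "F \<in> borel_measurable borel" and c: "c \<noteq> 0"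
  shows "(\<integral>\<^sup>+x. F x \<partial>lborel) = ennreal (\<bar>c\<bar> ^ DIM('a)) * (\<integral>\<^sup>+x. F (t + c *\<^sub>R x) \<partial>lborel)"
  by (subst lborel_affine[OF c, of t])
     (simp add: nn_integral_density nn_integral_distr nn_integral_cmult)

lemma integral_lborel_affine:
  fixes F :: "'a::euclidean_space \<Rightarrow> complex"
  assumes [measurable]: "F \<in> borel_measurable borel" and c: "c \<noteq> 0"
  shows "(LINT x|lborel. F x) = of_real (\<bar>c\<bar> ^ DIM('a)) * (LINT x|lborel. F (t + c *\<^sub>R x))"
  by (subst lborel_affine[OF c, of t])
     (simp add: integral_density integral_distr scaleR_conv_of_real)

lemma wavelet_eq:
  "wavelet \<phi> p x = complex_of_real (fst p powr (- (real CARD('d) / 2))) * \<phi> (inverse (fst p) *\<^sub>R x - snd p)"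
  for x :: "real ^ 'd"
  by (cases p) simp

lemma powr_half_sq: "a > 0 \<Longrightarrow> (a powr (- (real n / 2)))\<^sup>2 = inverse (a ^ n)"
  by (simp add: power2_eq_square powr_minus powr_realpow flip: powr_add inverse_mult_distrib)

lemma esq_wavelet:
  fixes \<phi> :: "real ^ 'd \<Rightarrow> complex"
  assumes [measurable]: "\<phi> \<in> borel_measurable borel" and p: "fst p > 0"
  shows "esq lborel (wavelet \<phi> p) = esq lborel \<phi>"
proof -
  let ?a = "fst p" and ?b = "snd p"
  have "esq lborel \<phi> = ennreal (inverse ?a ^ CARD('d)) *
      (\<integral>\<^sup>+x. ennreal ((cmod (\<phi> (- ?b + inverse ?a *\<^sub>R x)))\<^sup>2) \<partial>lborel)"
    unfolding esq_def using p by (subst nn_integral_lborel_affine[of _ "inverse ?a" "- ?b"]) auto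
  also have "\<dots> = esq lborel (wavelet \<phi> p)"
    unfolding esq_def wavelet_eq using p
    by (subst nn_integral_cmult[symmetric])
       (auto simp: norm_mult power_mult_distrib powr_half_sq power_inverse ennreal_mult intro!: nn_integral_cong)
  finally show ?thesis ..
qed

lemma borel_measurable_fst:
  fixes P :: "'a \<Rightarrow> 'b::topological_space \<times> 'c::topological_space"
  shows "P \<in> borel_measurable M \<Longrightarrow> (\<lambda>x. fst (P x)) \<in> borel_measurable M"
  by (rule measurable_compose[of P M borel fst]) (auto intro!: borel_measurable_continuous_onI continuous_intros)

lemma borel_measurable_snd:
  fixes P :: "'a \<Rightarrow> 'b::topological_space \<times> 'c::topological_space"
  shows "P \<in> borel_measurable M \<Longrightarrow> (\<lambda>x. snd (P x)) \<in> borel_measurable M"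
  by (rule measurable_compose[of P M borel snd]) (auto intro!: borel_measurable_continuous_onI continuous_intros)

lemma wavelet_measurable [measurable (raw)]:
  fixes \<phi> :: "real ^ 'd \<Rightarrow> complex"
  assumes [measurable]: "\<phi> \<in> borel_measurable borel" "P \<in> borel_measurable M" "X \<in> borel_measurable M"
  shows "(\<lambda>x. wavelet \<phi> (P x) (X x)) \<in> borel_measurable M"
proof -
  have [measurable]: "(\<lambda>x. inverse (fst (P x)) *\<^sub>R X x - snd (P x)) \<in> borel_measurable M"
    by (intro borel_measurable_diff borel_measurable_scaleR borel_measurable_inverse borel_measurable_fst
        borel_measurable_snd assms)
  have [measurable]: "(\<lambda>x. fst (P x) powr (- (real CARD('d) / 2))) \<in> borel_measurable M"
    by (intro powr_real_measurable borel_measurable_fst assms measurable_const) auto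
  have "(\<lambda>x. \<phi> (inverse (fst (P x)) *\<^sub>R X x - snd (P x))) \<in> borel_measurable M"
    by (rule measurable_compose[of _ M borel \<phi>]) measurable
  then show ?thesis unfolding wavelet_eq by measurable
qed

lemma wavelet_borel_measurable:
  fixes \<phi> :: "real ^ 'd \<Rightarrow> complex"
  assumes [measurable]: "\<phi> \<in> borel_measurable borel"
  shows "wavelet \<phi> p \<in> borel_measurable borel"
  unfolding wavelet_eq[abs_def] by measurable

lemma wavelet_L2: "\<phi> \<in> L2 \<Longrightarrow> fst p > 0 \<Longrightarrow> wavelet \<phi> p \<in> L2"
  unfolding L2_iff by (simp add: esq_wavelet wavelet_borel_measurable)

lemma L2_norm_wavelet: "\<phi> \<in> L2 \<Longrightarrow> fst p > 0 \<Longrightarrow> L2_norm (wavelet \<phi> p) = L2_norm \<phi>"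
  by (simp add: L2_norm_eq_nrm wavelet_L2 nrm_def esq_wavelet L2_measurable)

lemma wavelet_diff: "wavelet (\<lambda>x. f x - g x) p = (\<lambda>x. wavelet f p x - wavelet g p x)"
  by (auto simp: wavelet_eq fun_eq_iff right_diff_distrib)

text \<open>A convergent sequence of group elements keeps the scales bounded above and away from 0
  and the translations bounded. All the functions then live in one ball with one bound, and
  dominated convergence applies.\<close>

lemma wavelet_tendsto_compact_support:
  fixes g :: "real ^ 'd \<Rightarrow> complex"
  assumes cont: "continuous_on UNIV g" and supp: "\<And>x. norm x > R \<Longrightarrow> g x = 0" and bd: "\<And>x. cmod (g x) \<le> R"
    and lim: "P \<longlonglongrightarrow> q" and pos: "\<And>n. fst (P n) > 0" "fst q > 0"
  shows "(\<lambda>n. esq lborel (\<lambda>x. wavelet g (P n) x - wavelet g q x)) \<longlonglongrightarrow> 0"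
proof -
  have [measurable]: "g \<in> borel_measurable borel" using cont by (rule borel_measurable_continuous_onI)
  have lf: "(\<lambda>n. fst (P n)) \<longlonglongrightarrow> fst q" and ls: "(\<lambda>n. snd (P n)) \<longlonglongrightarrow> snd q"
    using tendsto_fst[OF lim] tendsto_snd[OF lim] by auto
  let ?s = "\<lambda>n. fst (P n) powr (- (real CARD('d) / 2))"
  have lp: "?s \<longlonglongrightarrow> fst q powr (- (real CARD('d) / 2))"
    by (intro tendsto_powr[OF lf tendsto_const]) (use pos(2) in auto)
  have lm: "(\<lambda>n. fst (P n) * (\<bar>R\<bar> + norm (snd (P n)))) \<longlonglongrightarrow> fst q * (\<bar>R\<bar> + norm (snd q))"
    by (intro tendsto_mult lf tendsto_add tendsto_const tendsto_norm ls)
  obtain B where B: "\<And>n. norm (?s n) \<le> B"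
    using convergent_imp_Bseq[OF convergentI[OF lp]] unfolding Bseq_def by blast
  obtain C where C: "\<And>n. norm (fst (P n) * (\<bar>R\<bar> + norm (snd (P n)))) \<le> C"
    using convergent_imp_Bseq[OF convergentI[OF lm]] unfolding Bseq_def by blast
  have B': "fst q powr (- (real CARD('d) / 2)) \<le> B"
    using lp B by (intro LIMSEQ_le_const2[OF lp]) (auto intro: order.trans[OF abs_ge_self])
  have C': "fst q * (\<bar>R\<bar> + norm (snd q)) \<le> C"
    using C by (intro LIMSEQ_le_const2[OF lm]) (auto intro: order.trans[OF abs_ge_self])
  have loc: "cmod (wavelet g p x) \<le> B * \<bar>R\<bar> \<and> (norm x > C \<longrightarrow> wavelet g p x = 0)"
    if p: "fst p > 0" "fst p powr (- (real CARD('d) / 2)) \<le> B" "fst p * (\<bar>R\<bar> + norm (snd p)) \<le> C" for p x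
  proof
    show "cmod (wavelet g p x) \<le> B * \<bar>R\<bar>"
      unfolding wavelet_eq norm_mult
    proof (rule mult_mono)
      show "cmod (g (inverse (fst p) *\<^sub>R x - snd p)) \<le> \<bar>R\<bar>"
        using bd[of "inverse (fst p) *\<^sub>R x - snd p"] by linarith
    qed (use p in \<open>auto intro: order.trans[OF powr_ge_zero]\<close>)
    show "norm x > C \<longrightarrow> wavelet g p x = 0"
    proof
      assume x: "norm x > C"
      then have "fst p * (\<bar>R\<bar> + norm (snd p)) < norm x" using p by simp
      then have "\<bar>R\<bar> + norm (snd p) < norm (inverse (fst p) *\<^sub>R x)"
        using p by (simp add: field_simps)
      also have "\<dots> \<le> norm (inverse (fst p) *\<^sub>R x - snd p) + norm (snd p)"
        using norm_triangle_ineq[of "inverse (fst p) *\<^sub>R x - snd p" "snd p"] by simp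
      finally have "R < norm (inverse (fst p) *\<^sub>R x - snd p)" by simp
      then show "wavelet g p x = 0" by (simp add: wavelet_eq supp)
    qed
  qed
  have locP: "cmod (wavelet g (P n) x) \<le> B * \<bar>R\<bar> \<and> (norm x > C \<longrightarrow> wavelet g (P n) x = 0)" for n x
    using B[of n] C[of n] pos(1)[of n] by (intro loc) (auto intro: order.trans[OF abs_ge_self])
  have locq: "cmod (wavelet g q x) \<le> B * \<bar>R\<bar> \<and> (norm x > C \<longrightarrow> wavelet g q x = 0)" for x
    using B' C' pos(2) by (intro loc)
  show ?thesis
  proof (rule esq_dominated_convergence)
    show "AE x in lborel. (\<lambda>n. wavelet g (P n) x - wavelet g q x) \<longlonglongrightarrow> 0"
    proof (rule AE_I2)
      fix x :: "real ^ 'd"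
      have "isCont g (inverse (fst q) *\<^sub>R x - snd q)" using cont by (simp add: continuous_on_eq_continuous_at)
      moreover have "(\<lambda>n. inverse (fst (P n)) *\<^sub>R x - snd (P n)) \<longlonglongrightarrow> inverse (fst q) *\<^sub>R x - snd q"
        by (intro tendsto_diff tendsto_scaleR tendsto_inverse lf ls tendsto_const) (use pos(2) in auto)
      ultimately have "(\<lambda>n. g (inverse (fst (P n)) *\<^sub>R x - snd (P n))) \<longlonglongrightarrow> g (inverse (fst q) *\<^sub>R x - snd q)"
        by (rule isCont_tendsto_compose)
      then have "(\<lambda>n. wavelet g (P n) x) \<longlonglongrightarrow> wavelet g q x"
        unfolding wavelet_eq by (intro tendsto_mult tendsto_of_real lp)
      then show "(\<lambda>n. wavelet g (P n) x - wavelet g q x) \<longlonglongrightarrow> 0" by (simp add: LIM_zero_iff)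
    qed
    show "AE x in lborel. ennreal ((cmod (wavelet g (P n) x - wavelet g q x))\<^sup>2) \<le>
        ennreal ((2 * (B * \<bar>R\<bar>))\<^sup>2) * indicator (cball 0 C) x" for n
    proof (rule AE_I2)
      fix x
      have "cmod (wavelet g (P n) x - wavelet g q x) \<le> 2 * (B * \<bar>R\<bar>)"
        using norm_triangle_ineq4[of "wavelet g (P n) x" "wavelet g q x"] locP[of n x] locq[of x] by linarith
      then have "(cmod (wavelet g (P n) x - wavelet g q x))\<^sup>2 \<le> (2 * (B * \<bar>R\<bar>))\<^sup>2"
        by (intro power_mono) auto
      then show "ennreal ((cmod (wavelet g (P n) x - wavelet g q x))\<^sup>2) \<le>
          ennreal ((2 * (B * \<bar>R\<bar>))\<^sup>2) * indicator (cball 0 C) x"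
        using locP[of n x] locq[of x] by (auto split: split_indicator intro!: ennreal_leI)
    qed
    show "(\<integral>\<^sup>+x. ennreal ((2 * (B * \<bar>R\<bar>))\<^sup>2) * indicator (cball 0 C) x \<partial>(lborel :: (real ^ 'd) measure)) < \<infinity>"
      by (rule nn_integral_const_cball)
  qed measurable
qed

text \<open>Every \<open>wavelet _ p\<close> is an isometry, so replacing the window by a continuous
  compactly supported one costs the same at all \<open>p\<close>. The shares
  \<open>\<epsilon> / 16\<close> and \<open>\<epsilon> / 4\<close> add up to
  \<open>\<epsilon>\<close> after the factors 2 of the splittings.\<close>

theorem wavelet_tendsto:
  fixes \<phi> :: "real ^ 'd \<Rightarrow> complex"
  assumes \<phi>: "\<phi> \<in> L2" and lim: "P \<longlonglongrightarrow> q" and pos: "\<And>n. fst (P n) > 0" "fst q > 0"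
  shows "(\<lambda>n. esq lborel (\<lambda>x. wavelet \<phi> (P n) x - wavelet \<phi> q x)) \<longlonglongrightarrow> 0"
proof (rule tendsto_0_ennrealI)
  fix \<epsilon> :: real assume e: "\<epsilon> > 0"
  note [measurable] = L2_measurable[OF \<phi>]
  have "esq lborel \<phi> < \<infinity>" by (rule L2_esq[OF \<phi>])
  then obtain g R where g: "continuous_on UNIV g" "R > 0" "\<And>x. norm x > R \<Longrightarrow> g x = 0"
    "\<And>x. cmod (g x) \<le> R" and close: "esq lborel (\<lambda>x. \<phi> x - g x) < ennreal (\<epsilon> / 16)"
    using esq_dense_compact_support[of \<phi> "ennreal (\<epsilon> / 16)"] e by auto
  have [measurable]: "g \<in> borel_measurable borel" using g(1) by (rule borel_measurable_continuous_onI)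
  have d: "esq lborel (\<lambda>x. wavelet \<phi> p x - wavelet g p x) \<le> ennreal (\<epsilon> / 16)" if "fst p > 0" for p
    using esq_wavelet[of "\<lambda>x. \<phi> x - g x" p] that close by (simp add: wavelet_diff)
  have "\<forall>\<^sub>F n in sequentially. esq lborel (\<lambda>x. wavelet g (P n) x - wavelet g q x) < ennreal (\<epsilon> / 4)"
    using wavelet_tendsto_compact_support[OF g(1,3,4) lim pos] by (rule order_tendstoD) (use e in auto)
  then show "\<forall>\<^sub>F n in sequentially. esq lborel (\<lambda>x. wavelet \<phi> (P n) x - wavelet \<phi> q x) \<le> ennreal \<epsilon>"
  proof eventually_elim
    fix n assume n: "esq lborel (\<lambda>x. wavelet g (P n) x - wavelet g q x) < ennreal (\<epsilon> / 4)"
    let ?A = "\<lambda>x. wavelet \<phi> (P n) x - wavelet g (P n) x"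
    let ?B = "\<lambda>x. wavelet \<phi> q x - wavelet g q x"
    let ?C = "\<lambda>x. wavelet g (P n) x - wavelet g q x"
    have "esq lborel (\<lambda>x. (?A x - ?B x) + ?C x) \<le> 2 * esq lborel (\<lambda>x. ?A x - ?B x) + 2 * esq lborel ?C"
      by (rule esq_add_le2) measurable
    also have "\<dots> \<le> 2 * (2 * esq lborel ?A + 2 * esq lborel ?B) + 2 * esq lborel ?C"
      by (intro add_mono mult_left_mono esq_diff_le2) auto
    also have "\<dots> \<le> 2 * (2 * ennreal (\<epsilon> / 16) + 2 * ennreal (\<epsilon> / 16)) + 2 * ennreal (\<epsilon> / 4)"
      using n d[of "P n"] d[of q] pos by (intro add_mono mult_left_mono) auto
    also have "\<dots> = ennreal \<epsilon>"
      using e ennreal_mult[of 16 "\<epsilon> / 16"] ennreal_mult[of 4 "\<epsilon> / 16"]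
      by (simp add: distrib_left flip: distrib_right mult.assoc)
    finally show "esq lborel (\<lambda>x. wavelet \<phi> (P n) x - wavelet \<phi> q x) \<le> ennreal \<epsilon>" by (simp add: algebra_simps)
  qed
qed

corollary translation_tendsto:
  fixes \<phi> :: "real ^ 'd \<Rightarrow> complex"
  assumes "\<phi> \<in> L2" and "B \<longlonglongrightarrow> 0"
  shows "(\<lambda>n. esq lborel (\<lambda>x. \<phi> (x - B n) - \<phi> x)) \<longlonglongrightarrow> 0"
proof -
  have "(\<lambda>n. (1 :: real, B n)) \<longlonglongrightarrow> (1, 0)" by (intro tendsto_Pair tendsto_const assms(2))
  from wavelet_tendsto[OF assms(1) this] show ?thesis by simp
qed

section \<open>Plancherel's identity\<close>

lemma cis_measurable [measurable]:
  "f \<in> borel_measurable M \<Longrightarrow> (\<lambda>x. cis (f x)) \<in> borel_measurable M"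
  using borel_measurable_continuous_onI[of cis] by (rule measurable_compose[rotated]) (intro continuous_intros)

lemma lborel_pair_integrable:
  fixes f :: "'a::euclidean_space \<Rightarrow> 'b::euclidean_space \<Rightarrow> complex"
  assumes [measurable]: "case_prod f \<in> borel_measurable (lborel \<Otimes>\<^sub>M lborel)"
    and fin: "(\<integral>\<^sup>+x. \<integral>\<^sup>+y. ennreal (cmod (f x y)) \<partial>lborel \<partial>lborel) < \<infinity>"
  shows "integrable (lborel \<Otimes>\<^sub>M lborel) (case_prod f)"
proof (rule integrableI_bounded)
  have "(\<integral>\<^sup>+z. ennreal (cmod (case_prod f z)) \<partial>(lborel \<Otimes>\<^sub>M lborel)) =
      (\<integral>\<^sup>+x. \<integral>\<^sup>+y. ennreal (cmod (f x y)) \<partial>lborel \<partial>lborel)"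
    by (subst lborel.nn_integral_fst[symmetric]) auto
  with fin show "(\<integral>\<^sup>+z. ennreal (norm (case_prod f z)) \<partial>(lborel \<Otimes>\<^sub>M lborel)) < \<infinity>" by simp
qed measurable

lemma lborel_Fubini:
  fixes f :: "'a::euclidean_space \<Rightarrow> 'b::euclidean_space \<Rightarrow> complex"
  assumes "case_prod f \<in> borel_measurable (lborel \<Otimes>\<^sub>M lborel)"
    and "(\<integral>\<^sup>+x. \<integral>\<^sup>+y. ennreal (cmod (f x y)) \<partial>lborel \<partial>lborel) < \<infinity>"
  shows "(LINT y|lborel. LINT x|lborel. f x y) = (LINT x|lborel. LINT y|lborel. f x y)"
  by (rule lborel_pair.Fubini_integral[OF lborel_pair_integrable[OF assms]])

lemma fourier_measurable [measurable]:
  fixes f :: "real ^ 'd \<Rightarrow> complex"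
  assumes [measurable]: "f \<in> borel_measurable borel"
  shows "fourier_integral f \<in> borel_measurable borel"
proof -
  have "(\<lambda>\<xi>. LINT x|lborel. cis (- 2 * pi * (x \<bullet> \<xi>)) * f x) \<in> borel_measurable lborel"
    by (rule lborel.borel_measurable_lebesgue_integral) measurable
  then show ?thesis by (simp add: fourier_integral_def[abs_def])
qed

lemma fourier_bound:
  fixes f :: "real ^ 'd \<Rightarrow> complex"
  shows "cmod (fourier_integral f \<xi>) \<le> (LINT x|lborel. cmod (f x))"
  unfolding fourier_integral_def
  using integral_norm_bound[of lborel "\<lambda>x. cis (- 2 * pi * (x \<bullet> \<xi>)) * f x"] by (simp add: norm_mult)

lemma integrable_cis_mult:
  fixes f :: "real ^ 'd \<Rightarrow> complex"
  assumes "integrable lborel f"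
  shows "integrable lborel (\<lambda>x. cis (c * (x \<bullet> \<xi>)) * f x)"
proof (rule Bochner_Integration.integrable_bound[OF assms])
  note [measurable] = borel_measurable_integrable[OF assms]
  show "(\<lambda>x. cis (c * (x \<bullet> \<xi>)) * f x) \<in> borel_measurable lborel" by measurable
qed (simp add: norm_mult)

text \<open>Fubini, since the phase is symmetric in the two variables. The Gaussian energy identity
  uses this transfer twice: once for the outer integral and once to recognize a convolution.\<close>

lemma fourier_multiplication:
  fixes f h :: "real ^ 'd \<Rightarrow> complex"
  assumes f: "integrable lborel f" and h: "integrable lborel h"
  shows "(LINT \<xi>|lborel. fourier_integral f \<xi> * h \<xi>) = (LINT x|lborel. f x * fourier_integral h x)"
proof -
  note [measurable] = borel_measurable_integrable[OF f, simplified] borel_measurable_integrable[OF h, simplified]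
  have fin: "(\<integral>\<^sup>+x. ennreal (cmod (f x)) \<partial>lborel) < \<infinity>" "(\<integral>\<^sup>+x. ennreal (cmod (h x)) \<partial>lborel) < \<infinity>"
    using f h by (simp_all add: integrable_iff_bounded)
  have "(LINT \<xi>|lborel. fourier_integral f \<xi> * h \<xi>) =
      (LINT \<xi>|lborel. LINT x|lborel. cis (- 2 * pi * (x \<bullet> \<xi>)) * f x * h \<xi>)"
    unfolding fourier_integral_def by (simp only: integral_mult_left_zero)
  also have "\<dots> = (LINT x|lborel. LINT \<xi>|lborel. cis (- 2 * pi * (x \<bullet> \<xi>)) * f x * h \<xi>)"
  proof (rule lborel_Fubini)
    have "(\<integral>\<^sup>+x. \<integral>\<^sup>+\<xi>. ennreal (cmod (cis (- 2 * pi * (x \<bullet> \<xi>)) * f x * h \<xi>)) \<partial>lborel \<partial>lborel) =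
        (\<integral>\<^sup>+x. ennreal (cmod (f x)) * (\<integral>\<^sup>+\<xi>. ennreal (cmod (h \<xi>)) \<partial>lborel) \<partial>lborel)"
      by (intro nn_integral_cong) (simp add: norm_mult ennreal_mult nn_integral_cmult)
    also have "\<dots> = (\<integral>\<^sup>+x. ennreal (cmod (f x)) \<partial>lborel) * (\<integral>\<^sup>+\<xi>. ennreal (cmod (h \<xi>)) \<partial>lborel)"
      by (simp add: nn_integral_multc)
    also have "\<dots> < \<infinity>" using fin by (simp add: ennreal_mult_less_top)
    finally show "(\<integral>\<^sup>+x. \<integral>\<^sup>+\<xi>. ennreal (cmod (cis (- 2 * pi * (x \<bullet> \<xi>)) * f x * h \<xi>)) \<partial>lborel \<partial>lborel) < \<infinity>" .
  qed measurable
  also have "\<dots> = (LINT x|lborel. f x * (LINT \<xi>|lborel. cis (- 2 * pi * (\<xi> \<bullet> x)) * h \<xi>))"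
    by (simp add: inner_commute mult.assoc mult.left_commute[of _ "f _"] flip: integral_mult_right_zero)
  finally show ?thesis by (simp add: fourier_integral_def)
qed

section \<open>Gaussians and their Fourier transforms\<close>

lemma norm_sq_Basis: "(norm y)\<^sup>2 = (\<Sum>b\<in>Basis. (y \<bullet> b)\<^sup>2)" for y :: "'a::euclidean_space"
  unfolding power2_norm_eq_inner by (subst euclidean_inner) (simp add: power2_eq_square)

text \<open>Density of the standard normal law in Euclidean space, written as a product over the
  basis so that its integrals reduce to one-dimensional ones known from probability;
  \<open>gauss_eq\<close> is the radial form.\<close>

definition gauss :: "'a::euclidean_space \<Rightarrow> real" where
  "gauss y = (\<Prod>b\<in>Basis. std_normal_density (y \<bullet> b))"

lemma gauss_eq: "gauss y = (1 / sqrt (2 * pi)) ^ DIM('a) * exp (- (norm y)\<^sup>2 / 2)"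
  for y :: "'a::euclidean_space"
proof -
  have "exp (- (norm y)\<^sup>2 / 2) = (\<Prod>b\<in>Basis. exp (- (y \<bullet> b)\<^sup>2 / 2))"
    by (simp add: norm_sq_Basis exp_sum[symmetric] sum_negf sum_divide_distrib)
  then show ?thesis
    by (simp only: gauss_def std_normal_density_def prod.distrib prod_constant)
qed

lemma gauss_nonneg: "gauss y \<ge> 0"
  unfolding gauss_def by (intro prod_nonneg) (auto intro: normal_density_nonneg)

lemma gauss_measurable [measurable]: "(gauss :: 'a::euclidean_space \<Rightarrow> real) \<in> borel_measurable borel"
  unfolding gauss_def[abs_def] by measurable

lemma nn_integral_gauss: "(\<integral>\<^sup>+y. ennreal (gauss (y :: 'a::euclidean_space)) \<partial>lborel) = 1"
proof -
  have "(\<integral>\<^sup>+y. ennreal (gauss (y :: 'a)) \<partial>lborel) = (\<integral>\<^sup>+y. (\<Prod>b\<in>Basis. ennreal (std_normal_density ((y :: 'a) \<bullet> b))) \<partial>lborel)"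
    unfolding gauss_def by (subst prod_ennreal) (auto intro: normal_density_nonneg)
  also have "\<dots> = (\<Prod>b\<in>(Basis :: 'a set). \<integral>\<^sup>+x. ennreal (std_normal_density x) \<partial>lborel)"
    by (rule nn_integral_lborel_prod) auto
  also have "(\<integral>\<^sup>+x. ennreal (std_normal_density x) \<partial>lborel) = 1"
    by (subst nn_integral_eq_integral) (auto intro: normal_density_nonneg)
  finally show ?thesis by simp
qed

lemma integrable_gauss: "integrable lborel (gauss :: 'a::euclidean_space \<Rightarrow> real)"
  by (rule integrableI_bounded) (simp_all add: nn_integral_gauss gauss_nonneg)

lemma integral_gauss: "(LINT y|lborel. gauss (y :: 'a::euclidean_space)) = 1"
  by (subst integral_eq_nn_integral) (auto simp: nn_integral_gauss gauss_nonneg)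

lemma cis_sum: "finite A \<Longrightarrow> cis (\<Sum>i\<in>A. f i) = (\<Prod>i\<in>A. cis (f i))"
  by (induction rule: finite_induct) (auto simp: cis_mult[symmetric])

text \<open>\<open>lborel\<close> is the image of a product of real Lebesgue measures under the
  coordinate expansion, and the integrand factors along it; each factor is the characteristic
  function of the standard normal distribution.\<close>

lemma char_gauss:
  fixes t :: "'a::euclidean_space"
  shows "(LINT y|lborel. cis (t \<bullet> y) * complex_of_real (gauss y)) = complex_of_real (exp (- (norm t)\<^sup>2 / 2))"
proof -
  interpret product_sigma_finite "\<lambda>_::'a. lborel :: real measure" ..
  let ?h = "\<lambda>b x. cis ((t \<bullet> b) * x) * complex_of_real (std_normal_density x)"
  have int: "integrable lborel (?h b)" for b
    by (rule Bochner_Integration.integrable_bound[OF integrable_normal_density[of 1 0]])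
       (auto simp: norm_mult normal_density_nonneg)
  have one: "(LINT x|lborel. ?h b x) = complex_of_real (exp (- ((t \<bullet> b)^2) / 2))" for b
  proof -
    have "complex_of_real (exp (- ((t \<bullet> b)^2) / 2)) = char std_normal_distribution (t \<bullet> b)"
      by (simp add: char_std_normal_distribution)
    also have "\<dots> = (LINT x|lborel. std_normal_density x *\<^sub>R iexp ((t \<bullet> b) * x))"
      unfolding char_def by (subst integral_density) (auto simp: normal_density_nonneg)
    also have "\<dots> = (LINT x|lborel. ?h b x)"
      by (simp add: cis_conv_exp scaleR_conv_of_real mult.commute)
    finally show ?thesis ..
  qed
  have "(LINT y|lborel. cis (t \<bullet> y) * complex_of_real (gauss y)) = (LINT y|lborel. (\<Prod>b\<in>Basis. ?h b (y \<bullet> b)))"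
  proof -
    have "cis (t \<bullet> y) = (\<Prod>b\<in>Basis. cis ((t \<bullet> b) * (y \<bullet> b)))" for y
      by (subst euclidean_inner) (simp add: cis_sum)
    then show ?thesis by (simp add: gauss_def prod.distrib)
  qed
  also have "\<dots> = (LINT f|Pi\<^sub>M Basis (\<lambda>_::'a. lborel :: real measure). (\<Prod>b\<in>Basis. ?h b ((\<Sum>c\<in>Basis. f c *\<^sub>R c) \<bullet> b)))"
    by (subst lborel_eq) (subst integral_distr, auto)
  also have "\<dots> = (LINT f|Pi\<^sub>M Basis (\<lambda>_::'a. lborel :: real measure). (\<Prod>b\<in>Basis. ?h b (f b)))"
    by (intro Bochner_Integration.integral_cong prod.cong) (auto simp: inner_sum_left inner_Basis if_distrib cong: if_cong)
  also have "\<dots> = (\<Prod>b\<in>(Basis::'a set). (LINT x|lborel. ?h b x))"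
    by (rule product_integral_prod) (auto intro: int)
  also have "\<dots> = complex_of_real (\<Prod>b\<in>Basis. exp (- ((t \<bullet> b)^2) / 2))"
    by (simp add: one)
  also have "(\<Prod>b\<in>Basis. exp (- ((t \<bullet> b)^2) / 2)) = exp (- (norm t)\<^sup>2 / 2)"
    by (simp add: norm_sq_Basis exp_sum[symmetric] sum_negf sum_divide_distrib)
  finally show ?thesis .
qed

text \<open>The right-hand side is a Gaussian of total mass 1 at scale \<open>s / (2 * pi)\<close>,
  hence an approximate identity as \<open>s\<close> tends to 0, while the weight being transformed
  tends to 1.\<close>

lemma fourier_gauss:
  fixes z :: "real ^ 'd"
  assumes s: "s > 0"
  shows "fourier_integral (\<lambda>\<xi>. complex_of_real (exp (- (s * norm \<xi>)\<^sup>2 / 2))) z =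
    complex_of_real ((2 * pi / s) ^ CARD('d) * gauss ((2 * pi / s) *\<^sub>R z))"
proof -
  let ?d = "CARD('d)"
  let ?C = "sqrt (2 * pi) ^ ?d"
  have w: "exp (- (s * norm \<xi>)\<^sup>2 / 2) = ?C * gauss (s *\<^sub>R \<xi>)" for \<xi> :: "real ^ 'd"
    using s by (simp add: gauss_eq power_one_over)
  have "fourier_integral (\<lambda>\<xi>. complex_of_real (exp (- (s * norm \<xi>)\<^sup>2 / 2))) z =
      ?C * (LINT \<xi>|lborel. cis (- 2 * pi * (\<xi> \<bullet> z)) * complex_of_real (gauss (s *\<^sub>R \<xi>)))"
    unfolding fourier_integral_def w by (simp add: mult.left_commute[of _ "complex_of_real ?C"] flip: of_real_power)
  also have "(LINT \<xi>|lborel. cis (- 2 * pi * (\<xi> \<bullet> z)) * complex_of_real (gauss (s *\<^sub>R \<xi>))) =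
      complex_of_real (inverse s ^ ?d) * (LINT y|lborel. cis (((- 2 * pi / s) *\<^sub>R z) \<bullet> y) * complex_of_real (gauss y))"
    using s
    by (subst integral_lborel_affine[of _ "inverse s" 0]) (auto simp: inner_commute divide_inverse mult.assoc)
  also have "\<dots> = complex_of_real (inverse s ^ ?d * exp (- (norm ((2 * pi / s) *\<^sub>R z))\<^sup>2 / 2))"
    unfolding char_gauss by simp
  also have "exp (- (norm ((2 * pi / s) *\<^sub>R z))\<^sup>2 / 2) = ?C * gauss ((2 * pi / s) *\<^sub>R z)"
    by (simp add: gauss_eq power_one_over)
  finally have eq: "fourier_integral (\<lambda>\<xi>. complex_of_real (exp (- (s * norm \<xi>)\<^sup>2 / 2))) z =
      complex_of_real (?C * (inverse s ^ ?d * (?C * gauss ((2 * pi / s) *\<^sub>R z))))"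
    by simp
  have CC: "?C * ?C = (2 * pi) ^ ?d"
    by (simp only: power_mult_distrib[symmetric]) simp
  have "?C * (inverse s ^ ?d * (?C * g)) = (2 * pi / s) ^ ?d * g" for g
  proof -
    have "?C * (inverse s ^ ?d * (?C * g)) = (?C * ?C) * inverse s ^ ?d * g"
      by (simp only: mult_ac)
    also have "\<dots> = (2 * pi / s) ^ ?d * g"
      by (simp only: CC divide_inverse power_mult_distrib)
    finally show ?thesis .
  qed
  with eq show ?thesis by (simp only:)
qed

lemma integrable_gauss_weight:
  assumes s: "s > 0"
  shows "integrable lborel (\<lambda>\<xi>::real ^ 'd. exp (- (s * norm \<xi>)\<^sup>2 / 2))"
proof -
  have "integrable lborel (\<lambda>\<xi>::real ^ 'd. sqrt (2 * pi) ^ CARD('d) * gauss (s *\<^sub>R \<xi>))"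
  proof (intro integrable_mult_right integrableI_bounded)
    have "(\<integral>\<^sup>+y. ennreal (gauss (y :: real ^ 'd)) \<partial>lborel) = ennreal (\<bar>s\<bar> ^ DIM(real ^ 'd)) * (\<integral>\<^sup>+x. ennreal (gauss (0 + s *\<^sub>R (x :: real ^ 'd))) \<partial>lborel)"
      by (rule nn_integral_lborel_affine) (use s in auto)
    then have "(\<integral>\<^sup>+x. ennreal (gauss (s *\<^sub>R (x :: real ^ 'd))) \<partial>lborel) \<noteq> \<infinity>"
      using s by (auto simp: nn_integral_gauss ennreal_mult_top)
    then show "(\<integral>\<^sup>+x. ennreal (norm (gauss (s *\<^sub>R (x :: real ^ 'd)))) \<partial>lborel) < \<infinity>"
      by (simp add: gauss_nonneg less_top)
  qed measurable
  also have "(\<lambda>\<xi>::real ^ 'd. sqrt (2 * pi) ^ CARD('d) * gauss (s *\<^sub>R \<xi>)) = (\<lambda>\<xi>. exp (- (s * norm \<xi>)\<^sup>2 / 2))"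
    using s by (simp add: gauss_eq power_one_over fun_eq_iff)
  finally show ?thesis .
qed

lemma ennreal_power2_le_imp_le:
  fixes x y :: ennreal
  assumes "x\<^sup>2 \<le> y\<^sup>2"
  shows "x \<le> y"
proof (cases y)
  case (real r)
  with assms have "x\<^sup>2 < \<infinity>" by (auto simp: ennreal_power intro: le_less_trans)
  then obtain t where t: "x = ennreal t" "t \<ge> 0"
    by (cases x) (auto simp: power_eq_top_ennreal)
  with real assms have "t\<^sup>2 \<le> r\<^sup>2" by (simp add: ennreal_power)
  then show ?thesis using t real by (auto intro: ennreal_leI power2_le_imp_le)
qed simp

lemma nn_integral_lborel_reflect:
  fixes F :: "'a::euclidean_space \<Rightarrow> ennreal"
  assumes [measurable]: "F \<in> borel_measurable borel"
  shows "(\<integral>\<^sup>+x. F (t - x) \<partial>lborel) = (\<integral>\<^sup>+x. F x \<partial>lborel)"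
  using nn_integral_lborel_affine[of F "-1" t] by simp

lemma nn_integral_lborel_translate:
  fixes F :: "'a::euclidean_space \<Rightarrow> ennreal"
  assumes [measurable]: "F \<in> borel_measurable borel"
  shows "(\<integral>\<^sup>+x. F (t + x) \<partial>lborel) = (\<integral>\<^sup>+x. F x \<partial>lborel)"
  using nn_integral_lborel_affine[of F 1 t] by simp

lemma integral_lborel_reflect:
  fixes F :: "'a::euclidean_space \<Rightarrow> complex"
  assumes [measurable]: "F \<in> borel_measurable borel"
  shows "(LINT x|lborel. F (t - x)) = (LINT x|lborel. F x)"
  using integral_lborel_affine[of F "-1" t] by simp

section \<open>Autocorrelation and Gaussian regularization of the Fourier energy\<close>

lemma wavelet_translate: "wavelet f (1, b) = (\<lambda>x. f (x - b))"
  by (simp add: fun_eq_iff)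

lemma translate_L2: "f \<in> L2 \<Longrightarrow> (\<lambda>x. f (x - b)) \<in> L2" for f :: "real ^ 'd \<Rightarrow> complex"
  using wavelet_L2[of f "(1, b)"] by (simp add: wavelet_translate del: wavelet.simps)

lemma L2_norm_translate: "f \<in> L2 \<Longrightarrow> L2_norm (\<lambda>x. f (x - b)) = L2_norm f" for f :: "real ^ 'd \<Rightarrow> complex"
  using L2_norm_wavelet[of f "(1, b)"] by (simp add: wavelet_translate del: wavelet.simps)

lemma L2_inner_tendsto:
  assumes f: "f \<in> L2" and g: "\<And>n. g n \<in> L2" "h \<in> L2"
    and lim: "(\<lambda>n. esq lborel (\<lambda>x. g n x - h x)) \<longlonglongrightarrow> 0"
  shows "(\<lambda>n. L2_inner f (g n)) \<longlonglongrightarrow> L2_inner f h"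
proof -
  have "(\<lambda>n. L2_inner f (g n) - L2_inner f h) \<longlonglongrightarrow> 0"
  proof (rule Lim_null_comparison)
    show "(\<lambda>n. L2_norm f * nrm lborel (\<lambda>x. g n x - h x)) \<longlonglongrightarrow> 0"
      using nrm_diff_tendsto_0[OF lim] by (rule tendsto_mult_right_zero)
    show "\<forall>\<^sub>F n in sequentially. norm (L2_inner f (g n) - L2_inner f h) \<le> L2_norm f * nrm lborel (\<lambda>x. g n x - h x)"
    proof (rule always_eventually, rule allI)
      fix n
      show "norm (L2_inner f (g n) - L2_inner f h) \<le> L2_norm f * nrm lborel (\<lambda>x. g n x - h x)"
        using cmod_L2_inner_le[OF f L2_diff[OF g(1)[of n] g(2)]]
        by (simp add: L2_inner_diff_right f g L2_norm_eq_nrm L2_diff)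
    qed
  qed
  then show ?thesis by (simp add: LIM_zero_iff)
qed

lemma L2_inner_tendsto_left:
  assumes "f \<in> L2" "\<And>n. g n \<in> L2" "h \<in> L2" "(\<lambda>n. esq lborel (\<lambda>x. g n x - h x)) \<longlonglongrightarrow> 0"
  shows "(\<lambda>n. L2_inner (g n) f) \<longlonglongrightarrow> L2_inner h f"
  using tendsto_cnj[OF L2_inner_tendsto[OF assms]] by (simp add: L2_inner_commute[of f])

text \<open>Formally the inverse transform of the squared modulus of
  \<open>fourier_integral f\<close>. Its value at 0 is the squared norm and it is continuous there,
  which is what Plancherel's identity needs from it.\<close>

definition autocorr :: "(real ^ 'd \<Rightarrow> complex) \<Rightarrow> real ^ 'd \<Rightarrow> complex" where
  "autocorr f z = L2_inner f (\<lambda>x. f (x - z))"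

lemma autocorr_measurable [measurable]:
  assumes [measurable]: "f \<in> borel_measurable borel"
  shows "autocorr f \<in> borel_measurable borel"
proof -
  have "(\<lambda>z. LINT x|lborel. f x * cnj (f (x - z))) \<in> borel_measurable lborel"
    by (rule lborel.borel_measurable_lebesgue_integral) measurable
  then show ?thesis by (simp add: autocorr_def[abs_def] L2_inner_def)
qed

lemma autocorr_bound: "f \<in> L2 \<Longrightarrow> cmod (autocorr f z) \<le> (L2_norm f)\<^sup>2"
  unfolding autocorr_def using cmod_L2_inner_le[OF _ translate_L2, of f f z]
  by (simp add: L2_norm_translate power2_eq_square)

lemma autocorr_tendsto:
  assumes "f \<in> L2" "z \<longlonglongrightarrow> 0"
  shows "(\<lambda>n. autocorr f (z n)) \<longlonglongrightarrow> complex_of_real ((L2_norm f)\<^sup>2)"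
  unfolding autocorr_def L2_inner_self[symmetric]
  by (intro L2_inner_tendsto translation_tendsto translate_L2 assms)

text \<open>The Gaussian weight makes the energy of the transform integrable before it is known to
  be finite. The multiplication formula moves the outer transform onto the conjugate transform times
  the weight, where it produces a convolution with a Gaussian; Fubini then brings out the
  autocorrelation.\<close>

lemma fourier_energy_gauss:
  fixes f :: "real ^ 'd \<Rightarrow> complex"
  assumes f2: "f \<in> L2" and f1: "integrable lborel f" and s: "s > 0"
  shows "(LINT \<xi>|lborel. fourier_integral f \<xi> * (cnj (fourier_integral f \<xi>) * complex_of_real (exp (- (s * norm \<xi>)\<^sup>2 / 2)))) =
    (LINT y|lborel. complex_of_real (gauss y) * autocorr f ((s / (2 * pi)) *\<^sub>R y))"
proof -
  note [measurable] = L2_measurable[OF f2]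
  let ?F = "fourier_integral f"
  define w where "w \<xi> = complex_of_real (exp (- (s * norm \<xi>)\<^sup>2 / 2))" for \<xi> :: "real ^ 'd"
  define W where "W = fourier_integral w"
  have w: "integrable lborel w"
    unfolding w_def[abs_def] by (intro integrable_of_real integrable_gauss_weight s)
  note [measurable] = borel_measurable_integrable[OF w, simplified]
  have [measurable]: "W \<in> borel_measurable borel" unfolding W_def by measurable
  have Fw: "integrable lborel (\<lambda>\<xi>. cnj (?F \<xi>) * w \<xi>)"
  proof (rule Bochner_Integration.integrable_bound)
    show "integrable lborel (\<lambda>\<xi>. complex_of_real (LINT x|lborel. cmod (f x)) * w \<xi>)"
      using w by (rule integrable_mult_right)
    have "(LINT x|lborel. cmod (f x)) \<ge> 0" by simp
    then show "AE \<xi> in lborel. norm (cnj (?F \<xi>) * w \<xi>) \<le> norm (complex_of_real (LINT x|lborel. cmod (f x)) * w \<xi>)"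
      by (intro AE_I2) (simp add: norm_mult mult_right_mono fourier_bound)
  qed measurable
  have inner: "fourier_integral (\<lambda>\<xi>. cnj (?F \<xi>) * w \<xi>) x = (LINT z|lborel. cnj (f (x - z)) * W z)" for x
  proof -
    \<comment> \<open>The conjugate of \<open>?F\<close> is itself a transform, namely that of
      \<open>g\<close>, and modulating the weight to \<open>h\<close> translates its transform by
      \<open>x\<close>. A second use of the multiplication formula turns the product into a
      convolution.\<close>
    define g where "g y = cnj (f (- y))" for y
    define h where "h \<xi> = cis (- 2 * pi * (\<xi> \<bullet> x)) * w \<xi>" for \<xi>
    have "integrable lborel (\<lambda>y. f (0 + (-1) *\<^sub>R y))"
    proof -
      have "(\<integral>\<^sup>+y. ennreal (cmod (f (0 - y))) \<partial>lborel) = (\<integral>\<^sup>+y. ennreal (cmod (f y)) \<partial>lborel)"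
        by (rule nn_integral_lborel_reflect) measurable
      then show ?thesis using f1 by (simp add: integrable_iff_bounded)
    qed
    then have g: "integrable lborel g" unfolding g_def[abs_def] by simp
    have h: "integrable lborel h" unfolding h_def[abs_def] by (rule integrable_cis_mult[OF w])
    have Fg: "fourier_integral g \<xi> = cnj (?F \<xi>)" for \<xi>
    proof -
      have "fourier_integral g \<xi> = (LINT y|lborel. cnj (cis (- 2 * pi * ((0 - y) \<bullet> \<xi>)) * f (0 - y)))"
        unfolding fourier_integral_def g_def by (intro Bochner_Integration.integral_cong) (auto simp: cis_cnj)
      also have "\<dots> = (LINT y|lborel. cnj (cis (- 2 * pi * (y \<bullet> \<xi>)) * f y))"
        by (rule integral_lborel_reflect) measurable
      finally show ?thesis by (simp only: fourier_integral_def Bochner_Integration.integral_cnj)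
    qed
    have Fh: "fourier_integral h y = W (x + y)" for y
    proof -
      have arg: "- 2 * pi * (\<xi> \<bullet> y) + - 2 * pi * (\<xi> \<bullet> x) = - 2 * pi * (\<xi> \<bullet> (x + y))" for \<xi>
        by (simp add: inner_add_right distrib_left)
      have "cis (- 2 * pi * (\<xi> \<bullet> y)) * h \<xi> = cis (- 2 * pi * (\<xi> \<bullet> (x + y))) * w \<xi>" for \<xi>
      proof -
        have "cis (- 2 * pi * (\<xi> \<bullet> y)) * h \<xi> = (cis (- 2 * pi * (\<xi> \<bullet> y)) * cis (- 2 * pi * (\<xi> \<bullet> x))) * w \<xi>"
          unfolding h_def by (rule mult.assoc[symmetric])
        then show ?thesis by (simp only: cis_mult arg)
      qed
      then show ?thesis unfolding fourier_integral_def W_def by simp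
    qed
    have "fourier_integral (\<lambda>\<xi>. cnj (?F \<xi>) * w \<xi>) x = (LINT \<xi>|lborel. fourier_integral g \<xi> * h \<xi>)"
      unfolding Fg fourier_integral_def[of _ x] h_def by (simp add: mult.left_commute)
    also have "\<dots> = (LINT y|lborel. g y * W (x + y))"
      unfolding fourier_multiplication[OF g h] Fh ..
    also have "\<dots> = (LINT z|lborel. cnj (f (x - z)) * W z)"
      using integral_lborel_affine[of "\<lambda>z. cnj (f (x - z)) * W z" 1 x] by (simp add: g_def)
    finally show ?thesis .
  qed
  have Wi: "W z = complex_of_real ((2 * pi / s) ^ CARD('d) * gauss ((2 * pi / s) *\<^sub>R z))" for z
    unfolding W_def w_def by (rule fourier_gauss[OF s])
  have intW: "(\<integral>\<^sup>+z. ennreal (cmod (W z)) \<partial>lborel) < \<infinity>"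
  proof -
    have "cmod (W z) = (2 * pi / s) ^ CARD('d) * gauss ((2 * pi / s) *\<^sub>R z)" for z
      unfolding Wi norm_of_real using s by (intro abs_of_nonneg mult_nonneg_nonneg gauss_nonneg) simp
    then have "(\<integral>\<^sup>+z. ennreal (cmod (W z)) \<partial>lborel) =
        ennreal ((2 * pi / s) ^ CARD('d)) * (\<integral>\<^sup>+z. ennreal (gauss (0 + (2 * pi / s) *\<^sub>R (z :: real ^ 'd))) \<partial>lborel)"
      using s by (simp add: ennreal_mult' nn_integral_cmult)
    also have "\<dots> = (\<integral>\<^sup>+y. ennreal (gauss (y :: real ^ 'd)) \<partial>lborel)"
      using s nn_integral_lborel_affine[of "\<lambda>y. ennreal (gauss (y :: real ^ 'd))" "2 * pi / s" 0] by simp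
    also have "\<dots> < \<infinity>" by (simp add: nn_integral_gauss)
    finally show ?thesis .
  qed
  have "(LINT \<xi>|lborel. ?F \<xi> * (cnj (?F \<xi>) * w \<xi>)) = (LINT x|lborel. f x * (LINT z|lborel. cnj (f (x - z)) * W z))"
    unfolding fourier_multiplication[OF f1 Fw] inner ..
  also have "\<dots> = (LINT x|lborel. LINT z|lborel. f x * cnj (f (x - z)) * W z)"
    by (simp only: integral_mult_right_zero mult.assoc)
  also have "\<dots> = (LINT z|lborel. LINT x|lborel. f x * cnj (f (x - z)) * W z)"
  proof (rule lborel_Fubini)
    have "(\<integral>\<^sup>+z. \<integral>\<^sup>+x. ennreal (cmod (f x * cnj (f (x - z)) * W z)) \<partial>lborel \<partial>lborel) \<le>
        (\<integral>\<^sup>+z. ennreal ((L2_norm f)\<^sup>2) * ennreal (cmod (W z)) \<partial>lborel)"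
    proof (intro nn_integral_mono)
      fix z
      let ?t = "\<lambda>x. f (x - z)"
      have "(\<integral>\<^sup>+x. ennreal (cmod (f x)) * ennreal (cmod (?t x)) \<partial>lborel)\<^sup>2 \<le> esq lborel f * esq lborel ?t"
        by (rule nn_integral_mult_le_esq) measurable
      also have "\<dots> = (ennreal ((L2_norm f)\<^sup>2))\<^sup>2"
        using f2 by (simp add: esq_L2 translate_L2 L2_norm_translate power2_eq_square)
      finally have "(\<integral>\<^sup>+x. ennreal (cmod (f x)) * ennreal (cmod (?t x)) \<partial>lborel) \<le> ennreal ((L2_norm f)\<^sup>2)"
        by (rule ennreal_power2_le_imp_le)
      then show "(\<integral>\<^sup>+x. ennreal (cmod (f x * cnj (f (x - z)) * W z)) \<partial>lborel) \<le> ennreal ((L2_norm f)\<^sup>2) * ennreal (cmod (W z))"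
        by (simp add: norm_mult ennreal_mult nn_integral_multc mult_right_mono)
    qed
    also have "\<dots> < \<infinity>" using intW by (simp add: nn_integral_cmult ennreal_mult_less_top)
    finally show "(\<integral>\<^sup>+z. \<integral>\<^sup>+x. ennreal (cmod (f x * cnj (f (x - z)) * W z)) \<partial>lborel \<partial>lborel) < \<infinity>" .
  qed measurable
  also have "\<dots> = (LINT z|lborel. autocorr f z * W z)"
    by (simp add: autocorr_def L2_inner_def)
  also have "\<dots> = complex_of_real (\<bar>s / (2 * pi)\<bar> ^ CARD('d)) * (LINT y|lborel. autocorr f (0 + (s / (2 * pi)) *\<^sub>R y) * W (0 + (s / (2 * pi)) *\<^sub>R y))"
    using s by (subst integral_lborel_affine[of _ "s / (2 * pi)" 0]) auto
  also have "\<dots> = (LINT y|lborel. complex_of_real (gauss y) * autocorr f ((s / (2 * pi)) *\<^sub>R y))"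
  proof -
    have "complex_of_real (\<bar>s / (2 * pi)\<bar> ^ CARD('d)) * (a * W (0 + (s / (2 * pi)) *\<^sub>R y)) = complex_of_real (gauss y) * a" for a y
    proof -
      have "\<bar>s / (2 * pi)\<bar> ^ CARD('d) * (2 * pi / s) ^ CARD('d) = 1"
        using s by (simp flip: power_mult_distrib)
      then have "complex_of_real (\<bar>s / (2 * pi)\<bar> ^ CARD('d)) * W (0 + (s / (2 * pi)) *\<^sub>R y) = complex_of_real (gauss y)"
        using s unfolding Wi of_real_mult[symmetric] by (simp flip: mult.assoc)
      then show ?thesis by (metis mult.assoc mult.commute)
    qed
    then show ?thesis by (simp only: flip: integral_mult_right_zero) simp
  qed
  finally show ?thesis by (simp add: w_def)
qed

text \<open>The width \<open>s = 1 / (n + 1)\<close> tends to 0. The weighted energy increases to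
  the full one by monotone convergence; the other side converges under the bound
  \<open>(L2_norm f)^2 * gauss y\<close>, since the autocorrelation tends to its value at 0.\<close>

theorem Plancherel:
  fixes f :: "real ^ 'd \<Rightarrow> complex"
  assumes f2: "f \<in> L2" and f1: "integrable lborel f"
  shows "esq lborel (fourier_integral f) = esq lborel f"
proof -
  note [measurable] = L2_measurable[OF f2]
  let ?F = "fourier_integral f"
  let ?s = "\<lambda>n. 1 / real (Suc n)"
  let ?w = "\<lambda>n \<xi>. exp (- (?s n * norm \<xi>)\<^sup>2 / 2)"
  have eq: "(\<integral>\<^sup>+\<xi>. ennreal ((cmod (?F \<xi>))\<^sup>2 * ?w n \<xi>) \<partial>lborel) =
      ennreal (Re (LINT y|lborel. complex_of_real (gauss y) * autocorr f ((?s n / (2 * pi)) *\<^sub>R y)))" for n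
  proof -
    have i: "integrable lborel (\<lambda>\<xi>. (cmod (?F \<xi>))\<^sup>2 * ?w n \<xi>)"
    proof (rule Bochner_Integration.integrable_bound)
      show "integrable lborel (\<lambda>\<xi>::real ^ 'd. (LINT x|lborel. cmod (f x))\<^sup>2 * ?w n \<xi>)"
        by (intro integrable_mult_right integrable_gauss_weight) simp
      show "AE \<xi> in lborel. norm ((cmod (?F \<xi>))\<^sup>2 * ?w n \<xi>) \<le> norm ((LINT x|lborel. cmod (f x))\<^sup>2 * ?w n \<xi>)"
        by (intro AE_I2) (simp add: abs_mult mult_right_mono power_mono fourier_bound)
    qed measurable
    have "(LINT y|lborel. complex_of_real (gauss y) * autocorr f ((?s n / (2 * pi)) *\<^sub>R y)) =
        (LINT \<xi>|lborel. complex_of_real ((cmod (?F \<xi>))\<^sup>2 * ?w n \<xi>))"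
      by (subst fourier_energy_gauss[OF f2 f1, symmetric])
         (auto simp: complex_norm_square[symmetric] mult.assoc[symmetric] simp del: of_real_power simp flip: of_real_mult)
    then have "Re (LINT y|lborel. complex_of_real (gauss y) * autocorr f ((?s n / (2 * pi)) *\<^sub>R y)) =
        (LINT \<xi>|lborel. (cmod (?F \<xi>))\<^sup>2 * ?w n \<xi>)"
      by (simp only: integral_complex_of_real Re_complex_of_real)
    then show ?thesis using i by (subst nn_integral_eq_integral) auto
  qed
  have "(\<lambda>n. \<integral>\<^sup>+\<xi>. ennreal ((cmod (?F \<xi>))\<^sup>2 * ?w n \<xi>) \<partial>lborel) \<longlonglongrightarrow> (\<integral>\<^sup>+\<xi>. ennreal ((cmod (?F \<xi>))\<^sup>2) \<partial>lborel)"
  proof (rule nn_integral_LIMSEQ)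
    show "incseq (\<lambda>n \<xi>. ennreal ((cmod (?F \<xi>))\<^sup>2 * ?w n \<xi>))"
      by (intro incseq_SucI le_funI ennreal_leI mult_left_mono)
         (auto intro!: power_mono mult_right_mono divide_left_mono)
    show "(\<lambda>n. ennreal ((cmod (?F \<xi>))\<^sup>2 * ?w n \<xi>)) \<longlonglongrightarrow> ennreal ((cmod (?F \<xi>))\<^sup>2)" for \<xi>
    proof -
      have "(\<lambda>n. (cmod (?F \<xi>))\<^sup>2 * ?w n \<xi>) \<longlonglongrightarrow> (cmod (?F \<xi>))\<^sup>2 * exp (- (0 * norm \<xi>)\<^sup>2 / 2)"
        by (intro tendsto_mult tendsto_const tendsto_exp tendsto_divide tendsto_minus tendsto_power LIMSEQ_Suc lim_1_over_n) auto
      then show ?thesis by (intro tendsto_ennrealI) simp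
    qed
  qed measurable
  moreover have "(\<lambda>n. \<integral>\<^sup>+\<xi>. ennreal ((cmod (?F \<xi>))\<^sup>2 * ?w n \<xi>) \<partial>lborel) \<longlonglongrightarrow> esq lborel f"
  proof -
    have "(\<lambda>n. LINT y|lborel. complex_of_real (gauss y) * autocorr f ((?s n / (2 * pi)) *\<^sub>R y)) \<longlonglongrightarrow>
        (LINT y|lborel. complex_of_real (gauss (y :: real ^ 'd)) * complex_of_real ((L2_norm f)\<^sup>2))"
    proof (rule integral_dominated_convergence)
      show "integrable lborel (\<lambda>y::real ^ 'd. gauss y * (L2_norm f)\<^sup>2)"
        by (intro integrable_mult_left integrable_gauss)
      show "AE y in lborel. (\<lambda>n. complex_of_real (gauss y) * autocorr f ((?s n / (2 * pi)) *\<^sub>R y)) \<longlonglongrightarrow>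
          complex_of_real (gauss y) * complex_of_real ((L2_norm f)\<^sup>2)"
      proof (intro AE_I2 tendsto_mult tendsto_const autocorr_tendsto[OF f2])
        fix y :: "real ^ 'd"
        have "(\<lambda>n. (?s n / (2 * pi)) *\<^sub>R y) \<longlonglongrightarrow> (0 / (2 * pi)) *\<^sub>R y"
          by (intro tendsto_scaleR tendsto_divide tendsto_const LIMSEQ_Suc lim_1_over_n) auto
        then show "(\<lambda>n. (?s n / (2 * pi)) *\<^sub>R y) \<longlonglongrightarrow> 0" by simp
      qed
      show "AE y in lborel. norm (complex_of_real (gauss y) * autocorr f ((?s n / (2 * pi)) *\<^sub>R y)) \<le> gauss y * (L2_norm f)\<^sup>2" for n
        by (intro AE_I2) (auto simp: norm_mult gauss_nonneg intro!: mult_left_mono autocorr_bound[OF f2])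
    qed measurable
    also have "(LINT y|lborel. complex_of_real (gauss (y :: real ^ 'd)) * complex_of_real ((L2_norm f)\<^sup>2)) = complex_of_real ((L2_norm f)\<^sup>2)"
      by (simp add: integral_gauss flip: of_real_mult of_real_power)
    finally have "(\<lambda>n. ennreal (Re (LINT y|lborel. complex_of_real (gauss y) * autocorr f ((?s n / (2 * pi)) *\<^sub>R y)))) \<longlonglongrightarrow>
        ennreal (Re (complex_of_real ((L2_norm f)\<^sup>2)))"
      by (intro tendsto_ennrealI tendsto_Re)
    then show ?thesis unfolding eq by (simp add: esq_L2[OF f2])
  qed
  ultimately show ?thesis unfolding esq_def[of _ ?F] by (rule LIMSEQ_unique)
qed

section \<open>The isometry property of the wavelet transform\<close>

lemma grp_iff: "p \<in> grp \<longleftrightarrow> fst p > 0"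
  by (cases p) (auto simp: grp_def)

lemma grp_borel [measurable]: "(grp :: (real \<times> (real ^ 'd)) set) \<in> sets borel"
  unfolding grp_def by (intro borel_open open_Times) auto

lemma space_haar [simp]: "space haar = grp"
  by (simp add: haar_def space_restrict_space)

lemma borel_measurable_haar:
  "F \<in> borel_measurable borel \<Longrightarrow> F \<in> borel_measurable (haar :: (real \<times> (real ^ 'd)) measure)"
  unfolding haar_def measurable_density_eq1 by (intro measurable_restrict_space1) simp

lemma nn_integral_haar_lborel:
  assumes [measurable]: "F \<in> borel_measurable borel"
  shows "(\<integral>\<^sup>+p. F p \<partial>(haar :: (real \<times> (real ^ 'd)) measure)) =
    (\<integral>\<^sup>+p. indicator {0<..} (fst p) * ennreal (inverse (fst p)) * F p \<partial>lborel)"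
proof -
  have [measurable]: "(\<lambda>p :: real \<times> (real ^ 'd). ennreal (inverse (fst p))) \<in> borel_measurable borel"
    by (intro measurable_compose[OF _ measurable_ennreal] borel_measurable_inverse borel_measurable_fst) auto
  have haar_eq: "haar = density (restrict_space lborel grp) (\<lambda>p :: real \<times> (real ^ 'd). ennreal (inverse (fst p)))"
    by (simp add: haar_def case_prod_beta')
  have "(\<integral>\<^sup>+p. F p \<partial>(haar :: (real \<times> (real ^ 'd)) measure)) =
      (\<integral>\<^sup>+p. ennreal (inverse (fst p)) * F p \<partial>restrict_space lborel grp)"
    unfolding haar_eq by (intro nn_integral_density measurable_restrict_space1; simp)
  also have "\<dots> = (\<integral>\<^sup>+p. ennreal (inverse (fst p)) * F p * indicator grp p \<partial>lborel)"
    by (rule nn_integral_restrict_space) simp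
  also have "\<dots> = (\<integral>\<^sup>+p. indicator {0<..} (fst p) * ennreal (inverse (fst p)) * F p \<partial>lborel)"
    by (intro nn_integral_cong) (auto simp: grp_iff split: split_indicator)
  finally show ?thesis .
qed

lemma nn_integral_haar:
  assumes F: "F \<in> borel_measurable borel"
  shows "(\<integral>\<^sup>+p. F p \<partial>(haar :: (real \<times> (real ^ 'd)) measure)) =
    (\<integral>\<^sup>+a. indicator {0<..} a * ennreal (inverse a) * (\<integral>\<^sup>+b. F (a, b) \<partial>lborel) \<partial>lborel)"
proof -
  note [measurable] = F
  have F': "F \<in> borel_measurable (lborel \<Otimes>\<^sub>M lborel)" using F by (simp add: lborel_prod)
  note [measurable] = F'
  have "(\<integral>\<^sup>+p. F p \<partial>haar) = (\<integral>\<^sup>+p. indicator {0<..} (fst p) * ennreal (inverse (fst p)) * F p \<partial>(lborel \<Otimes>\<^sub>M lborel))"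
    unfolding nn_integral_haar_lborel[OF F] lborel_prod ..
  also have "\<dots> = (\<integral>\<^sup>+a. \<integral>\<^sup>+b. indicator {0<..} a * ennreal (inverse a) * F (a, b) \<partial>lborel \<partial>lborel)"
    by (subst lborel.nn_integral_fst[symmetric]) auto
  also have "\<dots> = (\<integral>\<^sup>+a. indicator {0<..} a * ennreal (inverse a) * (\<integral>\<^sup>+b. F (a, b) \<partial>lborel) \<partial>lborel)"
    by (intro nn_integral_cong nn_integral_cmult measurable_Pair2'[THEN measurable_compose, OF _ F']) simp
  finally show ?thesis .
qed

text \<open>An isometry on approximants passes to the limit when one side converges in norm and the
  other only pointwise: the identity for differences makes the \<open>F n\<close> a Cauchy sequence,
  whose pointwise limit is its norm limit. That identity is a separate hypothesis, standing in for
  linearity.\<close>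

lemma esq_isometry_limit:
  assumes [measurable]: "\<And>n. F n \<in> borel_measurable M" "F' \<in> borel_measurable M"
    "\<And>n. G n \<in> borel_measurable N" "G' \<in> borel_measurable N"
    and lim: "AE x in M. (\<lambda>n. F n x) \<longlonglongrightarrow> F' x"
    and G: "(\<lambda>n. esq N (\<lambda>x. G n x - G' x)) \<longlonglongrightarrow> 0" and fin: "esq N G' < \<infinity>"
    and eq: "\<And>n. esq M (F n) = esq N (G n)"
    and diff: "\<And>m n. esq M (\<lambda>x. F m x - F n x) = esq N (\<lambda>x. G m x - G n x)"
  shows "esq M F' = esq N G'"
proof -
  have conv: "(\<lambda>n. esq M (\<lambda>x. F n x - F' x)) \<longlonglongrightarrow> 0"
  proof (rule esq_limit_of_Cauchy[where k = "\<lambda>n. n"])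
    fix \<epsilon> :: real assume "\<epsilon> > 0"
    then have "\<forall>\<^sub>F n in sequentially. esq N (\<lambda>x. G n x - G' x) < ennreal (\<epsilon> / 4)"
      by (intro order_tendstoD(2)[OF G]) simp
    then obtain K where K: "\<And>n. n \<ge> K \<Longrightarrow> esq N (\<lambda>x. G n x - G' x) < ennreal (\<epsilon> / 4)"
      by (auto simp: eventually_sequentially)
    show "\<exists>K. \<forall>m\<ge>K. \<forall>n\<ge>K. esq M (\<lambda>x. F m x - F n x) \<le> ennreal \<epsilon>"
    proof (intro exI allI impI)
      fix m n assume mn: "K \<le> m" "K \<le> n"
      have "esq N (\<lambda>x. (G m x - G' x) - (G n x - G' x)) \<le>
          2 * esq N (\<lambda>x. G m x - G' x) + 2 * esq N (\<lambda>x. G n x - G' x)"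
        by (rule esq_diff_le2) measurable
      also have "\<dots> \<le> 2 * ennreal (\<epsilon> / 4) + 2 * ennreal (\<epsilon> / 4)"
        using K[OF mn(1)] K[OF mn(2)] by (intro add_mono mult_left_mono) auto
      also have "\<dots> = ennreal \<epsilon>"
        using \<open>\<epsilon> > 0\<close> ennreal_mult[of 4 "\<epsilon> / 4"] by (simp flip: distrib_right)
      finally show "esq M (\<lambda>x. F m x - F n x) \<le> ennreal \<epsilon>"
        by (simp add: diff)
    qed
  qed (use lim in \<open>auto simp: filterlim_ident\<close>)
  have Glim: "(\<lambda>n. esq N (G n)) \<longlonglongrightarrow> esq N G'"
    by (rule esq_tendsto[OF _ _ G fin]) measurable
  have "\<forall>\<^sub>F n in sequentially. esq M (\<lambda>x. F n x - F' x) < 1 \<and> esq N (G n) < \<infinity>"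
    using order_tendstoD(2)[OF conv, of 1] order_tendstoD(2)[OF Glim fin] by (auto intro: eventually_conj)
  from eventually_happens'[OF sequentially_bot this]
  obtain n where n: "esq M (\<lambda>x. F n x - F' x) < 1" "esq N (G n) < \<infinity>" by blast
  have "esq M (\<lambda>x. F n x - F' x) < \<infinity>" using n(1) by (rule less_trans) simp
  then have "esq M (\<lambda>x. F n x - (F n x - F' x)) < \<infinity>"
    using n(2) by - (rule esq_diff_finite, simp_all add: eq)
  then have "(\<lambda>n. esq M (F n)) \<longlonglongrightarrow> esq M F'"
    by (intro esq_tendsto[OF _ _ conv]) auto
  with Glim show ?thesis unfolding eq by (intro LIMSEQ_unique)
qed

section \<open>Cross-correlations and the wavelet energy at a fixed scale\<close>

definition corr :: "(real ^ 'd \<Rightarrow> complex) \<Rightarrow> (real ^ 'd \<Rightarrow> complex) \<Rightarrow> real ^ 'd \<Rightarrow> complex" where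
  "corr f g b = L2_inner f (\<lambda>x. g (x - b))"

lemma corr_measurable [measurable]:
  assumes [measurable]: "f \<in> borel_measurable borel" "g \<in> borel_measurable borel"
  shows "corr f g \<in> borel_measurable borel"
proof -
  have "(\<lambda>z. LINT x|lborel. f x * cnj (g (x - z))) \<in> borel_measurable lborel"
    by (rule lborel.borel_measurable_lebesgue_integral) measurable
  then show ?thesis by (simp add: corr_def[abs_def] L2_inner_def)
qed

lemma nn_integral_corr:
  fixes f g :: "real ^ 'd \<Rightarrow> complex"
  assumes [measurable]: "f \<in> borel_measurable borel" "g \<in> borel_measurable borel"
  shows "(\<integral>\<^sup>+x. \<integral>\<^sup>+b. ennreal (cmod (f x)) * ennreal (cmod (g (x - b))) \<partial>lborel \<partial>lborel) =
    (\<integral>\<^sup>+x. ennreal (cmod (f x)) \<partial>lborel) * (\<integral>\<^sup>+x. ennreal (cmod (g x)) \<partial>lborel)"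
proof -
  have "(\<integral>\<^sup>+b. ennreal (cmod (f x)) * ennreal (cmod (g (x - b))) \<partial>lborel) =
      ennreal (cmod (f x)) * (\<integral>\<^sup>+x. ennreal (cmod (g x)) \<partial>lborel)" for x
    using nn_integral_lborel_reflect[of "\<lambda>y. ennreal (cmod (g y))" x] by (simp add: nn_integral_cmult)
  then show ?thesis by (simp add: nn_integral_multc)
qed

lemma integrable_corr:
  fixes f g :: "real ^ 'd \<Rightarrow> complex"
  assumes f: "integrable lborel f" and g: "integrable lborel g"
  shows "integrable lborel (corr f g)"
proof -
  note [measurable] = borel_measurable_integrable[OF f, simplified] borel_measurable_integrable[OF g, simplified]
  have "integrable (lborel \<Otimes>\<^sub>M lborel) (\<lambda>(x, b). f x * cnj (g (x - b)))"
  proof (rule lborel_pair_integrable)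
    show "(\<integral>\<^sup>+x. \<integral>\<^sup>+b. ennreal (cmod (f x * cnj (g (x - b)))) \<partial>lborel \<partial>lborel) < \<infinity>"
      using f g by (simp add: norm_mult ennreal_mult nn_integral_corr integrable_iff_bounded ennreal_mult_less_top)
  qed measurable
  from lborel_pair.integrable_snd[OF this] show ?thesis
    by (simp add: corr_def[abs_def] L2_inner_def)
qed

text \<open>Bounded by Cauchy-Schwarz and integrable by Fubini, hence square integrable.\<close>

lemma corr_L2:
  fixes f g :: "real ^ 'd \<Rightarrow> complex"
  assumes f: "integrable lborel f" "f \<in> L2" and g: "integrable lborel g" "g \<in> L2"
  shows "corr f g \<in> L2"
proof -
  note [measurable] = L2_measurable[OF f(2)] L2_measurable[OF g(2)]
  let ?K = "L2_norm f * L2_norm g"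
  have "cmod (corr f g b) \<le> ?K" for b
    unfolding corr_def using cmod_L2_inner_le[OF f(2) translate_L2[OF g(2)]]
    by (simp add: L2_norm_translate g)
  then have "(cmod (corr f g b))\<^sup>2 \<le> ?K * cmod (corr f g b)" for b
    unfolding power2_eq_square by (intro mult_right_mono) auto
  then have "esq lborel (corr f g) \<le> (\<integral>\<^sup>+b. ennreal ?K * ennreal (cmod (corr f g b)) \<partial>lborel)"
    unfolding esq_def by (intro nn_integral_mono) (simp add: ennreal_leI flip: ennreal_mult)
  also have "\<dots> < \<infinity>"
    using integrable_corr[OF f(1) g(1)] by (simp add: nn_integral_cmult integrable_iff_bounded ennreal_mult_less_top)
  finally show ?thesis by (simp add: L2_iff)
qed

lemma fourier_corr:
  fixes f g :: "real ^ 'd \<Rightarrow> complex"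
  assumes f: "integrable lborel f" and g: "integrable lborel g"
  shows "fourier_integral (corr f g) \<xi> = fourier_integral f \<xi> * cnj (fourier_integral g \<xi>)"
proof -
  note [measurable] = borel_measurable_integrable[OF f, simplified] borel_measurable_integrable[OF g, simplified]
  let ?e = "\<lambda>x. cis (- 2 * pi * (x \<bullet> \<xi>))"
  have "fourier_integral (corr f g) \<xi> = (LINT b|lborel. LINT x|lborel. ?e b * (f x * cnj (g (x - b))))"
    unfolding fourier_integral_def corr_def L2_inner_def by (simp only: integral_mult_right_zero)
  also have "\<dots> = (LINT x|lborel. LINT b|lborel. ?e b * (f x * cnj (g (x - b))))"
  proof (rule lborel_Fubini)
    show "(\<integral>\<^sup>+x. \<integral>\<^sup>+b. ennreal (cmod (?e b * (f x * cnj (g (x - b))))) \<partial>lborel \<partial>lborel) < \<infinity>"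
      using f g by (simp add: norm_mult ennreal_mult nn_integral_corr integrable_iff_bounded ennreal_mult_less_top)
  qed measurable
  also have "\<dots> = (LINT x|lborel. ?e x * f x * cnj (fourier_integral g \<xi>))"
  proof (intro Bochner_Integration.integral_cong refl)
    fix x
    let ?h = "\<lambda>y. ?e x * f x * cnj (?e y * g y)"
    have "?e b * (f x * cnj (g (x - b))) = ?h (x - b)" for b
    proof -
      have arg: "- 2 * pi * (x \<bullet> \<xi>) + - (- 2 * pi * ((x - b) \<bullet> \<xi>)) = - 2 * pi * (b \<bullet> \<xi>)"
        by (simp add: inner_diff_left right_diff_distrib)
      have "?h (x - b) = (?e x * cnj (?e (x - b))) * (f x * cnj (g (x - b)))"
        by (simp only: complex_cnj_mult mult_ac)
      then show ?thesis by (simp only: cis_cnj cis_mult arg)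
    qed
    then have "(LINT b|lborel. ?e b * (f x * cnj (g (x - b)))) = (LINT b|lborel. ?h (x - b))"
      by (simp only:)
    also have "\<dots> = (LINT y|lborel. ?h y)" by (rule integral_lborel_reflect) measurable
    also have "\<dots> = ?e x * f x * cnj (fourier_integral g \<xi>)"
      by (simp only: integral_mult_right_zero Bochner_Integration.integral_cnj fourier_integral_def)
    finally show "(LINT b|lborel. ?e b * (f x * cnj (g (x - b)))) = ?e x * f x * cnj (fourier_integral g \<xi>)" .
  qed
  also have "\<dots> = fourier_integral f \<xi> * cnj (fourier_integral g \<xi>)"
    by (simp only: integral_mult_left_zero fourier_integral_def[of f])
  finally show ?thesis .
qed

lemma fourier_dilation:
  fixes \<phi> :: "real ^ 'd \<Rightarrow> complex"
  assumes [measurable]: "\<phi> \<in> borel_measurable borel" and a: "a > 0"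
  shows "fourier_integral (wavelet \<phi> (a, 0)) \<xi> =
    complex_of_real (a ^ CARD('d) * a powr (- (real CARD('d) / 2))) * fourier_integral \<phi> (a *\<^sub>R \<xi>)"
proof -
  let ?c = "complex_of_real (a powr (- (real CARD('d) / 2)))"
  have "fourier_integral (wavelet \<phi> (a, 0)) \<xi> =
      (LINT x|lborel. ?c * (cis (- 2 * pi * (x \<bullet> \<xi>)) * \<phi> (inverse a *\<^sub>R x)))"
    unfolding fourier_integral_def by (simp add: mult.left_commute)
  also have "\<dots> = complex_of_real (a ^ CARD('d)) *
      (LINT x|lborel. ?c * (cis (- 2 * pi * ((a *\<^sub>R x) \<bullet> \<xi>)) * \<phi> (inverse a *\<^sub>R (a *\<^sub>R x))))"
    using integral_lborel_affine[of "\<lambda>x. ?c * (cis (- 2 * pi * (x \<bullet> \<xi>)) * \<phi> (inverse a *\<^sub>R x))" a 0] a by simp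
  also have "(LINT x|lborel. ?c * (cis (- 2 * pi * ((a *\<^sub>R x) \<bullet> \<xi>)) * \<phi> (inverse a *\<^sub>R (a *\<^sub>R x)))) =
      ?c * fourier_integral \<phi> (a *\<^sub>R \<xi>)"
    using a by (simp add: fourier_integral_def)
  finally show ?thesis by (simp only: of_real_mult mult.assoc)
qed

lemma integrable_wavelet:
  fixes \<phi> :: "real ^ 'd \<Rightarrow> complex"
  assumes \<phi>: "integrable lborel \<phi>" and p: "fst p > 0"
  shows "integrable lborel (wavelet \<phi> p)"
proof -
  note [measurable] = borel_measurable_integrable[OF \<phi>, simplified]
  have "(\<integral>\<^sup>+x. ennreal (cmod (\<phi> x)) \<partial>lborel) = ennreal (inverse (fst p) ^ CARD('d)) *
      (\<integral>\<^sup>+x. ennreal (cmod (\<phi> (- snd p + inverse (fst p) *\<^sub>R x))) \<partial>lborel)"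
    using nn_integral_lborel_affine[of "\<lambda>x. ennreal (cmod (\<phi> x))" "inverse (fst p)" "- snd p"] p by simp
  then have "(\<integral>\<^sup>+x. ennreal (cmod (\<phi> (inverse (fst p) *\<^sub>R x - snd p))) \<partial>lborel) < \<infinity>"
    using \<phi> p by (auto simp: integrable_iff_bounded ennreal_mult_less_top algebra_simps)
  then have "integrable lborel (\<lambda>x. \<phi> (inverse (fst p) *\<^sub>R x - snd p))"
    by (intro integrableI_bounded) auto
  then show ?thesis unfolding wavelet_eq[abs_def] by (rule integrable_mult_right)
qed

lemma wavelet_transform_measurable [measurable]:
  fixes \<phi> f :: "real ^ 'd \<Rightarrow> complex"
  assumes \<phi>: "\<phi> \<in> L2" and f: "f \<in> L2"
  shows "wavelet_transform \<phi> f \<in> borel_measurable borel"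
proof -
  note [measurable] = L2_measurable[OF \<phi>] L2_measurable[OF f]
  have "(\<lambda>p. LINT x|lborel. f x * cnj (wavelet \<phi> p x)) \<in> borel_measurable (lborel :: (real \<times> (real ^ 'd)) measure)"
  proof (rule lborel.borel_measurable_lebesgue_integral)
    have [measurable]: "(fst :: (real \<times> (real ^ 'd)) \<times> (real ^ 'd) \<Rightarrow> _) \<in> borel_measurable (lborel \<Otimes>\<^sub>M lborel)"
      using measurable_fst[of "lborel :: (real \<times> (real ^ 'd)) measure" "lborel :: (real ^ 'd) measure"] by simp
    have [measurable]: "(snd :: (real \<times> (real ^ 'd)) \<times> (real ^ 'd) \<Rightarrow> _) \<in> borel_measurable (lborel \<Otimes>\<^sub>M lborel)"
      using measurable_snd[of "lborel :: (real \<times> (real ^ 'd)) measure" "lborel :: (real ^ 'd) measure"] by simp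
    have "(\<lambda>z. f (snd z) * cnj (wavelet \<phi> (fst z) (snd z))) \<in> borel_measurable ((lborel :: (real \<times> (real ^ 'd)) measure) \<Otimes>\<^sub>M lborel)"
      by (intro borel_measurable_times borel_measurable_cnj wavelet_measurable measurable_compose[of snd _ borel f]) auto
    then show "(\<lambda>(p, x). f x * cnj (wavelet \<phi> p x)) \<in> borel_measurable ((lborel :: (real \<times> (real ^ 'd)) measure) \<Otimes>\<^sub>M lborel)"
      by (simp add: case_prod_beta')
  qed
  then show ?thesis by (simp add: wavelet_transform_def[abs_def] L2_inner_def)
qed

lemma slice_measurable:
  fixes F :: "real \<times> (real ^ 'd) \<Rightarrow> 'b::topological_space"
  assumes "F \<in> borel_measurable borel"
  shows "(\<lambda>b. F (a, b)) \<in> borel_measurable borel"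
  by (rule measurable_compose[OF _ assms]) (intro borel_measurable_continuous_onI continuous_intros)

text \<open>For fixed \<open>a\<close> the transform is a cross-correlation evaluated at
  \<open>a *\<^sub>R b\<close>, so Plancherel and the correlation formula apply. The Jacobian
  \<open>a^d\<close> of this substitution cancels the square of the factor
  \<open>a^d * a^(-d/2)\<close> in the Fourier transform of the dilate.\<close>

lemma wavelet_energy_slice_L1:
  fixes \<phi> f :: "real ^ 'd \<Rightarrow> complex"
  assumes \<phi>: "integrable lborel \<phi>" "\<phi> \<in> L2" and f: "integrable lborel f" "f \<in> L2" and a: "a > 0"
  shows "esq lborel (\<lambda>b. wavelet_transform \<phi> f (a, b)) =
    esq lborel (\<lambda>\<xi>. fourier_integral f \<xi> * fourier_integral \<phi> (a *\<^sub>R \<xi>))"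
proof -
  note [measurable] = L2_measurable[OF \<phi>(2)] L2_measurable[OF f(2)]
  let ?g = "wavelet \<phi> (a, 0)"
  have g: "integrable lborel ?g" "?g \<in> L2"
    using integrable_wavelet[OF \<phi>(1), of "(a, 0)"] wavelet_L2[OF \<phi>(2), of "(a, 0)"] a by auto
  have W: "wavelet_transform \<phi> f (a, b) = corr f ?g (a *\<^sub>R b)" for b
  proof -
    have "wavelet \<phi> (a, b) x = ?g (x - a *\<^sub>R b)" for x
      using a by (simp add: scaleR_diff_right)
    then have "wavelet \<phi> (a, b) = (\<lambda>x. ?g (x - a *\<^sub>R b))" by (rule ext)
    then show ?thesis unfolding wavelet_transform_def corr_def by (rule arg_cong)
  qed
  have "esq lborel (corr f ?g) = ennreal (a ^ CARD('d)) * esq lborel (\<lambda>b. corr f ?g (a *\<^sub>R b))"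
    unfolding esq_def using a nn_integral_lborel_affine[of "\<lambda>b. ennreal ((cmod (corr f ?g b))\<^sup>2)" a 0]
      corr_measurable[OF L2_measurable[OF f(2)] L2_measurable[OF g(2)]] by simp
  then have "ennreal (a ^ CARD('d)) * esq lborel (\<lambda>b. wavelet_transform \<phi> f (a, b)) = esq lborel (corr f ?g)"
    by (simp only: W)
  also have "\<dots> = esq lborel (fourier_integral (corr f ?g))"
    by (intro Plancherel[symmetric] corr_L2 integrable_corr f g)
  also have "\<dots> = esq lborel (\<lambda>\<xi>. complex_of_real (a ^ CARD('d) * a powr (- (real CARD('d) / 2))) *
      (fourier_integral f \<xi> * cnj (fourier_integral \<phi> (a *\<^sub>R \<xi>))))"
  proof (rule esq_cong)
    fix \<xi>
    show "fourier_integral (corr f ?g) \<xi> = complex_of_real (a ^ CARD('d) * a powr (- (real CARD('d) / 2))) *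
      (fourier_integral f \<xi> * cnj (fourier_integral \<phi> (a *\<^sub>R \<xi>)))"
      unfolding fourier_corr[OF f(1) g(1)] using fourier_dilation[of \<phi> a \<xi>] a by simp
  qed
  also have "\<dots> = ennreal (a ^ CARD('d)) * esq lborel (\<lambda>\<xi>. fourier_integral f \<xi> * cnj (fourier_integral \<phi> (a *\<^sub>R \<xi>)))"
  proof (subst esq_cmult)
    have "(cmod (complex_of_real (a ^ CARD('d) * a powr (- (real CARD('d) / 2)))))\<^sup>2 = a ^ CARD('d)"
      unfolding norm_of_real power2_abs power_mult_distrib powr_half_sq[OF a] using a by (simp add: power2_eq_square)
    then show "ennreal ((cmod (complex_of_real (a ^ CARD('d) * a powr (- (real CARD('d) / 2)))))\<^sup>2) *
        esq lborel (\<lambda>\<xi>. fourier_integral f \<xi> * cnj (fourier_integral \<phi> (a *\<^sub>R \<xi>))) =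
        ennreal (a ^ CARD('d)) * esq lborel (\<lambda>\<xi>. fourier_integral f \<xi> * cnj (fourier_integral \<phi> (a *\<^sub>R \<xi>)))"
      by (simp only:)
  qed measurable
  finally have "ennreal (a ^ CARD('d)) * esq lborel (\<lambda>b. wavelet_transform \<phi> f (a, b)) = ennreal (a ^ CARD('d)) *
      esq lborel (\<lambda>\<xi>. fourier_integral f \<xi> * cnj (fourier_integral \<phi> (a *\<^sub>R \<xi>)))" .
  moreover have "ennreal (a ^ CARD('d)) \<noteq> 0" "ennreal (a ^ CARD('d)) \<noteq> top" using a by auto
  ultimately have "esq lborel (\<lambda>b. wavelet_transform \<phi> f (a, b)) =
      esq lborel (\<lambda>\<xi>. fourier_integral f \<xi> * cnj (fourier_integral \<phi> (a *\<^sub>R \<xi>)))"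
    by (subst (asm) ennreal_mult_cancel_left) auto
  also have "\<dots> = esq lborel (\<lambda>\<xi>. fourier_integral f \<xi> * fourier_integral \<phi> (a *\<^sub>R \<xi>))"
    by (simp add: esq_def norm_mult)
  finally show ?thesis .
qed

text \<open>The truncation of \<open>is_L2_fourier\<close> at integer radii, so that the transforms
  of the truncated window converge to \<open>\<psi>\<close> by definition.\<close>

definition trunc :: "(real ^ 'd \<Rightarrow> complex) \<Rightarrow> nat \<Rightarrow> real ^ 'd \<Rightarrow> complex" where
  "trunc f n x = indicator (cball 0 (real n)) x * f x"

lemma trunc_measurable [measurable]:
  "f \<in> borel_measurable borel \<Longrightarrow> trunc f n \<in> borel_measurable borel"
  unfolding trunc_def[abs_def] by (intro borel_measurable_times borel_measurable_indicator) auto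

lemma trunc_L2: "f \<in> L2 \<Longrightarrow> trunc f n \<in> L2"
proof -
  assume f: "f \<in> L2"
  have "esq lborel (trunc f n) \<le> esq lborel f"
    by (rule esq_mono) (simp add: trunc_def norm_mult split: split_indicator)
  also have "\<dots> < \<infinity>" by (rule L2_esq[OF f])
  finally show ?thesis using trunc_measurable[OF L2_measurable[OF f]] by (simp add: L2_iff)
qed

lemma trunc_integrable: "f \<in> L2 \<Longrightarrow> integrable lborel (trunc f n)"
  for f :: "real ^ 'd \<Rightarrow> complex"
proof -
  assume f: "f \<in> L2"
  let ?i = "\<lambda>x :: real ^ 'd. indicator (cball 0 (real n)) x :: complex"
  have "esq lborel ?i = (\<integral>\<^sup>+x. ennreal 1 * indicator (cball 0 (real n)) x \<partial>(lborel :: (real ^ 'd) measure))"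
    unfolding esq_def by (intro nn_integral_cong) (auto split: split_indicator)
  also have "\<dots> < \<infinity>" by (rule nn_integral_const_cball)
  finally have "?i \<in> L2" by (simp add: L2_iff)
  from L2_integrable_mult[OF f this] show ?thesis
    by (rule Bochner_Integration.integrable_cong[THEN iffD1, rotated -1]) (auto simp: trunc_def split: split_indicator)
qed

lemma trunc_tendsto: "f \<in> L2 \<Longrightarrow> (\<lambda>n. esq lborel (\<lambda>x. trunc f n x - f x)) \<longlonglongrightarrow> 0"
proof (rule esq_dominated_convergence[where w = "\<lambda>x. ennreal ((cmod (f x))\<^sup>2)"])
  assume f: "f \<in> L2"
  note [measurable] = L2_measurable[OF f]
  show "(\<lambda>x. trunc f n x - f x) \<in> borel_measurable lborel" for n by measurable
  show "(\<lambda>x. ennreal ((cmod (f x))\<^sup>2)) \<in> borel_measurable lborel" by measurable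
  show "AE x in lborel. (\<lambda>n. trunc f n x - f x) \<longlonglongrightarrow> 0"
  proof (rule AE_I2, rule tendsto_eventually)
    fix x
    show "\<forall>\<^sub>F n in sequentially. trunc f n x - f x = 0"
      using eventually_ge_at_top[of "nat \<lceil>norm x\<rceil>"]
      by eventually_elim (auto simp: trunc_def split: split_indicator)
  qed
  show "(\<integral>\<^sup>+x. ennreal ((cmod (f x))\<^sup>2) \<partial>lborel) < \<infinity>" using L2_esq[OF f] by (simp add: esq_def)
  show "AE x in lborel. ennreal ((cmod (trunc f n x - f x))\<^sup>2) \<le> ennreal ((cmod (f x))\<^sup>2)" for n
    by (intro AE_I2) (simp add: trunc_def split: split_indicator)
qed

lemma wavelet_transform_diff_window:
  "\<phi> \<in> L2 \<Longrightarrow> \<psi> \<in> L2 \<Longrightarrow> f \<in> L2 \<Longrightarrow> fst p > 0 \<Longrightarrow>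
    wavelet_transform (\<lambda>x. \<phi> x - \<psi> x) f p = wavelet_transform \<phi> f p - wavelet_transform \<psi> f p"
  unfolding wavelet_transform_def wavelet_diff by (intro L2_inner_diff_right wavelet_L2)

lemma fourier_diff:
  fixes f g :: "real ^ 'd \<Rightarrow> complex"
  assumes "integrable lborel f" "integrable lborel g"
  shows "fourier_integral (\<lambda>x. f x - g x) \<xi> = fourier_integral f \<xi> - fourier_integral g \<xi>"
  unfolding fourier_integral_def right_diff_distrib
  by (rule Bochner_Integration.integral_diff) (intro integrable_cis_mult assms)+

text \<open>Truncating the window extends the slice identity from integrable windows to all of
  \<open>L2\<close>. Integrability of \<open>f\<close> is kept at this stage because it bounds
  \<open>fourier_integral f\<close>, so multiplication by that function preserves convergence in the
  mean.\<close>

lemma wavelet_energy_slice: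
  fixes \<phi> f :: "real ^ 'd \<Rightarrow> complex"
  assumes \<phi>: "\<phi> \<in> L2" "is_L2_fourier \<phi> \<psi>" and f: "integrable lborel f" "f \<in> L2" and a: "a > 0"
  shows "esq lborel (\<lambda>b. wavelet_transform \<phi> f (a, b)) =
    esq lborel (\<lambda>\<xi>. fourier_integral f \<xi> * \<psi> (a *\<^sub>R \<xi>))"
proof (rule esq_isometry_limit)
  note [measurable] = L2_measurable[OF \<phi>(1)] L2_measurable[OF f(2)]
  have \<psi>: "\<psi> \<in> L2" using \<phi>(2) by (simp add: is_L2_fourier_def)
  note [measurable] = L2_measurable[OF \<psi>]
  let ?K = "LINT x|lborel. cmod (f x)"
  let ?W = "\<lambda>n b. wavelet_transform (trunc \<phi> n) f (a, b)"
  let ?G = "\<lambda>n \<xi>. fourier_integral f \<xi> * fourier_integral (trunc \<phi> n) (a *\<^sub>R \<xi>)"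
  show "?W n \<in> borel_measurable lborel" for n
    using slice_measurable[OF wavelet_transform_measurable[OF trunc_L2[OF \<phi>(1)] f(2)]] by simp
  show "(\<lambda>b. wavelet_transform \<phi> f (a, b)) \<in> borel_measurable lborel"
    using slice_measurable[OF wavelet_transform_measurable[OF \<phi>(1) f(2)]] by simp
  show "?G n \<in> borel_measurable lborel" for n by measurable
  show Gm: "(\<lambda>\<xi>. fourier_integral f \<xi> * \<psi> (a *\<^sub>R \<xi>)) \<in> borel_measurable lborel" by measurable
  show "AE b in lborel. (\<lambda>n. ?W n b) \<longlonglongrightarrow> wavelet_transform \<phi> f (a, b)"
  proof (rule AE_I2)
    fix b
    have "(\<lambda>n. esq lborel (\<lambda>x. wavelet (trunc \<phi> n) (a, b) x - wavelet \<phi> (a, b) x)) \<longlonglongrightarrow> 0"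
      using trunc_tendsto[OF \<phi>(1)] esq_wavelet[of "\<lambda>x. trunc \<phi> n x - \<phi> x" "(a, b)" for n] a
      by (simp add: wavelet_diff del: wavelet.simps)
    then show "(\<lambda>n. ?W n b) \<longlonglongrightarrow> wavelet_transform \<phi> f (a, b)"
      unfolding wavelet_transform_def using a
      by (intro L2_inner_tendsto f wavelet_L2 trunc_L2 \<phi>) auto
  qed
  \<comment> \<open>The transform of an integrable function is bounded by its L1 norm
    \<open>?K\<close>; the inverse power of \<open>a\<close> is the Jacobian of the dilation in
    frequency.\<close>
  have K: "esq lborel (\<lambda>\<xi>. fourier_integral f \<xi> * g (a *\<^sub>R \<xi>)) \<le> ennreal (?K\<^sup>2 * inverse (a ^ CARD('d))) * esq lborel g"
    if [measurable]: "g \<in> borel_measurable borel" for g :: "real ^ 'd \<Rightarrow> complex"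
  proof -
    have "esq lborel (\<lambda>\<xi>. fourier_integral f \<xi> * g (a *\<^sub>R \<xi>)) \<le> esq lborel (\<lambda>\<xi>. complex_of_real ?K * g (a *\<^sub>R \<xi>))"
      by (rule esq_mono) (auto simp: norm_mult intro!: mult_right_mono fourier_bound order.trans[OF fourier_bound abs_ge_self])
    also have "\<dots> = ennreal (?K\<^sup>2) * esq lborel (\<lambda>\<xi>. g (a *\<^sub>R \<xi>))"
      by (subst esq_cmult) simp_all
    also have "esq lborel (\<lambda>\<xi>. g (a *\<^sub>R \<xi>)) = ennreal (inverse (a ^ CARD('d))) * esq lborel g"
    proof -
      have "esq lborel g = ennreal (a ^ CARD('d)) * esq lborel (\<lambda>\<xi>. g (a *\<^sub>R \<xi>))"
        using nn_integral_lborel_affine[of "\<lambda>b. ennreal ((cmod (g b))\<^sup>2)" a 0] a by (simp add: esq_def)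
      then have "ennreal (inverse (a ^ CARD('d))) * esq lborel g =
          (ennreal (inverse (a ^ CARD('d))) * ennreal (a ^ CARD('d))) * esq lborel (\<lambda>\<xi>. g (a *\<^sub>R \<xi>))"
        by (simp only: mult.assoc)
      also have "ennreal (inverse (a ^ CARD('d))) * ennreal (a ^ CARD('d)) = 1"
        using a by (simp flip: ennreal_mult)
      finally show ?thesis by simp
    qed
    finally show ?thesis using a by (simp add: ennreal_mult mult.assoc)
  qed
  have \<psi>lim: "(\<lambda>n. esq lborel (\<lambda>\<xi>. fourier_integral (trunc \<phi> n) \<xi> - \<psi> \<xi>)) \<longlonglongrightarrow> 0"
  proof -
    have "(\<lambda>n. \<integral>\<^sup>+\<xi>. ennreal ((cmod (\<psi> \<xi> - fourier_integral (\<lambda>x. indicator (cball 0 (real n)) x * \<phi> x) \<xi>))\<^sup>2) \<partial>lborel) \<longlonglongrightarrow> 0"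
      by (rule filterlim_compose[OF \<phi>(2)[unfolded is_L2_fourier_def, THEN conjunct2] filterlim_real_sequentially])
    then show ?thesis by (simp add: esq_def norm_minus_commute trunc_def[abs_def])
  qed
  show "(\<lambda>n. esq lborel (\<lambda>\<xi>. ?G n \<xi> - fourier_integral f \<xi> * \<psi> (a *\<^sub>R \<xi>))) \<longlonglongrightarrow> 0"
  proof (rule tendsto_sandwich[OF always_eventually always_eventually tendsto_const])
    let ?C = "ennreal (?K\<^sup>2 * inverse (a ^ CARD('d)))"
    show "\<forall>n. esq lborel (\<lambda>\<xi>. ?G n \<xi> - fourier_integral f \<xi> * \<psi> (a *\<^sub>R \<xi>)) \<le>
        ?C * esq lborel (\<lambda>\<xi>. fourier_integral (trunc \<phi> n) \<xi> - \<psi> \<xi>)"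
    proof
      fix n
      show "esq lborel (\<lambda>\<xi>. ?G n \<xi> - fourier_integral f \<xi> * \<psi> (a *\<^sub>R \<xi>)) \<le>
        ?C * esq lborel (\<lambda>\<xi>. fourier_integral (trunc \<phi> n) \<xi> - \<psi> \<xi>)"
        using K[of "\<lambda>\<xi>. fourier_integral (trunc \<phi> n) \<xi> - \<psi> \<xi>"] by (simp add: right_diff_distrib)
    qed
    have "(\<lambda>n. ?C * esq lborel (\<lambda>\<xi>. fourier_integral (trunc \<phi> n) \<xi> - \<psi> \<xi>)) \<longlonglongrightarrow> ?C * 0"
      by (intro ennreal_tendsto_cmult \<psi>lim) simp
    then show "(\<lambda>n. ?C * esq lborel (\<lambda>\<xi>. fourier_integral (trunc \<phi> n) \<xi> - \<psi> \<xi>)) \<longlonglongrightarrow> 0" by simp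
  qed simp
  show "esq lborel (\<lambda>\<xi>. fourier_integral f \<xi> * \<psi> (a *\<^sub>R \<xi>)) < \<infinity>"
    by (rule le_less_trans[OF K]) (use L2_esq[OF \<psi>] in \<open>auto simp: ennreal_mult_less_top\<close>)
  show "esq lborel (?W n) = esq lborel (?G n)" for n
    by (intro wavelet_energy_slice_L1 trunc_integrable trunc_L2 \<phi> f a)
  show "esq lborel (\<lambda>b. ?W m b - ?W n b) = esq lborel (\<lambda>\<xi>. ?G m \<xi> - ?G n \<xi>)" for m n
  proof -
    have "esq lborel (\<lambda>b. wavelet_transform (\<lambda>x. trunc \<phi> m x - trunc \<phi> n x) f (a, b)) =
        esq lborel (\<lambda>\<xi>. fourier_integral f \<xi> * fourier_integral (\<lambda>x. trunc \<phi> m x - trunc \<phi> n x) (a *\<^sub>R \<xi>))"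
      by (intro wavelet_energy_slice_L1 Bochner_Integration.integrable_diff trunc_integrable L2_diff trunc_L2 \<phi> f a)
    then show ?thesis
      using a by (simp add: wavelet_transform_diff_window trunc_L2 \<phi> f fourier_diff trunc_integrable right_diff_distrib)
  qed
qed

lemma admissible_L2: "\<phi> \<in> admissible \<Longrightarrow> \<phi> \<in> L2"
  by (simp add: admissible_def)

text \<open>Integrating the slice energies against \<open>da / a\<close> and exchanging integrals
  puts the admissibility integral next to \<open>|fourier_integral f \<xi>|^2\<close>; it equals 1
  for almost every \<open>\<xi>\<close>, and Plancherel finishes.\<close>

lemma wavelet_isometry_L1:
  fixes \<phi> f :: "real ^ 'd \<Rightarrow> complex"
  assumes adm: "\<phi> \<in> admissible" and f: "integrable lborel f" "f \<in> L2"
  shows "esq haar (wavelet_transform \<phi> f) = esq lborel f"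
proof -
  have \<phi>: "\<phi> \<in> L2" by (rule admissible_L2[OF adm])
  obtain \<psi> where \<psi>: "is_L2_fourier \<phi> \<psi>"
    and one: "AE x in lborel. (\<integral>\<^sup>+\<xi>\<in>{0<..}. ennreal ((cmod (\<psi> (\<xi> *\<^sub>R x)))\<^sup>2 / \<xi>) \<partial>lborel) = 1"
    using adm by (auto simp: admissible_def)
  have "\<psi> \<in> L2" using \<psi> by (simp add: is_L2_fourier_def)
  note [measurable] = L2_measurable[OF this] L2_measurable[OF \<phi>] L2_measurable[OF f(2)]
  note [measurable] = wavelet_transform_measurable[OF \<phi> f(2)]
  let ?i = "\<lambda>a. indicator {0<..} a * ennreal (inverse a)"
  have "esq haar (wavelet_transform \<phi> f) = (\<integral>\<^sup>+a. ?i a * esq lborel (\<lambda>b. wavelet_transform \<phi> f (a, b)) \<partial>lborel)"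
    unfolding esq_def by (rule nn_integral_haar) measurable
  also have "\<dots> = (\<integral>\<^sup>+a. ?i a * esq lborel (\<lambda>\<xi>. fourier_integral f \<xi> * \<psi> (a *\<^sub>R \<xi>)) \<partial>lborel)"
    by (intro nn_integral_cong) (auto simp: wavelet_energy_slice[OF \<phi> \<psi> f] split: split_indicator)
  also have "\<dots> = (\<integral>\<^sup>+a. \<integral>\<^sup>+\<xi>. ?i a * (ennreal ((cmod (fourier_integral f \<xi>))\<^sup>2) * ennreal ((cmod (\<psi> (a *\<^sub>R \<xi>)))\<^sup>2)) \<partial>lborel \<partial>lborel)"
    unfolding esq_def by (simp add: norm_mult power_mult_distrib ennreal_mult nn_integral_cmult)
  also have "\<dots> = (\<integral>\<^sup>+\<xi>. \<integral>\<^sup>+a. ?i a * (ennreal ((cmod (fourier_integral f \<xi>))\<^sup>2) * ennreal ((cmod (\<psi> (a *\<^sub>R \<xi>)))\<^sup>2)) \<partial>lborel \<partial>lborel)"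
    by (rule lborel_pair.Fubini'[symmetric]) measurable
  also have "\<dots> = (\<integral>\<^sup>+\<xi>. ennreal ((cmod (fourier_integral f \<xi>))\<^sup>2) * (\<integral>\<^sup>+a\<in>{0<..}. ennreal ((cmod (\<psi> (a *\<^sub>R \<xi>)))\<^sup>2 / a) \<partial>lborel) \<partial>lborel)"
  proof (intro nn_integral_cong)
    fix \<xi>
    have "(\<integral>\<^sup>+a. ?i a * (ennreal ((cmod (fourier_integral f \<xi>))\<^sup>2) * ennreal ((cmod (\<psi> (a *\<^sub>R \<xi>)))\<^sup>2)) \<partial>lborel) =
        (\<integral>\<^sup>+a. ennreal ((cmod (fourier_integral f \<xi>))\<^sup>2) * (ennreal ((cmod (\<psi> (a *\<^sub>R \<xi>)))\<^sup>2 / a) * indicator {0<..} a) \<partial>lborel)"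
      by (intro nn_integral_cong) (auto simp: divide_inverse ennreal_mult mult_ac split: split_indicator)
    also have "\<dots> = ennreal ((cmod (fourier_integral f \<xi>))\<^sup>2) * (\<integral>\<^sup>+a\<in>{0<..}. ennreal ((cmod (\<psi> (a *\<^sub>R \<xi>)))\<^sup>2 / a) \<partial>lborel)"
      by (rule nn_integral_cmult) measurable
    finally show "(\<integral>\<^sup>+a. ?i a * (ennreal ((cmod (fourier_integral f \<xi>))\<^sup>2) * ennreal ((cmod (\<psi> (a *\<^sub>R \<xi>)))\<^sup>2)) \<partial>lborel) =
      ennreal ((cmod (fourier_integral f \<xi>))\<^sup>2) * (\<integral>\<^sup>+a\<in>{0<..}. ennreal ((cmod (\<psi> (a *\<^sub>R \<xi>)))\<^sup>2 / a) \<partial>lborel)" .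
  qed
  also have "\<dots> = esq lborel (fourier_integral f)"
    unfolding esq_def by (rule nn_integral_cong_AE) (use one in \<open>eventually_elim, simp\<close>)
  also have "\<dots> = esq lborel f" by (rule Plancherel[OF f(2,1)])
  finally show ?thesis .
qed

lemma wavelet_transform_diff:
  "\<phi> \<in> L2 \<Longrightarrow> f \<in> L2 \<Longrightarrow> g \<in> L2 \<Longrightarrow> fst p > 0 \<Longrightarrow>
    wavelet_transform \<phi> (\<lambda>x. f x - g x) p = wavelet_transform \<phi> f p - wavelet_transform \<phi> g p"
  unfolding wavelet_transform_def by (intro L2_inner_diff_left wavelet_L2)

lemma wavelet_transform_add:
  "\<phi> \<in> L2 \<Longrightarrow> f \<in> L2 \<Longrightarrow> g \<in> L2 \<Longrightarrow> fst p > 0 \<Longrightarrow>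
    wavelet_transform \<phi> (\<lambda>x. f x + g x) p = wavelet_transform \<phi> f p + wavelet_transform \<phi> g p"
  unfolding wavelet_transform_def by (intro L2_inner_add_left wavelet_L2)

lemma wavelet_transform_cmult: "wavelet_transform \<phi> (\<lambda>x. c * f x) p = c * wavelet_transform \<phi> f p"
  unfolding wavelet_transform_def by (rule L2_inner_cmult_left)

text \<open>The same limit principle, now with truncations of \<open>f\<close>: they converge in
  \<open>L2\<close>, and their transforms converge at every group element because the inner product
  is continuous.\<close>

theorem wavelet_isometry:
  fixes \<phi> f :: "real ^ 'd \<Rightarrow> complex"
  assumes adm: "\<phi> \<in> admissible" and f: "f \<in> L2"
  shows "esq haar (wavelet_transform \<phi> f) = esq lborel f"
proof -
  have \<phi>: "\<phi> \<in> L2" by (rule admissible_L2[OF adm])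
  show ?thesis
  proof (rule esq_isometry_limit[where G = "trunc f" and F = "\<lambda>n. wavelet_transform \<phi> (trunc f n)"])
    show "AE p in haar. (\<lambda>n. wavelet_transform \<phi> (trunc f n) p) \<longlonglongrightarrow> wavelet_transform \<phi> f p"
      unfolding wavelet_transform_def
      by (intro AE_I2 L2_inner_tendsto_left wavelet_L2 \<phi> trunc_L2 trunc_tendsto f) (simp add: grp_iff)
    show "esq haar (wavelet_transform \<phi> (trunc f n)) = esq lborel (trunc f n)" for n
      by (intro wavelet_isometry_L1 adm trunc_integrable trunc_L2 f)
    show "esq haar (\<lambda>p. wavelet_transform \<phi> (trunc f m) p - wavelet_transform \<phi> (trunc f n) p) =
        esq lborel (\<lambda>x. trunc f m x - trunc f n x)" for m n
    proof -
      have "esq haar (wavelet_transform \<phi> (\<lambda>x. trunc f m x - trunc f n x)) = esq lborel (\<lambda>x. trunc f m x - trunc f n x)"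
        by (intro wavelet_isometry_L1 adm Bochner_Integration.integrable_diff trunc_integrable L2_diff trunc_L2 f)
      also have "esq haar (wavelet_transform \<phi> (\<lambda>x. trunc f m x - trunc f n x)) =
          esq haar (\<lambda>p. wavelet_transform \<phi> (trunc f m) p - wavelet_transform \<phi> (trunc f n) p)"
        by (rule esq_cong) (simp add: wavelet_transform_diff \<phi> trunc_L2 f grp_iff)
      finally show ?thesis .
    qed
  qed (use f in \<open>auto intro!: borel_measurable_haar wavelet_transform_measurable trunc_L2 \<phi> trunc_tendsto trunc_measurable L2_measurable simp: L2_esq[simplified]\<close>)
qed

text \<open>The reproducing formula, by polarization of the isometry.\<close>

theorem wavelet_parseval:
  fixes \<phi> f g :: "real ^ 'd \<Rightarrow> complex"
  assumes adm: "\<phi> \<in> admissible" and f: "f \<in> L2" and g: "g \<in> L2"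
  shows "integrable haar (\<lambda>p. wavelet_transform \<phi> f p * cnj (wavelet_transform \<phi> g p))"
    and "(LINT p|haar. wavelet_transform \<phi> f p * cnj (wavelet_transform \<phi> g p)) = L2_inner f g"
proof -
  have \<phi>: "\<phi> \<in> L2" by (rule admissible_L2[OF adm])
  let ?W = "wavelet_transform \<phi>"
  have meas: "?W h \<in> borel_measurable haar" if "h \<in> L2" for h
    by (intro borel_measurable_haar wavelet_transform_measurable \<phi> that)
  have int: "integrable haar (\<lambda>p. ?W f p * cnj (?W h p))" if "f \<in> L2" "h \<in> L2" for f h
    by (intro integrable_mult_cnj meas that) (simp_all only: wavelet_isometry[OF adm] L2_esq that)
  show "integrable haar (\<lambda>p. ?W f p * cnj (?W g p))" by (rule int[OF f g])
  \<comment> \<open>\<open>B\<close> measures the failure of the sesquilinear identity and vanishes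
    on the diagonal by the isometry. Expanding it at \<open>f + c * g\<close> with
    \<open>c = 1\<close> and \<open>c = \<i>\<close> shows that the sum and the difference of
    \<open>B f g\<close> and \<open>B g f\<close> vanish.\<close>
  define B where "B u v = (LINT p|haar. ?W u p * cnj (?W v p)) - L2_inner u v" for u v
  have self: "B u u = 0" if u: "u \<in> L2" for u
  proof -
    have "integrable haar (\<lambda>p. (cmod (?W u p))\<^sup>2)"
      using int[OF u u] unfolding complex_norm_square[symmetric] by (simp only: complex_of_real_integrable_eq flip: of_real_power)
    then have "esq haar (?W u) = ennreal (LINT p|haar. (cmod (?W u p))\<^sup>2)"
      unfolding esq_def by (rule nn_integral_eq_integral) simp
    then have "(LINT p|haar. (cmod (?W u p))\<^sup>2) = (L2_norm u)\<^sup>2"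
      by (simp add: wavelet_isometry[OF adm u] esq_L2[OF u])
    then show ?thesis unfolding B_def L2_inner_self
      by (simp add: complex_norm_square[symmetric] del: of_real_power flip: of_real_power)
  qed
  have add: "B (\<lambda>x. u x + c * v x) (\<lambda>x. u x + c * v x) = B u u + cnj c * B u v + c * B v u + c * cnj c * B v v"
    if u: "u \<in> L2" and v: "v \<in> L2" for u v c
  proof -
    let ?s = "\<lambda>x. u x + c * v x"
    have W: "?W ?s p = ?W u p + c * ?W v p" if "p \<in> grp" for p
      using that by (simp add: wavelet_transform_add \<phi> u v L2_cmult wavelet_transform_cmult grp_iff)
    have "(LINT p|haar. ?W ?s p * cnj (?W ?s p)) =
        (LINT p|haar. ?W u p * cnj (?W u p) + cnj c * (?W u p * cnj (?W v p)) +
          c * (?W v p * cnj (?W u p)) + c * cnj c * (?W v p * cnj (?W v p)))"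
      by (rule Bochner_Integration.integral_cong) (auto simp: W algebra_simps)
    also have "\<dots> = (LINT p|haar. ?W u p * cnj (?W u p)) + cnj c * (LINT p|haar. ?W u p * cnj (?W v p)) +
          c * (LINT p|haar. ?W v p * cnj (?W u p)) + c * cnj c * (LINT p|haar. ?W v p * cnj (?W v p))"
      using int u v by simp
    moreover have "L2_inner ?s ?s = L2_inner u u + cnj c * L2_inner u v + c * L2_inner v u + c * cnj c * L2_inner v v"
      using u v by (simp add: L2_inner_add_left L2_inner_add_right L2_add L2_cmult L2_inner_cmult_left L2_inner_cmult_right algebra_simps)
    ultimately show ?thesis unfolding B_def by (simp add: algebra_simps)
  qed
  have "B f g + B g f = 0"
    using add[OF f g, of 1] self[OF L2_add[OF f g]] self[OF f] self[OF g] by simp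
  moreover have "- (\<i> * B f g) + \<i> * B g f = 0"
    using add[OF f g, of \<i>] self[OF L2_add[OF f L2_cmult[OF g]], of \<i>] self[OF f] self[OF g] by simp
  then have "\<i> * (B g f - B f g) = 0" by (simp add: algebra_simps)
  then have "B g f = B f g" by simp
  ultimately have "B f g = 0" by simp
  then show "(LINT p|haar. ?W f p * cnj (?W g p)) = L2_inner f g" by (simp add: B_def)
qed

section \<open>The index group\<close>

lemma grp_mult_eq: "grp_mult g p = (fst g * fst p, inverse (fst p) *\<^sub>R snd g + snd p)"
  by (cases g; cases p) simp

lemma borel_measurable_Pair_borel:
  fixes f :: "'a \<Rightarrow> 'b::second_countable_topology" and g :: "'a \<Rightarrow> 'c::second_countable_topology"
  assumes "f \<in> borel_measurable M" "g \<in> borel_measurable M"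
  shows "(\<lambda>x. (f x, g x)) \<in> borel_measurable M"
  using assms unfolding borel_prod[symmetric] by (rule measurable_Pair)

lemma grp_mult_measurable:
  fixes F :: "'a \<Rightarrow> real \<times> (real ^ 'd)"
  assumes "F \<in> borel_measurable M" "G \<in> borel_measurable M"
  shows "(\<lambda>x. grp_mult (F x) (G x)) \<in> borel_measurable M"
  unfolding grp_mult_eq using assms
  by (intro borel_measurable_Pair_borel borel_measurable_times borel_measurable_add borel_measurable_scaleR
      borel_measurable_inverse borel_measurable_fst borel_measurable_snd)

text \<open>Left multiplication scales the first coordinate by a constant and translates the second
  by a vector depending on the first. Integrating the second coordinate first removes the
  translation, and \<open>da / a\<close> is invariant under scaling.\<close>

lemma nn_integral_haar_left_invariant:
  fixes F :: "real \<times> (real ^ 'd) \<Rightarrow> ennreal"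
  assumes F: "F \<in> borel_measurable borel" and g: "g \<in> grp"
  shows "(\<integral>\<^sup>+p. F (grp_mult g p) \<partial>haar) = (\<integral>\<^sup>+p. F p \<partial>haar)"
proof -
  let ?a = "fst g"
  have a: "?a > 0" using g by (simp add: grp_iff)
  have [measurable]: "F \<in> borel_measurable (lborel \<Otimes>\<^sub>M lborel)" using F by (simp add: lborel_prod)
  define H where "H a = (\<integral>\<^sup>+b. F (a, b) \<partial>lborel)" for a
  have [measurable]: "H \<in> borel_measurable borel"
    unfolding H_def[abs_def] using lborel.borel_measurable_nn_integral_fst[of F lborel] by simp
  have "(\<integral>\<^sup>+p. F (grp_mult g p) \<partial>haar) =
      (\<integral>\<^sup>+a. indicator {0<..} a * ennreal (inverse a) * (\<integral>\<^sup>+b. F (grp_mult g (a, b)) \<partial>lborel) \<partial>lborel)"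
    by (rule nn_integral_haar) (rule measurable_compose[OF _ F], rule grp_mult_measurable, auto)
  also have "\<dots> = (\<integral>\<^sup>+a. indicator {0<..} a * ennreal (inverse a) * H (?a * a) \<partial>lborel)"
  proof (intro nn_integral_cong arg_cong2[where f = "(*)"] refl)
    fix a
    show "(\<integral>\<^sup>+b. F (grp_mult g (a, b)) \<partial>lborel) = H (?a * a)"
      unfolding H_def grp_mult_eq using nn_integral_lborel_translate[OF slice_measurable[OF F, of "?a * a"]] by simp
  qed
  also have "\<dots> = (\<integral>\<^sup>+a. ennreal ?a * (indicator {0<..} (?a * a) * ennreal (inverse (?a * a)) * H (?a * a)) \<partial>lborel)"
  proof (intro nn_integral_cong)
    fix t :: real
    have "indicator {0<..} t * ennreal (inverse t) = ennreal ?a * (indicator {0<..} (?a * t) * ennreal (inverse (?a * t)))"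
      using a by (auto split: split_indicator simp: zero_less_mult_iff simp flip: ennreal_mult)
    then show "indicator {0<..} t * ennreal (inverse t) * H (?a * t) =
        ennreal ?a * (indicator {0<..} (?a * t) * ennreal (inverse (?a * t)) * H (?a * t))"
      by (simp only: mult.assoc)
  qed
  also have "\<dots> = ennreal ?a * (\<integral>\<^sup>+a. indicator {0<..} (0 + ?a * a) * ennreal (inverse (0 + ?a * a)) * H (0 + ?a * a) \<partial>lborel)"
    by (subst nn_integral_cmult) auto
  also have "\<dots> = (\<integral>\<^sup>+a. indicator {0<..} a * ennreal (inverse a) * H a \<partial>lborel)"
    using nn_integral_real_affine[of "\<lambda>a. indicator {0<..} a * ennreal (inverse a) * H a" ?a 0] a by simp
  also have "\<dots> = (\<integral>\<^sup>+p. F p \<partial>haar)"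
    unfolding H_def by (rule nn_integral_haar[OF F, symmetric])
  finally show ?thesis .
qed

text \<open>Compact exhaustion of the group, used in place of metric balls. For \<open>m = 0\<close>
  the box is the single point \<open>(0, 0)\<close>, which lies outside \<open>grp\<close>.\<close>

definition grp_box :: "nat \<Rightarrow> (real \<times> (real ^ 'd)) set" where
  "grp_box m = {inverse (real m)..real m} \<times> cball 0 (real m)"

lemma grp_box_borel [measurable]: "(grp_box m :: (real \<times> (real ^ 'd)) set) \<in> sets borel"
  unfolding grp_box_def by (intro borel_closed closed_Times) auto

lemma emeasure_haar_box: "(\<integral>\<^sup>+p. indicator (grp_box m) p \<partial>(haar :: (real \<times> (real ^ 'd)) measure)) < \<infinity>"
proof -
  let ?C = "cball 0 (real m) :: (real ^ 'd) set"
  have "(\<integral>\<^sup>+p. indicator (grp_box m) p \<partial>(haar :: (real \<times> (real ^ 'd)) measure)) =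
      (\<integral>\<^sup>+a. indicator {0<..} a * ennreal (inverse a) * (\<integral>\<^sup>+b. indicator (grp_box m) (a, b :: real ^ 'd) \<partial>lborel) \<partial>lborel)"
    by (rule nn_integral_haar) simp
  also have "\<dots> \<le> (\<integral>\<^sup>+a. ennreal (real m) * indicator {inverse (real m)..real m} a * emeasure lborel ?C \<partial>lborel)"
  proof (intro nn_integral_mono)
    fix a :: real
    show "indicator {0<..} a * ennreal (inverse a) * (\<integral>\<^sup>+b. indicator (grp_box m) (a, b :: real ^ 'd) \<partial>lborel) \<le>
        ennreal (real m) * indicator {inverse (real m)..real m} a * emeasure lborel ?C"
    \<comment> \<open>In the second case one of the two indicators vanishes. The condition
      \<open>a > 0\<close> matters for \<open>m = 0\<close>, where the interval of scales is
      \<open>{0}\<close>.\<close>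
    proof (cases "a \<in> {inverse (real m)..real m} \<and> a > 0")
      case True
      have "(\<integral>\<^sup>+b. indicator (grp_box m) (a, b :: real ^ 'd) \<partial>lborel) = (\<integral>\<^sup>+b. indicator ?C b \<partial>lborel)"
        using True by (intro nn_integral_cong) (auto simp: grp_box_def split: split_indicator)
      also have "\<dots> = emeasure lborel ?C" by simp
      finally have e: "(\<integral>\<^sup>+b. indicator (grp_box m) (a, b :: real ^ 'd) \<partial>lborel) = emeasure lborel ?C" .
      have "m > 0" using True by (cases m) auto
      then have "inverse a \<le> inverse (inverse (real m))"
        using True by (intro le_imp_inverse_le) auto
      then show ?thesis using True unfolding e by (auto intro!: mult_right_mono ennreal_leI)
    next
      case False
      then have "indicator {0<..} a * (\<integral>\<^sup>+b. indicator (grp_box m) (a, b :: real ^ 'd) \<partial>lborel) = 0"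
        by (auto simp: grp_box_def split: split_indicator)
      then have "indicator {0<..} a * ennreal (inverse a) * (\<integral>\<^sup>+b. indicator (grp_box m) (a, b :: real ^ 'd) \<partial>lborel) = 0"
        unfolding mult.commute[of "indicator {0<..} a"] mult.assoc by (simp only: mult_zero_right)
      then show ?thesis by (simp only: zero_le)
    qed
  qed
  also have "\<dots> = ennreal (real m) * emeasure lborel {inverse (real m)..real m} * emeasure lborel ?C"
    by (simp add: nn_integral_multc nn_integral_cmult)
  also have "\<dots> < \<infinity>"
    using emeasure_bounded_finite[of ?C] emeasure_bounded_finite[of "{inverse (real m)..real m}"]
    by (simp add: ennreal_mult_less_top less_top)
  finally show ?thesis .
qed

lemma grp_box_cover:
  assumes "p \<in> grp"
  obtains m where "p \<in> grp_box m"
proof -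
  have p: "fst p > 0" using assms by (simp add: grp_iff)
  obtain m :: nat where "max (max (fst p) (inverse (fst p))) (norm (snd p)) \<le> real m"
    using real_arch_simple by blast
  then have m: "fst p \<le> real m" "inverse (fst p) \<le> real m" "norm (snd p) \<le> real m" by auto
  have "inverse (real m) \<le> inverse (inverse (fst p))"
    using m(2) p by (intro le_imp_inverse_le) auto
  then have "p \<in> grp_box m" using m by (cases p) (simp add: grp_box_def)
  then show ?thesis by (rule that)
qed

lemma sigma_finite_haar: "sigma_finite_measure (haar :: (real \<times> (real ^ 'd)) measure)"
proof
  let ?A = "range (\<lambda>m. grp_box m \<inter> grp :: (real \<times> (real ^ 'd)) set)"
  have sets: "grp_box m \<inter> grp \<in> sets (haar :: (real \<times> (real ^ 'd)) measure)" for m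
    unfolding haar_def by (auto simp: sets_restrict_space)
  have "emeasure haar (grp_box m \<inter> grp :: (real \<times> (real ^ 'd)) set) \<noteq> \<infinity>" for m
  proof -
    have "emeasure haar (grp_box m \<inter> grp :: (real \<times> (real ^ 'd)) set) = (\<integral>\<^sup>+p. indicator (grp_box m \<inter> grp :: (real \<times> (real ^ 'd)) set) p \<partial>haar)"
      by (rule nn_integral_indicator[OF sets, symmetric])
    also have "\<dots> = (\<integral>\<^sup>+p. indicator (grp_box m :: (real \<times> (real ^ 'd)) set) p \<partial>haar)"
      by (intro nn_integral_cong) (auto split: split_indicator)
    finally show ?thesis using emeasure_haar_box[of m, where 'd = 'd] by auto
  qed
  moreover have "(\<Union>m. grp_box m \<inter> grp) = (grp :: (real \<times> (real ^ 'd)) set)"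
  proof (intro equalityI subsetI)
    fix p :: "real \<times> (real ^ 'd)" assume p: "p \<in> grp"
    then obtain m where "p \<in> grp_box m" by (rule grp_box_cover)
    with p show "p \<in> (\<Union>m. grp_box m \<inter> grp)" by blast
  qed blast
  ultimately show "\<exists>A. countable A \<and> A \<subseteq> sets (haar :: (real \<times> (real ^ 'd)) measure) \<and> \<Union> A = space haar \<and> (\<forall>a\<in>A. emeasure haar a \<noteq> \<infinity>)"
    using sets by (intro exI[of _ ?A]) auto
qed

interpretation haar: sigma_finite_measure "haar :: (real \<times> (real ^ 'd)) measure"
  by (rule sigma_finite_haar)

interpretation haar_pair: pair_sigma_finite "haar :: (real \<times> (real ^ 'd)) measure" "haar :: (real \<times> (real ^ 'd)) measure" ..

section \<open>The reproducing kernel\<close>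

text \<open>The group law is the one for which the maps \<open>wavelet _ g\<close> form a
  representation; together with their unitarity this is the source of the left invariance used
  below.\<close>

lemma wavelet_grp_mult:
  assumes "fst g > 0" "fst p > 0"
  shows "wavelet \<phi> (grp_mult g p) = wavelet (wavelet \<phi> p) g"
proof
  fix x
  have "inverse (fst g * fst p) *\<^sub>R x - (inverse (fst p) *\<^sub>R snd g + snd p) =
      inverse (fst p) *\<^sub>R (inverse (fst g) *\<^sub>R x - snd g) - snd p"
    by (simp add: scaleR_diff_right mult.commute)
  then have "\<phi> (inverse (fst g * fst p) *\<^sub>R x - (inverse (fst p) *\<^sub>R snd g + snd p)) =
      \<phi> (inverse (fst p) *\<^sub>R (inverse (fst g) *\<^sub>R x - snd g) - snd p)"
    by (rule arg_cong)
  then show "wavelet \<phi> (grp_mult g p) x = wavelet (wavelet \<phi> p) g x"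
    unfolding wavelet_eq grp_mult_eq fst_conv snd_conv using assms by (simp only: powr_mult of_real_mult mult.assoc)
qed

lemma L2_inner_wavelet:
  fixes f h :: "real ^ 'd \<Rightarrow> complex"
  assumes f: "f \<in> L2" and h: "h \<in> L2" and g: "fst g > 0"
  shows "L2_inner (wavelet f g) (wavelet h g) = L2_inner f h"
proof -
  note [measurable] = L2_measurable[OF f] L2_measurable[OF h]
  let ?c = "fst g powr (- (real CARD('d) / 2))"
  let ?F = "\<lambda>y. f y * cnj (h y)"
  have "L2_inner f h = complex_of_real (inverse (fst g) ^ CARD('d)) *
      (LINT x|lborel. ?F (- snd g + inverse (fst g) *\<^sub>R x))"
    unfolding L2_inner_def using g integral_lborel_affine[of ?F "inverse (fst g)" "- snd g"] by simp
  also have "complex_of_real (inverse (fst g) ^ CARD('d)) = complex_of_real ?c * complex_of_real ?c"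
    using powr_half_sq[OF g, of "CARD('d)"] by (simp add: power2_eq_square power_inverse flip: of_real_mult)
  also have "\<dots> * (LINT x|lborel. ?F (- snd g + inverse (fst g) *\<^sub>R x)) =
      (LINT x|lborel. complex_of_real ?c * complex_of_real ?c * ?F (- snd g + inverse (fst g) *\<^sub>R x))"
    by (rule integral_mult_right_zero[symmetric])
  also have "\<dots> = L2_inner (wavelet f g) (wavelet h g)"
    unfolding L2_inner_def wavelet_eq by (intro Bochner_Integration.integral_cong) (auto simp: mult_ac)
  finally show ?thesis ..
qed

text \<open>Modulus of the reproducing kernel for the range of the wavelet transform. Only size
  estimates are made with it, and without the phase it is symmetric.\<close>

definition kernel :: "(real ^ 'd \<Rightarrow> complex) \<Rightarrow> real \<times> (real ^ 'd) \<Rightarrow> real \<times> (real ^ 'd) \<Rightarrow> real" where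
  "kernel \<phi> p q = cmod (L2_inner (wavelet \<phi> p) (wavelet \<phi> q))"

lemma kernel_nonneg [simp]: "kernel \<phi> p q \<ge> 0"
  by (simp add: kernel_def)

lemma kernel_commute: "kernel \<phi> p q = kernel \<phi> q p"
  unfolding kernel_def by (rule cmod_L2_inner_commute)

lemma kernel_left_invariant:
  "\<phi> \<in> L2 \<Longrightarrow> g \<in> grp \<Longrightarrow> p \<in> grp \<Longrightarrow> q \<in> grp \<Longrightarrow> kernel \<phi> (grp_mult g p) (grp_mult g q) = kernel \<phi> p q"
  by (simp add: kernel_def wavelet_grp_mult L2_inner_wavelet wavelet_L2 grp_iff)

lemma kernel_measurable_pair:
  fixes \<phi> :: "real ^ 'd \<Rightarrow> complex"
  assumes \<phi>: "\<phi> \<in> L2" and F: "F \<in> borel_measurable M" and G: "G \<in> borel_measurable M"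
  shows "(\<lambda>z. kernel \<phi> (F z) (G z)) \<in> borel_measurable M"
proof -
  note [measurable] = L2_measurable[OF \<phi>]
  let ?N = "M \<Otimes>\<^sub>M (lborel :: (real ^ 'd) measure)"
  have m: "(\<lambda>z. F (fst z)) \<in> borel_measurable ?N" "(\<lambda>z. G (fst z)) \<in> borel_measurable ?N" "snd \<in> borel_measurable ?N"
    using measurable_compose[OF measurable_fst F] measurable_compose[OF measurable_fst G]
      measurable_snd[of M "lborel :: (real ^ 'd) measure"] by auto
  have "(\<lambda>z. wavelet \<phi> (F (fst z)) (snd z) * cnj (wavelet \<phi> (G (fst z)) (snd z))) \<in> borel_measurable ?N"
    by (intro borel_measurable_times borel_measurable_cnj wavelet_measurable m) measurable
  then have "(\<lambda>z. LINT x|lborel. wavelet \<phi> (F z) x * cnj (wavelet \<phi> (G z) x)) \<in> borel_measurable M"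
    by (intro lborel.borel_measurable_lebesgue_integral) (simp add: case_prod_beta')
  then show ?thesis unfolding kernel_def L2_inner_def by measurable
qed

lemma haar_id_measurable: "(\<lambda>p. p) \<in> borel_measurable (haar :: (real \<times> (real ^ 'd)) measure)"
  by (rule borel_measurable_haar) simp

section \<open>A Schur test\<close>

text \<open>The inequality \<open>2 * u x * u y \<le> (u x)^2 * v y / v x + (u y)^2 * v x / v
  y\<close> splits the form into two parts. Symmetry of \<open>h\<close> and Tonelli make them
  equal, so a single row estimate bounds the form by \<open>S\<close> times the squared
  norm.\<close>

lemma (in sigma_finite_measure) Schur_test:
  fixes h :: "'a \<Rightarrow> 'a \<Rightarrow> ennreal" and u v :: "'a \<Rightarrow> real"
  assumes h: "case_prod h \<in> borel_measurable (M \<Otimes>\<^sub>M M)"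
    and u: "u \<in> borel_measurable M" "\<And>x. u x \<ge> 0"
    and v: "v \<in> borel_measurable M" "\<And>x. x \<in> space M \<Longrightarrow> v x > 0"
    and sym: "\<And>x y. h x y = h y x"
    and bd: "\<And>x. x \<in> space M \<Longrightarrow> (\<integral>\<^sup>+y. h x y * ennreal (v y) \<partial>M) \<le> S * ennreal (v x)"
  shows "(\<integral>\<^sup>+x. \<integral>\<^sup>+y. ennreal (u x) * ennreal (u y) * h x y \<partial>M \<partial>M) \<le> S * (\<integral>\<^sup>+x. ennreal ((u x)\<^sup>2) \<partial>M)"
proof -
  interpret P: pair_sigma_finite M M ..
  note [measurable] = h u(1) v(1)
  have [measurable]: "(\<lambda>(x, y). h y x) \<in> borel_measurable (M \<Otimes>\<^sub>M M)"
    using h by (subst sym) simp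
  define A where "A x y = ennreal ((u x)\<^sup>2 * (v y / v x)) * h x y" for x y
  have [measurable]: "case_prod A \<in> borel_measurable (M \<Otimes>\<^sub>M M)"
    unfolding A_def by measurable
  have Ale: "(\<integral>\<^sup>+x. \<integral>\<^sup>+y. A x y \<partial>M \<partial>M) \<le> S * (\<integral>\<^sup>+x. ennreal ((u x)\<^sup>2) \<partial>M)"
  proof -
    have "(\<integral>\<^sup>+x. \<integral>\<^sup>+y. A x y \<partial>M \<partial>M) \<le> (\<integral>\<^sup>+x. S * ennreal ((u x)\<^sup>2) \<partial>M)"
    proof (intro nn_integral_mono)
      fix x assume x: "x \<in> space M"
      have hx: "h x \<in> borel_measurable M" using x by measurable
      have "(\<integral>\<^sup>+y. A x y \<partial>M) = (\<integral>\<^sup>+y. ennreal ((u x)\<^sup>2 / v x) * (h x y * ennreal (v y)) \<partial>M)"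
      proof (intro nn_integral_cong)
        fix y assume y: "y \<in> space M"
        have "ennreal ((u x)\<^sup>2 * (v y / v x)) = ennreal ((u x)\<^sup>2 / v x) * ennreal (v y)"
          using v(2)[OF x] v(2)[OF y] by (simp flip: ennreal_mult)
        then show "A x y = ennreal ((u x)\<^sup>2 / v x) * (h x y * ennreal (v y))"
          by (simp only: A_def mult_ac)
      qed
      also have "\<dots> = ennreal ((u x)\<^sup>2 / v x) * (\<integral>\<^sup>+y. h x y * ennreal (v y) \<partial>M)"
        by (rule nn_integral_cmult) (use hx in measurable)
      also have "\<dots> \<le> ennreal ((u x)\<^sup>2 / v x) * (S * ennreal (v x))"
        by (intro mult_left_mono bd x) simp
      also have "\<dots> = S * (ennreal ((u x)\<^sup>2 / v x) * ennreal (v x))" by (simp only: mult_ac)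
      also have "ennreal ((u x)\<^sup>2 / v x) * ennreal (v x) = ennreal ((u x)\<^sup>2)"
        using v(2)[OF x] by (simp flip: ennreal_mult)
      finally show "(\<integral>\<^sup>+y. A x y \<partial>M) \<le> S * ennreal ((u x)\<^sup>2)" .
    qed
    also have "\<dots> = S * (\<integral>\<^sup>+x. ennreal ((u x)\<^sup>2) \<partial>M)" by (rule nn_integral_cmult) measurable
    finally show ?thesis .
  qed
  have swap: "(\<integral>\<^sup>+x. \<integral>\<^sup>+y. A y x \<partial>M \<partial>M) = (\<integral>\<^sup>+x. \<integral>\<^sup>+y. A x y \<partial>M \<partial>M)"
    by (rule P.Fubini') measurable
  have "2 * (\<integral>\<^sup>+x. \<integral>\<^sup>+y. ennreal (u x) * ennreal (u y) * h x y \<partial>M \<partial>M) =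
      (\<integral>\<^sup>+x. \<integral>\<^sup>+y. 2 * (ennreal (u x) * ennreal (u y) * h x y) \<partial>M \<partial>M)"
    by (subst nn_integral_cmult[symmetric], measurable) (intro nn_integral_cong nn_integral_cmult[symmetric], measurable)
  also have "\<dots> \<le> (\<integral>\<^sup>+x. \<integral>\<^sup>+y. A x y + A y x \<partial>M \<partial>M)"
  proof (intro nn_integral_mono)
    fix x y assume x: "x \<in> space M" and y: "y \<in> space M"
    note pos = v(2)[OF x] v(2)[OF y]
    have "2 * u x * u y \<le> (u x)\<^sup>2 * (v y / v x) + (u y)\<^sup>2 * (v x / v y)"
    proof -
      have "0 \<le> (u x * v y - u y * v x)\<^sup>2 / (v x * v y)" using pos by simp
      also have "\<dots> = (u x)\<^sup>2 * (v y / v x) + (u y)\<^sup>2 * (v x / v y) - 2 * u x * u y"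
        using pos by (simp add: field_simps power2_eq_square)
      finally show ?thesis by simp
    qed
    then have "2 * (ennreal (u x) * ennreal (u y)) \<le> ennreal ((u x)\<^sup>2 * (v y / v x)) + ennreal ((u y)\<^sup>2 * (v x / v y))"
    proof -
      assume le: "2 * u x * u y \<le> (u x)\<^sup>2 * (v y / v x) + (u y)\<^sup>2 * (v x / v y)"
      have "2 * (ennreal (u x) * ennreal (u y)) = ennreal (2 * u x * u y)"
        by (simp add: ennreal_mult u(2) mult.assoc)
      also have "\<dots> \<le> ennreal ((u x)\<^sup>2 * (v y / v x) + (u y)\<^sup>2 * (v x / v y))"
        by (rule ennreal_leI[OF le])
      also have "\<dots> = ennreal ((u x)\<^sup>2 * (v y / v x)) + ennreal ((u y)\<^sup>2 * (v x / v y))"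
        using pos by (intro ennreal_plus) auto
      finally show ?thesis .
    qed
    then have "2 * (ennreal (u x) * ennreal (u y)) * h x y \<le>
        (ennreal ((u x)\<^sup>2 * (v y / v x)) + ennreal ((u y)\<^sup>2 * (v x / v y))) * h x y"
      by (rule mult_right_mono) simp
    then show "2 * (ennreal (u x) * ennreal (u y) * h x y) \<le> A x y + A y x"
      unfolding A_def sym[of y x] distrib_right by (simp only: mult.assoc)
  qed
  also have "\<dots> = (\<integral>\<^sup>+x. \<integral>\<^sup>+y. A x y \<partial>M \<partial>M) + (\<integral>\<^sup>+x. \<integral>\<^sup>+y. A y x \<partial>M \<partial>M)"
    by (subst nn_integral_add[symmetric], measurable) (intro nn_integral_cong nn_integral_add, measurable)
  also have "\<dots> = 2 * (\<integral>\<^sup>+x. \<integral>\<^sup>+y. A x y \<partial>M \<partial>M)" unfolding swap by (simp add: mult_2)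
  also have "\<dots> \<le> 2 * (S * (\<integral>\<^sup>+x. ennreal ((u x)\<^sup>2) \<partial>M))" by (intro mult_left_mono Ale) simp
  finally show ?thesis by (subst (asm) ennreal_mult_le_mult_iff) auto
qed

section \<open>Thin functions\<close>

text \<open>Berezin transform of \<open>\<sigma>\<close>: the diagonal entry of its localization
  operator at \<open>wavelet \<phi> q\<close>, which is the integral occurring in
  \<open>thin\<close>.\<close>

definition berezin :: "(real ^ 'd \<Rightarrow> complex) \<Rightarrow> (real \<times> (real ^ 'd) \<Rightarrow> real) \<Rightarrow> real \<times> (real ^ 'd) \<Rightarrow> ennreal" where
  "berezin \<phi> \<sigma> q = (\<integral>\<^sup>+p. ennreal (\<sigma> p * (kernel \<phi> p q)\<^sup>2) \<partial>haar)"

text \<open>Absolute values of the matrix entries of a localization operator, and their majorant for \<open>\<sigma> = 1\<close>.\<close>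

definition loc_kernel :: "(real ^ 'd \<Rightarrow> complex) \<Rightarrow> (real \<times> (real ^ 'd) \<Rightarrow> real) \<Rightarrow>
    real \<times> (real ^ 'd) \<Rightarrow> real \<times> (real ^ 'd) \<Rightarrow> ennreal" where
  "loc_kernel \<phi> \<sigma> q q' = (\<integral>\<^sup>+p. ennreal (\<sigma> p) * (ennreal (kernel \<phi> p q) * ennreal (kernel \<phi> p q')) \<partial>haar)"

lemma loc_kernel_commute: "loc_kernel \<phi> \<sigma> q q' = loc_kernel \<phi> \<sigma> q' q"
  unfolding loc_kernel_def by (simp only: mult.commute[of "ennreal (kernel \<phi> _ q)"])

lemma haar_fst_measurable: "(\<lambda>z. fst z) \<in> borel_measurable ((haar :: (real \<times> (real ^ 'd)) measure) \<Otimes>\<^sub>M M)"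
  by (rule measurable_compose[OF measurable_fst haar_id_measurable])

lemma haar_snd_measurable: "(\<lambda>z. snd z) \<in> borel_measurable (M \<Otimes>\<^sub>M (haar :: (real \<times> (real ^ 'd)) measure))"
  by (rule measurable_compose[OF measurable_snd haar_id_measurable])

lemma loc_kernel_measurable:
  fixes \<phi> :: "real ^ 'd \<Rightarrow> complex"
  assumes \<phi>: "\<phi> \<in> L2" and \<sigma>: "\<sigma> \<in> borel_measurable borel"
    and F: "F \<in> borel_measurable M" and G: "G \<in> borel_measurable M"
  shows "(\<lambda>z. loc_kernel \<phi> \<sigma> (F z) (G z)) \<in> borel_measurable M"
proof -
  let ?N = "M \<Otimes>\<^sub>M (haar :: (real \<times> (real ^ 'd)) measure)"
  have [measurable]: "(\<lambda>z. \<sigma> (snd z)) \<in> borel_measurable ?N"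
    by (rule measurable_compose[OF haar_snd_measurable \<sigma>])
  have [measurable]: "(\<lambda>z. kernel \<phi> (snd z) (F (fst z))) \<in> borel_measurable ?N"
    "(\<lambda>z. kernel \<phi> (snd z) (G (fst z))) \<in> borel_measurable ?N"
    by (intro kernel_measurable_pair \<phi> haar_snd_measurable measurable_compose[OF measurable_fst] F G)+
  show ?thesis unfolding loc_kernel_def
    by (rule haar.borel_measurable_nn_integral) (simp add: case_prod_beta')
qed

lemma kernel_measurable:
  fixes \<phi> :: "real ^ 'd \<Rightarrow> complex"
  shows "\<phi> \<in> L2 \<Longrightarrow> (\<lambda>p. kernel \<phi> p q) \<in> borel_measurable borel"
  by (rule kernel_measurable_pair) auto

text \<open>Cauchy-Schwarz for the measure with density \<open>\<sigma>\<close>: off-diagonal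
  entries are controlled by the diagonal, and the diagonal is what thinness speaks about.\<close>

lemma loc_kernel_sq_le:
  fixes \<phi> :: "real ^ 'd \<Rightarrow> complex"
  assumes \<phi>: "\<phi> \<in> L2" and \<sigma>: "\<sigma> \<in> borel_measurable borel" "\<And>p. \<sigma> p \<ge> 0"
  shows "(loc_kernel \<phi> \<sigma> q q')\<^sup>2 \<le> berezin \<phi> \<sigma> q * berezin \<phi> \<sigma> q'"
proof -
  let ?M = "density haar (\<lambda>p. ennreal (\<sigma> p))"
  note [measurable] = borel_measurable_haar[OF \<sigma>(1)] borel_measurable_haar[OF kernel_measurable[OF \<phi>]]
  have dens: "(\<integral>\<^sup>+p. F p \<partial>?M) = (\<integral>\<^sup>+p. ennreal (\<sigma> p) * F p \<partial>haar)" if "F \<in> borel_measurable haar" for F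
    using that by (intro nn_integral_density) measurable
  have sq: "(\<integral>\<^sup>+p. (ennreal (kernel \<phi> p r))\<^sup>2 \<partial>?M) = berezin \<phi> \<sigma> r" for r
    unfolding berezin_def by (subst dens) (auto simp: ennreal_power ennreal_mult \<sigma>(2))
  have "(\<integral>\<^sup>+p. ennreal (kernel \<phi> p q) * ennreal (kernel \<phi> p q') \<partial>?M)\<^sup>2 \<le>
      (\<integral>\<^sup>+p. (ennreal (kernel \<phi> p q))\<^sup>2 \<partial>?M) * (\<integral>\<^sup>+p. (ennreal (kernel \<phi> p q'))\<^sup>2 \<partial>?M)"
    by (rule Cauchy_Schwarz_nn_integral) measurable
  then show ?thesis unfolding sq by (subst (asm) dens) (auto simp: loc_kernel_def)
qed

lemma kernel_wavelet_transform: "kernel \<phi> p q = cmod (wavelet_transform \<phi> (wavelet \<phi> p) q)"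
  by (simp add: kernel_def wavelet_transform_def)

text \<open>For \<open>\<sigma> = 1\<close> this is the isometry applied to
  \<open>wavelet \<phi> q\<close>, whose norm is that of the window.\<close>

lemma berezin_le:
  fixes \<phi> :: "real ^ 'd \<Rightarrow> complex"
  assumes adm: "\<phi> \<in> admissible" and \<sigma>: "\<And>p. \<sigma> p \<le> 1" and q: "q \<in> grp"
  shows "berezin \<phi> \<sigma> q \<le> ennreal ((L2_norm \<phi>)\<^sup>2)"
proof -
  have \<phi>: "\<phi> \<in> L2" by (rule admissible_L2[OF adm])
  have "berezin \<phi> \<sigma> q \<le> esq haar (wavelet_transform \<phi> (wavelet \<phi> q))"
    unfolding berezin_def esq_def
  proof (intro nn_integral_mono ennreal_leI)
    fix p
    have "\<sigma> p * (kernel \<phi> p q)\<^sup>2 \<le> 1 * (kernel \<phi> p q)\<^sup>2" by (intro mult_right_mono \<sigma>) simp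
    then show "\<sigma> p * (kernel \<phi> p q)\<^sup>2 \<le> (cmod (wavelet_transform \<phi> (wavelet \<phi> q) p))\<^sup>2"
      unfolding kernel_commute[of \<phi> p q] kernel_wavelet_transform[of \<phi> q p] by (simp only: mult_1)
  qed
  also have "\<dots> = esq lborel \<phi>"
    using q by (subst wavelet_isometry[OF adm]) (auto simp: grp_iff wavelet_L2 \<phi> esq_wavelet L2_measurable)
  finally show ?thesis by (simp add: esq_L2 \<phi>)
qed

text \<open>The value at \<open>p\<close> is an inner product with \<open>wavelet \<phi> p\<close>,
  which Parseval's identity writes as an integral over the group.\<close>

lemma reproducing_le:
  fixes \<phi> :: "real ^ 'd \<Rightarrow> complex"
  assumes adm: "\<phi> \<in> admissible" and f: "f \<in> L2" and p: "p \<in> grp"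
  shows "ennreal (cmod (wavelet_transform \<phi> f p)) \<le>
    (\<integral>\<^sup>+q. ennreal (cmod (wavelet_transform \<phi> f q)) * ennreal (kernel \<phi> p q) \<partial>haar)"
proof -
  have \<phi>: "\<phi> \<in> L2" by (rule admissible_L2[OF adm])
  have w: "wavelet \<phi> p \<in> L2" using p by (simp add: grp_iff wavelet_L2 \<phi>)
  have "ennreal (cmod (wavelet_transform \<phi> f p)) =
      ennreal (cmod (LINT q|haar. wavelet_transform \<phi> f q * cnj (wavelet_transform \<phi> (wavelet \<phi> p) q)))"
    using wavelet_parseval(2)[OF adm f w] by (simp add: wavelet_transform_def)
  also have "\<dots> \<le> (\<integral>\<^sup>+q. ennreal (norm (wavelet_transform \<phi> f q * cnj (wavelet_transform \<phi> (wavelet \<phi> p) q))) \<partial>haar)"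
    by (rule integral_norm_bound_ennreal[OF wavelet_parseval(1)[OF adm f w]])
  finally show ?thesis by (simp add: norm_mult ennreal_mult kernel_wavelet_transform)
qed

text \<open>Both factors of \<open>|W f p|^2\<close> are replaced by their reproducing bounds;
  performing the integration over \<open>p\<close> first leaves a quadratic form in
  \<open>|W f|\<close> with kernel \<open>loc_kernel\<close>, the shape that Schur's test
  treats.\<close>

lemma energy_le_loc_kernel:
  fixes \<phi> :: "real ^ 'd \<Rightarrow> complex"
  assumes adm: "\<phi> \<in> admissible" and f: "f \<in> L2" and \<sigma>: "\<sigma> \<in> borel_measurable borel" "\<And>p. \<sigma> p \<ge> 0"
  shows "(\<integral>\<^sup>+p. ennreal (\<sigma> p * (cmod (wavelet_transform \<phi> f p))\<^sup>2) \<partial>haar) \<le>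
    (\<integral>\<^sup>+q. \<integral>\<^sup>+q'. ennreal (cmod (wavelet_transform \<phi> f q)) * ennreal (cmod (wavelet_transform \<phi> f q')) *
      loc_kernel \<phi> \<sigma> q q' \<partial>haar \<partial>haar)"
proof -
  have \<phi>: "\<phi> \<in> L2" by (rule admissible_L2[OF adm])
  let ?H = "haar :: (real \<times> (real ^ 'd)) measure"
  define u where "u p = ennreal (cmod (wavelet_transform \<phi> f p))" for p
  define k where "k p q = ennreal (kernel \<phi> p q)" for p q
  have [measurable]: "u \<in> borel_measurable borel"
    unfolding u_def[abs_def] using wavelet_transform_measurable[OF \<phi> f] by measurable
  have um[measurable]: "u \<in> borel_measurable ?H" by (rule borel_measurable_haar) measurable
  have [measurable]: "\<sigma> \<in> borel_measurable ?H" by (rule borel_measurable_haar[OF \<sigma>(1)])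
  have km: "(\<lambda>z. k (F z) (G z)) \<in> borel_measurable M" if "F \<in> borel_measurable M" "G \<in> borel_measurable M" for F G M
    unfolding k_def using kernel_measurable_pair[OF \<phi> that] by measurable
  have [measurable]: "(\<lambda>z. k (fst z) (snd z)) \<in> borel_measurable (?H \<Otimes>\<^sub>M ?H)"
    "(\<lambda>z. k (snd z) (fst z)) \<in> borel_measurable (?H \<Otimes>\<^sub>M ?H)"
    by (intro km haar_fst_measurable haar_snd_measurable)+
  have kp[measurable]: "k p \<in> borel_measurable ?H" "(\<lambda>p. k p q) \<in> borel_measurable ?H" for p q
    by (intro km haar_id_measurable measurable_const; simp)+
  have "(\<integral>\<^sup>+p. ennreal (\<sigma> p * (cmod (wavelet_transform \<phi> f p))\<^sup>2) \<partial>?H) = (\<integral>\<^sup>+p. ennreal (\<sigma> p) * (u p * u p) \<partial>?H)"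
    by (intro nn_integral_cong) (simp add: u_def \<sigma>(2) power2_eq_square flip: ennreal_mult)
  also have "\<dots> \<le> (\<integral>\<^sup>+p. ennreal (\<sigma> p) * ((\<integral>\<^sup>+q. u q * k p q \<partial>?H) * (\<integral>\<^sup>+q'. u q' * k p q' \<partial>?H)) \<partial>?H)"
    unfolding u_def k_def by (intro nn_integral_mono mult_left_mono mult_mono reproducing_le adm f) auto
  also have "\<dots> = (\<integral>\<^sup>+p. \<integral>\<^sup>+q. \<integral>\<^sup>+q'. u q * u q' * (ennreal (\<sigma> p) * (k p q * k p q')) \<partial>?H \<partial>?H \<partial>?H)"
  proof (intro nn_integral_cong)
    fix p
    have "(\<integral>\<^sup>+q. \<integral>\<^sup>+q'. u q * u q' * (ennreal (\<sigma> p) * (k p q * k p q')) \<partial>?H \<partial>?H) =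
        (\<integral>\<^sup>+q. ennreal (\<sigma> p) * (u q * k p q) * (\<integral>\<^sup>+q'. u q' * k p q' \<partial>?H) \<partial>?H)"
      by (subst nn_integral_cmult[symmetric]) (measurable, simp only: mult_ac)
    also have "\<dots> = (\<integral>\<^sup>+q. ennreal (\<sigma> p) * (u q * k p q) \<partial>?H) * (\<integral>\<^sup>+q'. u q' * k p q' \<partial>?H)"
      by (rule nn_integral_multc) measurable
    also have "\<dots> = ennreal (\<sigma> p) * (\<integral>\<^sup>+q. (u q * k p q) \<partial>?H) * (\<integral>\<^sup>+q'. u q' * k p q' \<partial>?H)"
      by (subst nn_integral_cmult) measurable
    finally show "ennreal (\<sigma> p) * ((\<integral>\<^sup>+q. u q * k p q \<partial>?H) * (\<integral>\<^sup>+q'. u q' * k p q' \<partial>?H)) =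
        (\<integral>\<^sup>+q. \<integral>\<^sup>+q'. u q * u q' * (ennreal (\<sigma> p) * (k p q * k p q')) \<partial>?H \<partial>?H)"
      by (simp only: mult.assoc)
  qed
  also have "\<dots> = (\<integral>\<^sup>+q. \<integral>\<^sup>+p. \<integral>\<^sup>+q'. u q * u q' * (ennreal (\<sigma> p) * (k p q * k p q')) \<partial>?H \<partial>?H \<partial>?H)"
  proof (rule haar_pair.Fubini'[symmetric])
    let ?N = "(?H \<Otimes>\<^sub>M ?H) \<Otimes>\<^sub>M ?H"
    have m: "(\<lambda>z. fst (fst z)) \<in> measurable ?N ?H" "(\<lambda>z. snd (fst z)) \<in> measurable ?N ?H" "snd \<in> measurable ?N ?H"
      by measurable
    note mb = measurable_compose[OF m(1) haar_id_measurable] measurable_compose[OF m(2) haar_id_measurable]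
      measurable_compose[OF m(3) haar_id_measurable]
    have "(\<lambda>z. u (snd (fst z)) * u (snd z) * (ennreal (\<sigma> (fst (fst z))) * (k (fst (fst z)) (snd (fst z)) * k (fst (fst z)) (snd z)))) \<in> borel_measurable ?N"
      using km[OF mb(1,2)] km[OF mb(1,3)] measurable_compose[OF m(2) um] measurable_compose[OF m(3) um] by measurable
    then show "(\<lambda>(p, q). \<integral>\<^sup>+q'. u q * u q' * (ennreal (\<sigma> p) * (k p q * k p q')) \<partial>?H) \<in> borel_measurable (?H \<Otimes>\<^sub>M ?H)"
      unfolding case_prod_beta' by (intro haar.borel_measurable_nn_integral) (simp add: case_prod_beta')
  qed
  also have "\<dots> = (\<integral>\<^sup>+q. \<integral>\<^sup>+q'. \<integral>\<^sup>+p. u q * u q' * (ennreal (\<sigma> p) * (k p q * k p q')) \<partial>?H \<partial>?H \<partial>?H)"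
  proof (rule nn_integral_cong)
    fix q
    have "(\<lambda>z. k (fst z) q) \<in> borel_measurable (?H \<Otimes>\<^sub>M ?H)"
      by (intro km haar_fst_measurable) simp
    then show "(\<integral>\<^sup>+p. \<integral>\<^sup>+q'. u q * u q' * (ennreal (\<sigma> p) * (k p q * k p q')) \<partial>?H \<partial>?H) =
        (\<integral>\<^sup>+q'. \<integral>\<^sup>+p. u q * u q' * (ennreal (\<sigma> p) * (k p q * k p q')) \<partial>?H \<partial>?H)"
      by (intro haar_pair.Fubini'[symmetric]) (simp only: case_prod_beta', measurable)
  qed
  also have "\<dots> = (\<integral>\<^sup>+q. \<integral>\<^sup>+q'. u q * u q' * loc_kernel \<phi> \<sigma> q q' \<partial>?H \<partial>?H)"
    unfolding loc_kernel_def k_def[symmetric] by (intro nn_integral_cong nn_integral_cmult) measurable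
  finally show ?thesis unfolding u_def .
qed

text \<open>The weight \<open>a\<^sup>s\<close> is multiplicative on the group, so left invariance makes it a Schur weight for
  every left-invariant symmetric kernel that is integrable against it.\<close>

definition wt :: "real \<Rightarrow> real \<times> (real ^ 'd) \<Rightarrow> real" where
  "wt s p = fst p powr s"

lemma wt_pos: "p \<in> grp \<Longrightarrow> wt s p > 0"
  by (simp add: wt_def grp_iff)

lemma wt_mult: "g \<in> grp \<Longrightarrow> p \<in> grp \<Longrightarrow> wt s (grp_mult g p) = wt s g * wt s p"
  by (simp add: wt_def grp_mult_eq grp_iff powr_mult)

lemma wt_measurable [measurable]: "(wt s :: real \<times> (real ^ 'd) \<Rightarrow> real) \<in> borel_measurable borel"
  unfolding wt_def[abs_def] by (intro powr_real_measurable borel_measurable_fst) auto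

lemma grp_one_grp: "grp_one \<in> grp"
  by (simp add: grp_one_def grp_def)

lemma grp_mult_one: "grp_mult g grp_one = g"
  by (simp add: grp_one_def grp_mult_eq)

lemma Schur_left_invariant:
  fixes h :: "real \<times> (real ^ 'd) \<Rightarrow> real \<times> (real ^ 'd) \<Rightarrow> ennreal"
  assumes h: "\<And>q. h q \<in> borel_measurable borel"
    and inv: "\<And>g p. g \<in> grp \<Longrightarrow> p \<in> grp \<Longrightarrow> h g (grp_mult g p) = h grp_one p"
    and q: "q \<in> grp"
  shows "(\<integral>\<^sup>+p. h q p * ennreal (wt s p) \<partial>haar) = (\<integral>\<^sup>+p. h grp_one p * ennreal (wt s p) \<partial>haar) * ennreal (wt s q)"
proof -
  note [measurable] = h
  have "(\<integral>\<^sup>+p. h q p * ennreal (wt s p) \<partial>haar) = (\<integral>\<^sup>+p. h q (grp_mult q p) * ennreal (wt s (grp_mult q p)) \<partial>haar)"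
    by (rule nn_integral_haar_left_invariant[OF _ q, symmetric]) measurable
  also have "\<dots> = (\<integral>\<^sup>+p. h grp_one p * ennreal (wt s p) * ennreal (wt s q) \<partial>haar)"
    by (intro nn_integral_cong) (simp add: inv q wt_mult ennreal_mult' wt_pos less_imp_le mult_ac)
  also have "\<dots> = (\<integral>\<^sup>+p. h grp_one p * ennreal (wt s p) \<partial>haar) * ennreal (wt s q)"
    by (intro nn_integral_multc borel_measurable_haar) measurable
  finally show ?thesis .
qed

text \<open>The substitution \<open>r -> g r\<close> leaves Haar measure and a constant weight
  unchanged, which is why the majorant is taken at the symbol 1.\<close>

lemma loc_kernel_left_invariant:
  fixes \<phi> :: "real ^ 'd \<Rightarrow> complex"
  assumes \<phi>: "\<phi> \<in> L2" and g: "g \<in> grp" "p \<in> grp"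
  shows "loc_kernel \<phi> (\<lambda>_. 1) g (grp_mult g p) = loc_kernel \<phi> (\<lambda>_. 1) grp_one p"
proof -
  let ?F = "\<lambda>r :: real \<times> (real ^ 'd). ennreal (kernel \<phi> r g) * ennreal (kernel \<phi> r (grp_mult g p))"
  note [measurable] = kernel_measurable[OF \<phi>]
  have "loc_kernel \<phi> (\<lambda>_. 1) g (grp_mult g p) = (\<integral>\<^sup>+r. ?F r \<partial>haar)" by (simp add: loc_kernel_def)
  also have "\<dots> = (\<integral>\<^sup>+r. ?F (grp_mult g r) \<partial>haar)"
    by (rule nn_integral_haar_left_invariant[OF _ g(1), symmetric]) measurable
  also have "\<dots> = loc_kernel \<phi> (\<lambda>_. 1) grp_one p"
    unfolding loc_kernel_def
  proof (intro nn_integral_cong)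
    fix r :: "real \<times> (real ^ 'd)" assume "r \<in> space haar"
    then have r: "r \<in> grp" by simp
    have "kernel \<phi> (grp_mult g r) g = kernel \<phi> r grp_one"
      using kernel_left_invariant[OF \<phi> g(1) r grp_one_grp] by (simp add: grp_mult_one)
    then show "?F (grp_mult g r) = ennreal 1 * (ennreal (kernel \<phi> r grp_one) * ennreal (kernel \<phi> r p))"
      by (simp add: kernel_left_invariant[OF \<phi> g(1) r g(2)])
  qed
  finally show ?thesis .
qed

text \<open>The majorant is the composition of the kernel with itself. Since the weight is
  multiplicative, the row integral of the inner kernel at \<open>p\<close> is
  \<open>I * wt s p\<close>, and integrating it against the outer kernel gives \<open>I\<close> once
  more.\<close>

lemma nn_integral_loc_kernel_wt:
  fixes \<phi> :: "real ^ 'd \<Rightarrow> complex" and s :: real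
  assumes \<phi>: "\<phi> \<in> L2"
  defines "I \<equiv> (\<integral>\<^sup>+p. ennreal (kernel \<phi> grp_one p) * ennreal (wt s p) \<partial>haar)"
  shows "(\<integral>\<^sup>+q. loc_kernel \<phi> (\<lambda>_. 1) grp_one q * ennreal (wt s q) \<partial>haar) = I * I"
proof -
  let ?H = "haar :: (real \<times> (real ^ 'd)) measure"
  have [measurable]: "(\<lambda>p. kernel \<phi> p q) \<in> borel_measurable ?H" "(\<lambda>q. kernel \<phi> p q) \<in> borel_measurable ?H" for p q
    by (intro kernel_measurable_pair[OF \<phi>] haar_id_measurable measurable_const; simp)+
  have [measurable]: "(\<lambda>z. kernel \<phi> (fst z) (snd z)) \<in> borel_measurable (?H \<Otimes>\<^sub>M ?H)"
    "(\<lambda>z. kernel \<phi> (snd z) (fst z)) \<in> borel_measurable (?H \<Otimes>\<^sub>M ?H)"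
    "(\<lambda>z. kernel \<phi> (fst z) q) \<in> borel_measurable (?H \<Otimes>\<^sub>M ?H)"
    "(\<lambda>z. kernel \<phi> (snd z) q) \<in> borel_measurable (?H \<Otimes>\<^sub>M ?H)" for q
    by (intro kernel_measurable_pair[OF \<phi>] haar_fst_measurable haar_snd_measurable measurable_const; simp)+
  have wm[measurable]: "wt s \<in> borel_measurable ?H" by (rule borel_measurable_haar) measurable
  have "(\<integral>\<^sup>+q. loc_kernel \<phi> (\<lambda>_. 1) grp_one q * ennreal (wt s q) \<partial>?H) =
      (\<integral>\<^sup>+q. \<integral>\<^sup>+p. ennreal (kernel \<phi> p grp_one) * ennreal (kernel \<phi> p q) * ennreal (wt s q) \<partial>?H \<partial>?H)"
    unfolding loc_kernel_def by (intro nn_integral_cong) (subst nn_integral_multc[symmetric], auto)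
  also have "\<dots> = (\<integral>\<^sup>+p. \<integral>\<^sup>+q. ennreal (kernel \<phi> p grp_one) * ennreal (kernel \<phi> p q) * ennreal (wt s q) \<partial>?H \<partial>?H)"
    by (rule haar_pair.Fubini') (simp only: case_prod_beta', measurable)
  also have "\<dots> = (\<integral>\<^sup>+p. ennreal (kernel \<phi> p grp_one) * (I * ennreal (wt s p)) \<partial>?H)"
  proof (intro nn_integral_cong)
    fix p assume "p \<in> space ?H"
    then have p: "p \<in> grp" by simp
    have "(\<integral>\<^sup>+q. ennreal (kernel \<phi> p q) * ennreal (wt s q) \<partial>?H) = I * ennreal (wt s p)"
      unfolding I_def
    proof (rule Schur_left_invariant[OF _ _ p])
      show "(\<lambda>q. ennreal (kernel \<phi> p q)) \<in> borel_measurable borel" for p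
        using kernel_measurable[OF \<phi>, of p] by (simp add: kernel_commute[of \<phi> p])
      show "ennreal (kernel \<phi> g (grp_mult g q)) = ennreal (kernel \<phi> grp_one q)" if "g \<in> grp" "q \<in> grp" for g q
        using kernel_left_invariant[OF \<phi> that(1) grp_one_grp that(2)] by (simp add: grp_mult_one)
    qed
    moreover have "(\<integral>\<^sup>+q. ennreal (kernel \<phi> p grp_one) * (ennreal (kernel \<phi> p q) * ennreal (wt s q)) \<partial>?H) =
        ennreal (kernel \<phi> p grp_one) * (\<integral>\<^sup>+q. ennreal (kernel \<phi> p q) * ennreal (wt s q) \<partial>?H)"
      by (rule nn_integral_cmult) measurable
    ultimately show "(\<integral>\<^sup>+q. ennreal (kernel \<phi> p grp_one) * ennreal (kernel \<phi> p q) * ennreal (wt s q) \<partial>?H) =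
        ennreal (kernel \<phi> p grp_one) * (I * ennreal (wt s p))"
      by (simp only: mult.assoc)
  qed
  also have "\<dots> = (\<integral>\<^sup>+p. I * (ennreal (kernel \<phi> grp_one p) * ennreal (wt s p)) \<partial>?H)"
    by (intro nn_integral_cong) (simp only: kernel_commute[of \<phi> _ grp_one] mult_ac)
  also have "\<dots> = I * I"
    unfolding I_def by (rule nn_integral_cmult) measurable
  finally show ?thesis .
qed

lemma A1_admissible: "\<phi> \<in> A1 \<Longrightarrow> \<phi> \<in> admissible"
  by (simp add: A1_def)

text \<open>At the identity the kernel is the modulus of
  \<open>wavelet_transform \<phi> \<phi>\<close>, so the condition in \<open>B1\<close> is
  finiteness of one weighted row integral, with \<open>s = d / 2 + \<epsilon>\<close>. Left
  invariance carries it to all rows.\<close>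

lemma A1_weight:
  fixes \<phi> :: "real ^ 'd \<Rightarrow> complex"
  assumes "\<phi> \<in> A1"
  obtains s where "(\<integral>\<^sup>+p. ennreal (kernel \<phi> grp_one p) * ennreal (wt s p) \<partial>haar) < \<infinity>"
proof -
  have \<phi>: "\<phi> \<in> L2" by (intro admissible_L2 A1_admissible assms)
  obtain \<epsilon> where "\<phi> \<in> B1 (weight \<epsilon>)" using assms by (auto simp: A1_def)
  then have "integrable (density haar (\<lambda>p. ennreal (weight \<epsilon> p))) (wavelet_transform \<phi> \<phi>)"
    by (simp add: B1_def)
  then have fin: "(\<integral>\<^sup>+p. ennreal (cmod (wavelet_transform \<phi> \<phi> p)) \<partial>density haar (\<lambda>p. ennreal (weight \<epsilon> p))) < \<infinity>"
    by (simp add: integrable_iff_bounded)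
  let ?s = "real CARD('d) / 2 + \<epsilon>"
  have w: "(\<lambda>p :: real \<times> (real ^ 'd). ennreal (weight \<epsilon> p)) = (\<lambda>p. ennreal (wt ?s p))"
    by (auto simp: weight_def wt_def fun_eq_iff)
  have one: "wavelet \<phi> grp_one = \<phi>" by (simp add: grp_one_def fun_eq_iff)
  have "(\<integral>\<^sup>+p. ennreal (cmod (wavelet_transform \<phi> \<phi> p)) \<partial>density haar (\<lambda>p. ennreal (weight \<epsilon> p))) =
      (\<integral>\<^sup>+p. ennreal (wt ?s p) * ennreal (cmod (wavelet_transform \<phi> \<phi> p)) \<partial>haar)"
    unfolding w
  proof (rule nn_integral_density)
    note [measurable] = wavelet_transform_measurable[OF \<phi> \<phi>]
    show "(\<lambda>p :: real \<times> (real ^ 'd). ennreal (wt ?s p)) \<in> borel_measurable haar"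
      by (rule borel_measurable_haar) measurable
    show "(\<lambda>p. ennreal (cmod (wavelet_transform \<phi> \<phi> p))) \<in> borel_measurable haar"
      by (rule borel_measurable_haar) measurable
  qed
  also have "\<dots> = (\<integral>\<^sup>+p. ennreal (kernel \<phi> grp_one p) * ennreal (wt ?s p) \<partial>haar)"
    unfolding kernel_wavelet_transform one by (simp only: mult.commute)
  finally show ?thesis using fin by (intro that[of ?s]) simp
qed

text \<open>The decisive estimate: off a set \<open>K\<close> outside which the Berezin transform is small, the matrix
  entries are both small and dominated by a fixed Schur-bounded kernel.\<close>

theorem thin_energy_estimate:
  fixes \<phi> :: "real ^ 'd \<Rightarrow> complex"
  assumes A1: "\<phi> \<in> A1" and \<eta>: "\<eta> > 0"
  obtains \<delta> :: real where "\<delta> > 0" and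
    "\<And>\<sigma> K f. \<sigma> \<in> borel_measurable borel \<Longrightarrow> (\<And>p. 0 \<le> \<sigma> p \<and> \<sigma> p \<le> 1) \<Longrightarrow> K \<in> sets borel \<Longrightarrow>
      (\<And>q. q \<in> grp \<Longrightarrow> q \<notin> K \<Longrightarrow> berezin \<phi> \<sigma> q \<le> ennreal \<delta>) \<Longrightarrow> f \<in> L2 \<Longrightarrow>
      (\<integral>\<^sup>+p. ennreal (\<sigma> p * (cmod (wavelet_transform \<phi> f p))\<^sup>2) \<partial>haar) \<le>
        ennreal ((L2_norm \<phi>)\<^sup>2) * (\<integral>\<^sup>+p. indicator K p * ennreal (cmod (wavelet_transform \<phi> f p)) \<partial>haar)\<^sup>2 +
        ennreal \<eta> * esq lborel f"
proof -
  have adm: "\<phi> \<in> admissible" by (rule A1_admissible[OF A1])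
  have \<phi>: "\<phi> \<in> L2" by (rule admissible_L2[OF adm])
  let ?H = "haar :: (real \<times> (real ^ 'd)) measure"
  let ?h = "loc_kernel \<phi> (\<lambda>_. 1)"
  let ?N = "L2_norm \<phi>"
  obtain s where s: "(\<integral>\<^sup>+p. ennreal (kernel \<phi> grp_one p) * ennreal (wt s p) \<partial>?H) < \<infinity>"
    by (rule A1_weight[OF A1])
  have hm: "?h q \<in> borel_measurable borel" for q
    by (rule loc_kernel_measurable[OF \<phi>]) auto
  have wm: "wt s \<in> borel_measurable ?H" by (rule borel_measurable_haar[OF wt_measurable])
  note [measurable] = borel_measurable_haar[OF hm] wm
  \<comment> \<open>Schur constant of the majorant truncated at height \<open>\<tau>\<close>.
    Truncation respects left invariance, so the same weight works, and the constant tends to 0 with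
    \<open>\<tau>\<close> by dominated convergence.\<close>
  define S where "S \<tau> = (\<integral>\<^sup>+p. min (ennreal \<tau>) (?h grp_one p) * ennreal (wt s p) \<partial>?H)" for \<tau>
  have fin: "(\<integral>\<^sup>+p. ?h grp_one p * ennreal (wt s p) \<partial>?H) < \<infinity>"
    using s by (simp add: nn_integral_loc_kernel_wt[OF \<phi>] ennreal_mult_less_top)
  have Slim: "(\<lambda>n. S (inverse (real (Suc n)))) \<longlonglongrightarrow> 0"
  proof -
    have "(\<lambda>n. S (inverse (real (Suc n)))) \<longlonglongrightarrow> (\<integral>\<^sup>+p. 0 \<partial>?H)"
      unfolding S_def
    proof (rule nn_integral_dominated_convergence[where w = "\<lambda>p. ?h grp_one p * ennreal (wt s p)"])
      show "AE p in ?H. (\<lambda>n. min (ennreal (inverse (real (Suc n)))) (?h grp_one p) * ennreal (wt s p)) \<longlonglongrightarrow> 0"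
      proof (rule AE_I2)
        fix p :: "real \<times> (real ^ 'd)"
        have "(\<lambda>n. ennreal (inverse (real (Suc n)) * wt s p)) \<longlonglongrightarrow> ennreal (0 * wt s p)"
          by (intro tendsto_ennrealI tendsto_mult tendsto_const LIMSEQ_inverse_real_of_nat)
        then have lim: "(\<lambda>n. ennreal (inverse (real (Suc n))) * ennreal (wt s p)) \<longlonglongrightarrow> 0"
          by (simp only: ennreal_mult'[symmetric] wt_def powr_ge_zero ennreal_mult[symmetric] inverse_nonnegative_iff_nonnegative of_nat_0_le_iff mult_zero_left ennreal_0)
        show "(\<lambda>n. min (ennreal (inverse (real (Suc n)))) (?h grp_one p) * ennreal (wt s p)) \<longlonglongrightarrow> 0"
          by (rule tendsto_sandwich[OF always_eventually always_eventually tendsto_const lim]) (auto intro: mult_right_mono)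
      qed
    qed (use fin in \<open>auto intro!: mult_right_mono AE_I2\<close>)
    then show ?thesis by simp
  qed
  obtain n where n: "S (inverse (real (Suc n))) < ennreal \<eta>"
    using order_tendstoD(2)[OF Slim, of "ennreal \<eta>"] \<eta> by (auto simp: eventually_sequentially)
  define \<tau> where "\<tau> = inverse (real (Suc n))"
  have \<tau>: "\<tau> > 0" by (simp add: \<tau>_def)
  \<comment> \<open>Chosen so that \<open>?N^2 * \<delta> \<le> \<tau>^2\<close>: the geometric mean
    of a Berezin value below \<open>\<delta>\<close> and one below \<open>?N^2\<close> is then at
    most \<open>\<tau>\<close>. The summand 1 covers a window of norm 0.\<close>
  define \<delta> where "\<delta> = \<tau>\<^sup>2 / (?N\<^sup>2 + 1)"
  have \<delta>: "\<delta> > 0" unfolding \<delta>_def using \<tau> by (intro divide_pos_pos) (auto intro: add_nonneg_pos)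
  have \<delta>\<tau>: "?N\<^sup>2 * \<delta> \<le> \<tau>\<^sup>2"
  proof -
    have "?N\<^sup>2 * \<delta> = (?N\<^sup>2 / (?N\<^sup>2 + 1)) * \<tau>\<^sup>2" by (simp add: \<delta>_def)
    also have "\<dots> \<le> 1 * \<tau>\<^sup>2" by (intro mult_right_mono) (auto simp: divide_le_eq_1 add_nonneg_pos)
    finally show ?thesis by simp
  qed
  show ?thesis
  proof (rule that[OF \<delta>])
    fix \<sigma> :: "real \<times> (real ^ 'd) \<Rightarrow> real" and K and f :: "real ^ 'd \<Rightarrow> complex"
    assume \<sigma>: "\<sigma> \<in> borel_measurable borel" "\<And>p. 0 \<le> \<sigma> p \<and> \<sigma> p \<le> 1" and K: "K \<in> sets borel"
      and small: "\<And>q. q \<in> grp \<Longrightarrow> q \<notin> K \<Longrightarrow> berezin \<phi> \<sigma> q \<le> ennreal \<delta>" and f: "f \<in> L2"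
    define u where "u p = cmod (wavelet_transform \<phi> f p)" for p
    let ?m = "\<lambda>q q'. min (ennreal \<tau>) (?h q q')"
    have um: "u \<in> borel_measurable ?H"
    proof -
      note [measurable] = wavelet_transform_measurable[OF \<phi> f]
      show ?thesis unfolding u_def by (rule borel_measurable_haar) measurable
    qed
    have Km: "indicator K \<in> borel_measurable ?H"
      by (intro borel_measurable_haar borel_measurable_indicator K)
    note [measurable] = um Km
    have [measurable]: "(\<lambda>z. loc_kernel \<phi> (\<lambda>_. 1) (fst z) (snd z)) \<in> borel_measurable (?H \<Otimes>\<^sub>M ?H)"
      by (intro loc_kernel_measurable[OF \<phi>] haar_fst_measurable haar_snd_measurable) auto
    have le1: "loc_kernel \<phi> \<sigma> q q' \<le> ?h q q'" for q q'
      unfolding loc_kernel_def by (intro nn_integral_mono mult_right_mono ennreal_leI) (auto simp: \<sigma>)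
    \<comment> \<open>Only entries with both indices in \<open>K\<close> lack a small Berezin value;
      they get the crude constant, which factors and integrates to the square of an L1 integral over
      \<open>K\<close>. All other entries are at most \<open>\<tau>\<close> and also below the
      majorant, hence below its truncation.\<close>
    have bound: "loc_kernel \<phi> \<sigma> q q' \<le> ennreal (?N\<^sup>2) * (indicator K q * indicator K q') + ?m q q'"
      if q: "q \<in> grp" "q' \<in> grp" for q q'
    proof (cases "q \<in> K \<and> q' \<in> K")
      case True
      have "(loc_kernel \<phi> \<sigma> q q')\<^sup>2 \<le> berezin \<phi> \<sigma> q * berezin \<phi> \<sigma> q'"
        by (rule loc_kernel_sq_le) (use \<phi> \<sigma> in auto)
      also have "\<dots> \<le> ennreal (?N\<^sup>2) * ennreal (?N\<^sup>2)"
        by (intro mult_mono berezin_le adm q) (use \<sigma> in auto)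
      also have "\<dots> = (ennreal (?N\<^sup>2))\<^sup>2" by (simp only: power2_eq_square)
      finally have "loc_kernel \<phi> \<sigma> q q' \<le> ennreal (?N\<^sup>2)" by (rule ennreal_power2_le_imp_le)
      then show ?thesis using True by (simp add: add_increasing2)
    next
      case False
      have "(loc_kernel \<phi> \<sigma> q q')\<^sup>2 \<le> berezin \<phi> \<sigma> q * berezin \<phi> \<sigma> q'"
        by (rule loc_kernel_sq_le) (use \<phi> \<sigma> in auto)
      also have "\<dots> \<le> ennreal (?N\<^sup>2) * ennreal \<delta>"
      proof (cases "q \<in> K")
        case True
        with False have "q' \<notin> K" by simp
        then show ?thesis by (intro mult_mono berezin_le adm small q) (use \<sigma> in auto)
      next
        case False
        have "berezin \<phi> \<sigma> q' * berezin \<phi> \<sigma> q \<le> ennreal (?N\<^sup>2) * ennreal \<delta>"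
          using False by (intro mult_mono berezin_le adm small q) (use \<sigma> in auto)
        then show ?thesis by (simp only: mult.commute)
      qed
      also have "\<dots> = ennreal (?N\<^sup>2 * \<delta>)" using \<delta> by (simp add: ennreal_mult)
      also have "\<dots> \<le> ennreal (\<tau>\<^sup>2)" by (rule ennreal_leI[OF \<delta>\<tau>])
      also have "\<dots> = (ennreal \<tau>)\<^sup>2" using \<tau> by (simp add: ennreal_power)
      finally have "loc_kernel \<phi> \<sigma> q q' \<le> ennreal \<tau>" by (rule ennreal_power2_le_imp_le)
      then have "loc_kernel \<phi> \<sigma> q q' \<le> ?m q q'" using le1 by simp
      then show ?thesis by (simp add: add_increasing)
    qed
    have "(\<integral>\<^sup>+p. ennreal (\<sigma> p * (cmod (wavelet_transform \<phi> f p))\<^sup>2) \<partial>?H) \<le>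
        (\<integral>\<^sup>+q. \<integral>\<^sup>+q'. ennreal (u q) * ennreal (u q') * loc_kernel \<phi> \<sigma> q q' \<partial>?H \<partial>?H)"
      unfolding u_def by (rule energy_le_loc_kernel) (use adm f \<sigma> in auto)
    also have "\<dots> \<le> (\<integral>\<^sup>+q. \<integral>\<^sup>+q'. ennreal (?N\<^sup>2) * (indicator K q * ennreal (u q)) * (indicator K q' * ennreal (u q')) +
        ennreal (u q) * ennreal (u q') * ?m q q' \<partial>?H \<partial>?H)"
    proof (intro nn_integral_mono)
      fix q q' assume "q \<in> space ?H" "q' \<in> space ?H"
      then have "ennreal (u q) * ennreal (u q') * loc_kernel \<phi> \<sigma> q q' \<le>
          ennreal (u q) * ennreal (u q') * (ennreal (?N\<^sup>2) * (indicator K q * indicator K q') + ?m q q')"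
        by (intro mult_left_mono bound) auto
      then show "ennreal (u q) * ennreal (u q') * loc_kernel \<phi> \<sigma> q q' \<le>
          ennreal (?N\<^sup>2) * (indicator K q * ennreal (u q)) * (indicator K q' * ennreal (u q')) + ennreal (u q) * ennreal (u q') * ?m q q'"
        by (simp only: distrib_left mult_ac)
    qed
    also have "\<dots> = (\<integral>\<^sup>+q. \<integral>\<^sup>+q'. ennreal (?N\<^sup>2) * (indicator K q * ennreal (u q)) * (indicator K q' * ennreal (u q')) \<partial>?H \<partial>?H) +
        (\<integral>\<^sup>+q. \<integral>\<^sup>+q'. ennreal (u q) * ennreal (u q') * ?m q q' \<partial>?H \<partial>?H)"
      by (subst nn_integral_add[symmetric], measurable) (intro nn_integral_cong nn_integral_add, measurable)
    also have "(\<integral>\<^sup>+q. \<integral>\<^sup>+q'. ennreal (?N\<^sup>2) * (indicator K q * ennreal (u q)) * (indicator K q' * ennreal (u q')) \<partial>?H \<partial>?H) =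
        ennreal (?N\<^sup>2) * (\<integral>\<^sup>+p. indicator K p * ennreal (u p) \<partial>?H)\<^sup>2"
    proof -
      have "(\<integral>\<^sup>+q. \<integral>\<^sup>+q'. ennreal (?N\<^sup>2) * (indicator K q * ennreal (u q)) * (indicator K q' * ennreal (u q')) \<partial>?H \<partial>?H) =
          (\<integral>\<^sup>+q. ennreal (?N\<^sup>2) * (indicator K q * ennreal (u q)) * (\<integral>\<^sup>+q'. indicator K q' * ennreal (u q') \<partial>?H) \<partial>?H)"
        by (intro nn_integral_cong nn_integral_cmult) measurable
      also have "\<dots> = (\<integral>\<^sup>+q. ennreal (?N\<^sup>2) * (indicator K q * ennreal (u q)) \<partial>?H) * (\<integral>\<^sup>+q'. indicator K q' * ennreal (u q') \<partial>?H)"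
        by (rule nn_integral_multc) measurable
      also have "(\<integral>\<^sup>+q. ennreal (?N\<^sup>2) * (indicator K q * ennreal (u q)) \<partial>?H) = ennreal (?N\<^sup>2) * (\<integral>\<^sup>+q. indicator K q * ennreal (u q) \<partial>?H)"
        by (rule nn_integral_cmult) measurable
      finally show ?thesis by (simp only: power2_eq_square[of "nn_integral _ _"] mult.assoc)
    qed
    also have "(\<integral>\<^sup>+q. \<integral>\<^sup>+q'. ennreal (u q) * ennreal (u q') * ?m q q' \<partial>?H \<partial>?H) \<le> S \<tau> * (\<integral>\<^sup>+q. ennreal ((u q)\<^sup>2) \<partial>?H)"
    proof (rule haar.Schur_test)
      show "case_prod ?m \<in> borel_measurable (?H \<Otimes>\<^sub>M ?H)" by (simp only: case_prod_beta') measurable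
      show "u \<in> borel_measurable ?H" by fact
      show "u p \<ge> 0" for p by (simp add: u_def)
      show "wt s \<in> borel_measurable ?H" by fact
      show "p \<in> space ?H \<Longrightarrow> wt s p > 0" for p by (simp add: wt_pos)
      show "?m q q' = ?m q' q" for q q' by (simp only: loc_kernel_commute[of \<phi> _ q])
      fix q assume "q \<in> space ?H"
      then have q: "q \<in> grp" by simp
      have "(\<integral>\<^sup>+p. ?m q p * ennreal (wt s p) \<partial>?H) = S \<tau> * ennreal (wt s q)"
        unfolding S_def
      proof (rule Schur_left_invariant[OF _ _ q])
        show "(\<lambda>p. ?m q p) \<in> borel_measurable borel" for q using hm[of q] by measurable
        show "?m g (grp_mult g p) = ?m grp_one p" if "g \<in> grp" "p \<in> grp" for g p
          by (simp only: loc_kernel_left_invariant[OF \<phi> that])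
      qed
      then show "(\<integral>\<^sup>+p. ?m q p * ennreal (wt s p) \<partial>?H) \<le> S \<tau> * ennreal (wt s q)" by simp
    qed
    also have "(\<integral>\<^sup>+q. ennreal ((u q)\<^sup>2) \<partial>?H) = esq lborel f"
      using wavelet_isometry[OF adm f] by (simp add: esq_def u_def)
    also have "S \<tau> * esq lborel f \<le> ennreal \<eta> * esq lborel f"
      using n by (intro mult_right_mono) (auto simp: \<tau>_def)
    finally show "(\<integral>\<^sup>+p. ennreal (\<sigma> p * (cmod (wavelet_transform \<phi> f p))\<^sup>2) \<partial>haar) \<le>
        ennreal (?N\<^sup>2) * (\<integral>\<^sup>+p. indicator K p * ennreal (cmod (wavelet_transform \<phi> f p)) \<partial>haar)\<^sup>2 +
        ennreal \<eta> * esq lborel f"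
      by (simp add: u_def add_left_mono)
  qed
qed

section \<open>Compactness\<close>

text \<open>The quadratic form of the localization operator with symbol \<open>\<rho>\<close>, kept
  in \<open>ennreal\<close> so that it makes sense before integrability is known.\<close>

definition energy :: "(real ^ 'd \<Rightarrow> complex) \<Rightarrow> (real \<times> (real ^ 'd) \<Rightarrow> real) \<Rightarrow> (real ^ 'd \<Rightarrow> complex) \<Rightarrow> ennreal" where
  "energy \<phi> \<rho> f = (\<integral>\<^sup>+p. ennreal (\<rho> p * (cmod (wavelet_transform \<phi> f p))\<^sup>2) \<partial>haar)"

lemma energy_mono: "(\<And>p. p \<in> grp \<Longrightarrow> \<rho> p \<le> \<rho>' p) \<Longrightarrow> energy \<phi> \<rho> f \<le> energy \<phi> \<rho>' f"
  unfolding energy_def by (intro nn_integral_mono ennreal_leI mult_right_mono) auto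

lemma energy_integrand_measurable:
  fixes \<phi> f :: "real ^ 'd \<Rightarrow> complex"
  assumes "\<phi> \<in> L2" "f \<in> L2" and [measurable]: "\<rho> \<in> borel_measurable borel"
  shows "(\<lambda>p. ennreal (\<rho> p * (cmod (wavelet_transform \<phi> f p))\<^sup>2)) \<in> borel_measurable haar"
proof -
  note [measurable] = wavelet_transform_measurable[OF assms(1,2)]
  show ?thesis by (rule borel_measurable_haar) measurable
qed

lemma energy_add:
  fixes \<phi> f :: "real ^ 'd \<Rightarrow> complex"
  assumes "\<phi> \<in> L2" "f \<in> L2" "\<rho> \<in> borel_measurable borel" "\<rho>' \<in> borel_measurable borel"
    and "\<And>p. p \<in> grp \<Longrightarrow> \<rho> p \<ge> 0" "\<And>p. p \<in> grp \<Longrightarrow> \<rho>' p \<ge> 0"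
  shows "energy \<phi> (\<lambda>p. \<rho> p + \<rho>' p) f = energy \<phi> \<rho> f + energy \<phi> \<rho>' f"
proof -
  have "energy \<phi> (\<lambda>p. \<rho> p + \<rho>' p) f =
      (\<integral>\<^sup>+p. ennreal (\<rho> p * (cmod (wavelet_transform \<phi> f p))\<^sup>2) + ennreal (\<rho>' p * (cmod (wavelet_transform \<phi> f p))\<^sup>2) \<partial>haar)"
    unfolding energy_def by (intro nn_integral_cong) (simp add: assms(5,6) distrib_right)
  also have "\<dots> = energy \<phi> \<rho> f + energy \<phi> \<rho>' f"
    unfolding energy_def by (intro nn_integral_add energy_integrand_measurable assms)
  finally show ?thesis .
qed

lemma energy_one:
  fixes \<phi> f :: "real ^ 'd \<Rightarrow> complex"
  assumes "\<phi> \<in> admissible" "f \<in> L2"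
  shows "energy \<phi> (\<lambda>_. 1) f = esq lborel f"
  using wavelet_isometry[OF assms] by (simp add: energy_def esq_def)

lemma energy_le_esq:
  fixes \<phi> f :: "real ^ 'd \<Rightarrow> complex"
  assumes "\<phi> \<in> admissible" "f \<in> L2" "\<And>p. p \<in> grp \<Longrightarrow> \<rho> p \<le> 1"
  shows "energy \<phi> \<rho> f \<le> esq lborel f"
  using energy_mono[of \<rho> "\<lambda>_. 1" \<phi> f] assms by (simp add: energy_one)

lemma energy_complement:
  fixes \<phi> f :: "real ^ 'd \<Rightarrow> complex"
  assumes adm: "\<phi> \<in> admissible" and f: "f \<in> L2" and \<rho>: "\<rho> \<in> borel_measurable borel" "\<And>p. p \<in> grp \<Longrightarrow> 0 \<le> \<rho> p \<and> \<rho> p \<le> 1"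
  shows "esq lborel f = energy \<phi> \<rho> f + energy \<phi> (\<lambda>p. 1 - \<rho> p) f"
proof -
  have "energy \<phi> (\<lambda>p. \<rho> p + (1 - \<rho> p)) f = energy \<phi> \<rho> f + energy \<phi> (\<lambda>p. 1 - \<rho> p) f"
    using \<rho> by (intro energy_add admissible_L2[OF adm] f) auto
  then show ?thesis by (simp add: energy_one[OF adm f])
qed

text \<open>Two different weights are allowed on the right because \<open>f\<close> and
  \<open>g\<close> may have small energy for different symbols:
  \<open>1 - max \<sigma> \<sigma>'\<close> lies below both \<open>1 - \<sigma>\<close> and
  \<open>1 - \<sigma>'\<close>.\<close>

lemma energy_diff_le:
  fixes \<phi> f g :: "real ^ 'd \<Rightarrow> complex"
  assumes \<phi>: "\<phi> \<in> L2" and f: "f \<in> L2" and g: "g \<in> L2"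
    and \<rho>: "\<rho> \<in> borel_measurable borel" "\<rho>' \<in> borel_measurable borel"
    and le: "\<And>p. p \<in> grp \<Longrightarrow> 0 \<le> \<rho>'' p \<and> \<rho>'' p \<le> \<rho> p \<and> \<rho>'' p \<le> \<rho>' p"
  shows "energy \<phi> \<rho>'' (\<lambda>x. f x - g x) \<le> 2 * energy \<phi> \<rho> f + 2 * energy \<phi> \<rho>' g"
proof -
  let ?W = "wavelet_transform \<phi>"
  note [measurable] = energy_integrand_measurable[OF \<phi> f \<rho>(1)] energy_integrand_measurable[OF \<phi> g \<rho>(2)]
  have "energy \<phi> \<rho>'' (\<lambda>x. f x - g x) \<le>
      (\<integral>\<^sup>+p. 2 * ennreal (\<rho> p * (cmod (?W f p))\<^sup>2) + 2 * ennreal (\<rho>' p * (cmod (?W g p))\<^sup>2) \<partial>haar)"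
    unfolding energy_def
  proof (intro nn_integral_mono)
    fix p :: "real \<times> (real ^ 'd)" assume "p \<in> space haar"
    then have p: "p \<in> grp" by simp
    have "\<rho>'' p * (cmod (?W (\<lambda>x. f x - g x) p))\<^sup>2 = \<rho>'' p * (cmod (?W f p + - ?W g p))\<^sup>2"
      using p by (simp add: wavelet_transform_diff \<phi> f g grp_iff)
    also have "\<dots> \<le> \<rho>'' p * (2 * (cmod (?W f p))\<^sup>2 + 2 * (cmod (?W g p))\<^sup>2)"
      using cmod_add_sq_le[of 1 "?W f p" "- ?W g p"] le[OF p] by (intro mult_left_mono) auto
    also have "\<dots> = 2 * (\<rho>'' p * (cmod (?W f p))\<^sup>2) + 2 * (\<rho>'' p * (cmod (?W g p))\<^sup>2)"
      by (simp add: distrib_left)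
    also have "\<dots> \<le> 2 * (\<rho> p * (cmod (?W f p))\<^sup>2) + 2 * (\<rho>' p * (cmod (?W g p))\<^sup>2)"
      using le[OF p] by (intro add_mono mult_left_mono mult_right_mono) auto
    finally have "ennreal (\<rho>'' p * (cmod (?W (\<lambda>x. f x - g x) p))\<^sup>2) \<le> ennreal (2 * (\<rho> p * (cmod (?W f p))\<^sup>2) + 2 * (\<rho>' p * (cmod (?W g p))\<^sup>2))"
      by (rule ennreal_leI)
    also have "\<dots> = 2 * ennreal (\<rho> p * (cmod (?W f p))\<^sup>2) + 2 * ennreal (\<rho>' p * (cmod (?W g p))\<^sup>2)"
    proof -
      have "0 \<le> \<rho> p" "0 \<le> \<rho>' p" using le[OF p] by auto
      then show ?thesis by (simp add: ennreal_mult)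
    qed
    finally show "ennreal (\<rho>'' p * (cmod (?W (\<lambda>x. f x - g x) p))\<^sup>2) \<le> 2 * ennreal (\<rho> p * (cmod (?W f p))\<^sup>2) + 2 * ennreal (\<rho>' p * (cmod (?W g p))\<^sup>2)" .
  qed
  also have "\<dots> = 2 * energy \<phi> \<rho> f + 2 * energy \<phi> \<rho>' g"
    unfolding energy_def by (subst nn_integral_add) (simp_all add: nn_integral_cmult)
  finally show ?thesis .
qed

lemma energy_cmult:
  fixes \<phi> f :: "real ^ 'd \<Rightarrow> complex"
  assumes \<phi>: "\<phi> \<in> L2" and f: "f \<in> L2" and \<rho>: "\<rho> \<in> borel_measurable borel"
  shows "energy \<phi> \<rho> (\<lambda>x. c * f x) = ennreal ((cmod c)\<^sup>2) * energy \<phi> \<rho> f"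
proof -
  have "energy \<phi> \<rho> (\<lambda>x. c * f x) = (\<integral>\<^sup>+p. ennreal ((cmod c)\<^sup>2) * ennreal (\<rho> p * (cmod (wavelet_transform \<phi> f p))\<^sup>2) \<partial>haar)"
    unfolding energy_def wavelet_transform_cmult norm_mult power_mult_distrib
    by (intro nn_integral_cong) (simp add: mult.left_commute flip: ennreal_mult')
  also have "\<dots> = ennreal ((cmod c)\<^sup>2) * energy \<phi> \<rho> f"
    unfolding energy_def by (intro nn_integral_cmult energy_integrand_measurable \<phi> f \<rho>)
  finally show ?thesis .
qed

lemma cmod_wavelet_transform_le:
  "\<phi> \<in> L2 \<Longrightarrow> f \<in> L2 \<Longrightarrow> p \<in> grp \<Longrightarrow> cmod (wavelet_transform \<phi> f p) \<le> L2_norm f * L2_norm \<phi>"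
  unfolding wavelet_transform_def
  using cmod_L2_inner_le[of f "wavelet \<phi> p"] by (simp add: grp_iff wavelet_L2 L2_norm_wavelet)

lemma grp_countable_dense:
  obtains S :: "(real \<times> (real ^ 'd)) set" where "countable S" "S \<subseteq> grp" "grp \<subseteq> closure S"
proof -
  obtain D :: "(real \<times> (real ^ 'd)) set" where D: "countable D" "\<And>X. open X \<Longrightarrow> X \<noteq> {} \<Longrightarrow> \<exists>d\<in>D. d \<in> X"
    using countable_dense_exists by blast
  have op: "open (grp :: (real \<times> (real ^ 'd)) set)" unfolding grp_def by (intro open_Times) auto
  have "closure D = UNIV"
    using D(2)[of "- closure D"] closure_subset[of D] by (auto simp: open_Compl)
  then have "grp \<subseteq> closure (grp \<inter> D)" using open_Int_closure_subset[OF op, of D] by simp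
  then show ?thesis using D(1) by (intro that[of "grp \<inter> D"]) auto
qed

text \<open>Bounded values on a countable dense set allow a diagonal extraction. Norm continuity of
  the wavelet in the group element makes the transforms of the unit ball equicontinuous, so
  convergence spreads to the whole group. This takes the place of weak compactness.\<close>

lemma wavelet_transform_convergent_subsequence:
  fixes \<phi> :: "real ^ 'd \<Rightarrow> complex" and f :: "nat \<Rightarrow> real ^ 'd \<Rightarrow> complex"
  assumes \<phi>: "\<phi> \<in> L2" and f: "\<And>n. f n \<in> L2" "\<And>n. L2_norm (f n) \<le> 1"
  obtains k where "strict_mono k" "\<And>p. p \<in> grp \<Longrightarrow> convergent (\<lambda>n. wavelet_transform \<phi> (f (k n)) p)"
proof -
  obtain S :: "(real \<times> (real ^ 'd)) set" where S: "countable S" "S \<subseteq> grp" "grp \<subseteq> closure S"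
    by (rule grp_countable_dense)
  have bd: "cmod (wavelet_transform \<phi> (f n) p) \<le> L2_norm \<phi>" if "p \<in> grp" for n p
    using cmod_wavelet_transform_le[OF \<phi> f(1) that, of n] mult_right_mono[OF f(2)[of n], of "L2_norm \<phi>"] by simp
  obtain k where k: "strict_mono (k::nat \<Rightarrow> nat)"
    "\<And>p. p \<in> S \<Longrightarrow> \<exists>l. (\<lambda>n. wavelet_transform \<phi> (f (k n)) p) \<longlonglongrightarrow> l"
    using function_convergent_subsequence[OF S(1), of "\<lambda>n p. wavelet_transform \<phi> (f n) p" "L2_norm \<phi>"] bd S(2) by blast
  have "convergent (\<lambda>n. wavelet_transform \<phi> (f (k n)) p)" if p: "p \<in> grp" for p
  proof -
    have "p \<in> closure S" using p S(3) by blast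
    then obtain P where P: "\<And>n. P n \<in> S" "P \<longlonglongrightarrow> p" by (auto simp: closure_sequential)
    have pos: "fst (P n) > 0" "fst p > 0" for n using P(1)[of n] S(2) p by (auto simp: grp_iff)
    have "(\<lambda>n. nrm lborel (\<lambda>x. wavelet \<phi> (P n) x - wavelet \<phi> p x)) \<longlonglongrightarrow> 0"
      by (intro nrm_diff_tendsto_0 wavelet_tendsto \<phi> P pos)
    have "Cauchy (\<lambda>n. wavelet_transform \<phi> (f (k n)) p)"
    proof (rule metric_CauchyI)
      fix e :: real assume e: "e > 0"
      have "\<forall>\<^sub>F n in sequentially. nrm lborel (\<lambda>x. wavelet \<phi> (P n) x - wavelet \<phi> p x) < e / 3"
        using e by (intro order_tendstoD(2)[OF nrm_diff_tendsto_0] wavelet_tendsto \<phi> P pos) auto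
      from eventually_happens'[OF sequentially_bot this]
      obtain n0 where n0: "nrm lborel (\<lambda>x. wavelet \<phi> (P n0) x - wavelet \<phi> p x) < e / 3" by blast
      let ?r = "P n0"
      \<comment> \<open>This is uniform in \<open>n\<close>: only the wavelet moves, and the
        \<open>f n\<close> have norm at most 1.\<close>
      have close: "cmod (wavelet_transform \<phi> (f n) ?r - wavelet_transform \<phi> (f n) p) < e / 3" for n
      proof -
        let ?d = "\<lambda>x. wavelet \<phi> ?r x - wavelet \<phi> p x"
        have d: "?d \<in> L2" using pos by (intro L2_diff wavelet_L2 \<phi>)
        have "wavelet_transform \<phi> (f n) ?r - wavelet_transform \<phi> (f n) p = L2_inner (f n) ?d"
          unfolding wavelet_transform_def using pos by (intro L2_inner_diff_right[symmetric] wavelet_L2 \<phi> f)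
        then have "cmod (wavelet_transform \<phi> (f n) ?r - wavelet_transform \<phi> (f n) p) \<le> L2_norm (f n) * L2_norm ?d"
          using cmod_L2_inner_le[OF f(1) d] by simp
        also have "\<dots> \<le> 1 * L2_norm ?d" by (intro mult_right_mono f) simp
        also have "\<dots> < e / 3" using n0 by (simp add: L2_norm_eq_nrm[OF d])
        finally show ?thesis .
      qed
      have Cr: "Cauchy (\<lambda>n. wavelet_transform \<phi> (f (k n)) ?r)"
        using k(2)[OF P(1)] by (auto simp: convergent_def intro!: convergent_Cauchy)
      obtain M where M: "\<And>m n. m \<ge> M \<Longrightarrow> n \<ge> M \<Longrightarrow> dist (wavelet_transform \<phi> (f (k m)) ?r) (wavelet_transform \<phi> (f (k n)) ?r) < e / 3"
        using metric_CauchyD[OF Cr, of "e / 3"] e by auto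
      show "\<exists>M. \<forall>m\<ge>M. \<forall>n\<ge>M. dist (wavelet_transform \<phi> (f (k m)) p) (wavelet_transform \<phi> (f (k n)) p) < e"
      proof (rule exI[of _ M], intro allI impI)
        fix m n assume mn: "M \<le> m" "M \<le> n"
        have 1: "dist (wavelet_transform \<phi> (f (k m)) p) (wavelet_transform \<phi> (f (k m)) ?r) < e / 3"
          unfolding dist_norm by (subst norm_minus_commute) (rule close)
        have 3: "dist (wavelet_transform \<phi> (f (k n)) ?r) (wavelet_transform \<phi> (f (k n)) p) < e / 3"
          unfolding dist_norm by (rule close)
        from 1 M[OF mn] 3 show "dist (wavelet_transform \<phi> (f (k m)) p) (wavelet_transform \<phi> (f (k n)) p) < e"
          by (rule dist_triangle_third)
      qed
    qed
    then show ?thesis by (rule Cauchy_convergent)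
  qed
  with k(1) show ?thesis by (rule that)
qed

lemma berezin_max_le:
  fixes \<phi> :: "real ^ 'd \<Rightarrow> complex"
  assumes \<phi>: "\<phi> \<in> L2" and \<sigma>: "\<sigma> \<in> borel_measurable borel" "\<And>p. \<sigma> p \<ge> 0" "\<sigma>' \<in> borel_measurable borel" "\<And>p. \<sigma>' p \<ge> 0"
  shows "berezin \<phi> (\<lambda>p. max (\<sigma> p) (\<sigma>' p)) q \<le> berezin \<phi> \<sigma> q + berezin \<phi> \<sigma>' q"
proof -
  note [measurable] = borel_measurable_haar[OF \<sigma>(1)] borel_measurable_haar[OF \<sigma>(3)]
    borel_measurable_haar[OF kernel_measurable[OF \<phi>]]
  have "berezin \<phi> (\<lambda>p. max (\<sigma> p) (\<sigma>' p)) q \<le>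
      (\<integral>\<^sup>+p. ennreal (\<sigma> p * (kernel \<phi> p q)\<^sup>2) + ennreal (\<sigma>' p * (kernel \<phi> p q)\<^sup>2) \<partial>haar)"
    unfolding berezin_def
  proof (intro nn_integral_mono)
    fix p
    have "max (\<sigma> p) (\<sigma>' p) * (kernel \<phi> p q)\<^sup>2 \<le> (\<sigma> p + \<sigma>' p) * (kernel \<phi> p q)\<^sup>2"
      using \<sigma>(2)[of p] \<sigma>(4)[of p] by (intro mult_right_mono) auto
    then show "ennreal (max (\<sigma> p) (\<sigma>' p) * (kernel \<phi> p q)\<^sup>2) \<le> ennreal (\<sigma> p * (kernel \<phi> p q)\<^sup>2) + ennreal (\<sigma>' p * (kernel \<phi> p q)\<^sup>2)"
      using \<sigma>(2)[of p] \<sigma>(4)[of p] by (simp add: distrib_right ennreal_leI flip: ennreal_plus)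
  qed
  also have "\<dots> = berezin \<phi> \<sigma> q + berezin \<phi> \<sigma>' q"
    unfolding berezin_def by (rule nn_integral_add) measurable
  finally show ?thesis .
qed

text \<open>Boxes replace the metric, and one box serves all \<open>n\<close>; a constant family
  encodes thinness of a single symbol. Measurability is demanded on the whole product space, so that
  symbols can be composed with group translations.\<close>

definition uniformly_thin :: "(real ^ 'd \<Rightarrow> complex) \<Rightarrow> (nat \<Rightarrow> real \<times> (real ^ 'd) \<Rightarrow> real) \<Rightarrow> bool" where
  "uniformly_thin \<phi> \<sigma> \<longleftrightarrow> (\<forall>n. \<sigma> n \<in> borel_measurable borel) \<and> (\<forall>n p. 0 \<le> \<sigma> n p \<and> \<sigma> n p \<le> 1) \<and>
     (\<forall>\<delta>>0. \<exists>m. \<forall>n. \<forall>q\<in>grp - grp_box m. berezin \<phi> (\<sigma> n) q \<le> ennreal \<delta>)"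

text \<open>The operator \<open>T\<^sub>\<sigma>\<close> is compact, uniformly for uniformly thin \<open>\<sigma>\<close>.\<close>

theorem thin_compactness:
  fixes \<phi> :: "real ^ 'd \<Rightarrow> complex" and f :: "nat \<Rightarrow> real ^ 'd \<Rightarrow> complex"
  assumes A1: "\<phi> \<in> A1" and thin: "uniformly_thin \<phi> \<sigma>"
    and f: "\<And>n. f n \<in> L2" "\<And>n. L2_norm (f n) \<le> 1"
    and lim: "(\<lambda>n. energy \<phi> (\<lambda>p. 1 - \<sigma> n p) (f n)) \<longlonglongrightarrow> 0"
  obtains k g where "strict_mono k" "g \<in> L2" "(\<lambda>n. esq lborel (\<lambda>x. f (k n) x - g x)) \<longlonglongrightarrow> 0"
proof -
  have adm: "\<phi> \<in> admissible" by (rule A1_admissible[OF A1])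
  have \<phi>: "\<phi> \<in> L2" by (rule admissible_L2[OF adm])
  let ?W = "wavelet_transform \<phi>"
  let ?H = "haar :: (real \<times> (real ^ 'd)) measure"
  let ?N = "L2_norm \<phi>"
  have \<sigma>: "\<sigma> n \<in> borel_measurable borel" "0 \<le> \<sigma> n p" "\<sigma> n p \<le> 1" for n p
    using thin unfolding uniformly_thin_def by blast+
  obtain k where k: "strict_mono k" and conv: "\<And>p. p \<in> grp \<Longrightarrow> convergent (\<lambda>n. ?W (f (k n)) p)"
    using wavelet_transform_convergent_subsequence[of \<phi> f, OF \<phi> f] by blast
  define g where "g n = f (k n)" for n
  define \<rho> where "\<rho> n = \<sigma> (k n)" for n
  have gL2: "g n \<in> L2" and g1: "L2_norm (g n) \<le> 1" for n using f by (auto simp: g_def)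
  have elim: "(\<lambda>n. energy \<phi> (\<lambda>p. 1 - \<rho> n p) (g n)) \<longlonglongrightarrow> 0"
    using LIMSEQ_subseq_LIMSEQ[OF lim k] by (simp add: g_def \<rho>_def comp_def)
  \<comment> \<open>A mere pointwise limit of the transforms: it serves as an intermediate point for
    estimating the differences \<open>?W (g i) - ?W (g j)\<close> and is not claimed to be a
    transform itself.\<close>
  define L where "L p = lim (\<lambda>n. ?W (g n) p)" for p
  have WL: "(\<lambda>n. ?W (g n) p) \<longlonglongrightarrow> L p" if "p \<in> grp" for p
    using conv[OF that] by (simp add: L_def g_def convergent_LIMSEQ_iff)
  have Wm[measurable]: "?W (g n) \<in> borel_measurable borel" for n by (rule wavelet_transform_measurable[OF \<phi> gL2])
  have WH[measurable]: "?W (g n) \<in> borel_measurable ?H" for n by (rule borel_measurable_haar[OF Wm])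
  have LH[measurable]: "L \<in> borel_measurable ?H" unfolding L_def[abs_def] by measurable
  have Wbd: "cmod (?W (g n) p) \<le> ?N" if "p \<in> grp" for n p
    using cmod_wavelet_transform_le[OF \<phi> gL2 that, of n] mult_right_mono[OF g1[of n], of ?N] by simp
  have box[measurable]: "indicator (grp_box m) \<in> borel_measurable ?H" for m
    by (intro borel_measurable_haar borel_measurable_indicator grp_box_borel)
  \<comment> \<open>Local L1 distance to \<open>L\<close>, matching the integral over
    \<open>K\<close> in the energy estimate. It tends to 0 by dominated convergence because the
    transforms have a common bound and boxes have finite measure.\<close>
  define d where "d m n = (\<integral>\<^sup>+p. indicator (grp_box m) p * ennreal (cmod (?W (g n) p - L p)) \<partial>?H)" for m n
  have dlim: "d m \<longlonglongrightarrow> 0" for m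
  proof -
    have "d m \<longlonglongrightarrow> (\<integral>\<^sup>+p. 0 \<partial>?H)"
      unfolding d_def
    proof (rule nn_integral_dominated_convergence[where w = "\<lambda>p. ennreal (2 * ?N) * indicator (grp_box m) p"])
      show "(\<integral>\<^sup>+p. ennreal (2 * ?N) * indicator (grp_box m) p \<partial>?H) < \<infinity>"
        using emeasure_haar_box[of m, where 'd = 'd] by (subst nn_integral_cmult) (auto simp: ennreal_mult_less_top)
      show "AE p in ?H. indicator (grp_box m) p * ennreal (cmod (?W (g n) p - L p)) \<le> ennreal (2 * ?N) * indicator (grp_box m) p" for n
      proof (rule AE_I2)
        fix p assume "p \<in> space ?H"
        then have p: "p \<in> grp" by simp
        have "cmod (L p) \<le> ?N"
          by (rule LIMSEQ_le_const2[OF tendsto_norm[OF WL[OF p]]]) (use Wbd[OF p] in auto)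
        then have "cmod (?W (g n) p - L p) \<le> 2 * ?N"
          using norm_triangle_ineq4[of "?W (g n) p" "L p"] Wbd[OF p, of n] by simp
        then show "indicator (grp_box m) p * ennreal (cmod (?W (g n) p - L p)) \<le> ennreal (2 * ?N) * indicator (grp_box m) p"
          by (auto split: split_indicator intro: ennreal_leI)
      qed
      show "AE p in ?H. (\<lambda>n. indicator (grp_box m) p * ennreal (cmod (?W (g n) p - L p))) \<longlonglongrightarrow> 0"
      proof (rule AE_I2)
        fix p assume "p \<in> space ?H"
        then have "(\<lambda>n. ?W (g n) p - L p) \<longlonglongrightarrow> 0" using WL[of p] by (simp add: LIM_zero_iff)
        then have "(\<lambda>n. ennreal (cmod (?W (g n) p - L p))) \<longlonglongrightarrow> ennreal (cmod 0)"
          by (intro tendsto_ennrealI tendsto_norm)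
        then show "(\<lambda>n. indicator (grp_box m) p * ennreal (cmod (?W (g n) p - L p))) \<longlonglongrightarrow> 0"
          by (cases "p \<in> grp_box m") auto
      qed
    qed measurable
    then show ?thesis by simp
  qed
  have cauchy: "\<exists>M. \<forall>i\<ge>M. \<forall>j\<ge>M. esq lborel (\<lambda>x. g i x - g j x) \<le> ennreal \<epsilon>" if \<epsilon>: "\<epsilon> > 0" for \<epsilon> :: real
  proof -
    have e16: "\<epsilon> / 16 > 0" using \<epsilon> by simp
    obtain \<delta> :: real where \<delta>: "\<delta> > 0" and est: "\<And>\<sigma> K f. \<sigma> \<in> borel_measurable borel \<Longrightarrow> (\<And>p. 0 \<le> \<sigma> p \<and> \<sigma> p \<le> 1) \<Longrightarrow> K \<in> sets borel \<Longrightarrow>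
      (\<And>q. q \<in> grp \<Longrightarrow> q \<notin> K \<Longrightarrow> berezin \<phi> \<sigma> q \<le> ennreal \<delta>) \<Longrightarrow> f \<in> L2 \<Longrightarrow>
      (\<integral>\<^sup>+p. ennreal (\<sigma> p * (cmod (?W f p))\<^sup>2) \<partial>haar) \<le>
        ennreal (?N\<^sup>2) * (\<integral>\<^sup>+p. indicator K p * ennreal (cmod (?W f p)) \<partial>haar)\<^sup>2 + ennreal (\<epsilon> / 16) * esq lborel f"
      using thin_energy_estimate[OF A1 e16] by blast
    obtain m where m: "\<And>n q. q \<in> grp \<Longrightarrow> q \<notin> grp_box m \<Longrightarrow> berezin \<phi> (\<sigma> n) q \<le> ennreal (\<delta> / 2)"
      using thin \<delta> unfolding uniformly_thin_def by (metis DiffI half_gt_zero)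
    \<comment> \<open>This makes the box term \<open>?N^2 * (\<alpha> + \<alpha>)^2\<close> at most
      \<open>\<epsilon> / 4\<close>. Together with \<open>4 * \<epsilon> / 16\<close> from the Schur
      term and \<open>\<epsilon> / 4\<close> from the complementary energy the total stays below
      \<open>\<epsilon>\<close>.\<close>
    define \<alpha> where "\<alpha> = sqrt \<epsilon> / (4 * (?N + 1))"
    have \<alpha>: "\<alpha> > 0" unfolding \<alpha>_def using \<epsilon> by (intro divide_pos_pos mult_pos_pos) (auto intro: add_nonneg_pos)
    have \<alpha>\<epsilon>: "?N\<^sup>2 * (\<alpha> + \<alpha>)\<^sup>2 \<le> \<epsilon> / 4"
    proof -
      have "c * (sqrt \<epsilon> / (4 * c) + sqrt \<epsilon> / (4 * c)) = sqrt \<epsilon> / 2" if "c > 0" for c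
        using that by (simp add: field_simps)
      then have "(?N + 1) * (\<alpha> + \<alpha>) = sqrt \<epsilon> / 2"
        unfolding \<alpha>_def using L2_norm_nonneg[of \<phi>] by (meson add_nonneg_pos zero_less_one)
      moreover have "?N * (\<alpha> + \<alpha>) \<le> (?N + 1) * (\<alpha> + \<alpha>)" using \<alpha> by (intro mult_right_mono) auto
      ultimately have "?N * (\<alpha> + \<alpha>) \<le> sqrt \<epsilon> / 2" by simp
      then have "(?N * (\<alpha> + \<alpha>))\<^sup>2 \<le> (sqrt \<epsilon> / 2)\<^sup>2" using \<alpha> by (intro power_mono) auto
      also have "(sqrt \<epsilon> / 2)\<^sup>2 = \<epsilon> / 4" using \<epsilon> by (simp add: power_divide)
      finally show ?thesis by (simp add: power_mult_distrib)
    qed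
    have "\<forall>\<^sub>F n in sequentially. d m n < ennreal \<alpha> \<and> energy \<phi> (\<lambda>p. 1 - \<rho> n p) (g n) < ennreal (\<epsilon> / 16)"
      using \<alpha> \<epsilon> by (intro eventually_conj order_tendstoD(2)[OF dlim] order_tendstoD(2)[OF elim]) auto
    then obtain M where M: "\<And>n. n \<ge> M \<Longrightarrow> d m n < ennreal \<alpha>" "\<And>n. n \<ge> M \<Longrightarrow> energy \<phi> (\<lambda>p. 1 - \<rho> n p) (g n) < ennreal (\<epsilon> / 16)"
      by (auto simp: eventually_sequentially)
    show ?thesis
    proof (intro exI allI impI)
      fix i j assume ij: "M \<le> i" "M \<le> j"
      let ?u = "\<lambda>x. g i x - g j x"
      \<comment> \<open>The two functions belong to different symbols. Their maximum has a Berezin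
        transform below the sum, hence small off the box (the reason for \<open>\<delta> / 2\<close>
        above), and its complement lies below both complements.\<close>
      define \<tau> where "\<tau> p = max (\<rho> i p) (\<rho> j p)" for p
      have u: "?u \<in> L2" by (intro L2_diff gL2)
      have \<rho>m[measurable]: "\<rho> n \<in> borel_measurable borel" and \<rho>01: "0 \<le> \<rho> n p" "\<rho> n p \<le> 1" for n p
        using \<sigma> by (auto simp: \<rho>_def)
      have \<tau>m: "\<tau> \<in> borel_measurable borel" unfolding \<tau>_def[abs_def] by measurable
      have \<tau>01: "0 \<le> \<tau> p \<and> \<tau> p \<le> 1" for p using \<rho>01 by (auto simp: \<tau>_def max_def)
      have "esq lborel ?u \<le> 2 * esq lborel (g i) + 2 * esq lborel (g j)"
        by (rule esq_diff_le2) (use gL2 in \<open>auto simp: L2_iff\<close>)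
      also have "\<dots> \<le> 2 * 1 + 2 * 1"
        using g1 by (intro add_mono mult_left_mono) (auto simp: esq_L2 gL2 power_le_one)
      finally have u4: "esq lborel ?u \<le> 4" by simp
      have "energy \<phi> \<tau> ?u \<le> ennreal (?N\<^sup>2) * (\<integral>\<^sup>+p. indicator (grp_box m) p * ennreal (cmod (?W ?u p)) \<partial>haar)\<^sup>2 + ennreal (\<epsilon> / 16) * esq lborel ?u"
        unfolding energy_def
      proof (rule est[OF \<tau>m \<tau>01 grp_box_borel _ u])
        fix q :: "real \<times> (real ^ 'd)" assume q: "q \<in> grp" "q \<notin> grp_box m"
        have "berezin \<phi> \<tau> q \<le> berezin \<phi> (\<rho> i) q + berezin \<phi> (\<rho> j) q"
          unfolding \<tau>_def by (intro berezin_max_le \<phi> \<rho>m \<rho>01)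
        also have "\<dots> \<le> ennreal (\<delta> / 2) + ennreal (\<delta> / 2)"
          unfolding \<rho>_def by (intro add_mono m q)
        also have "\<dots> = ennreal \<delta>" using \<delta> by (simp flip: ennreal_plus)
        finally show "berezin \<phi> \<tau> q \<le> ennreal \<delta>" .
      qed
      also have "\<dots> \<le> ennreal (?N\<^sup>2) * (ennreal \<alpha> + ennreal \<alpha>)\<^sup>2 + ennreal (\<epsilon> / 16) * 4"
      proof (intro add_mono mult_left_mono power_mono_ennreal u4)
        have "(\<integral>\<^sup>+p. indicator (grp_box m) p * ennreal (cmod (?W ?u p)) \<partial>haar) \<le>
            (\<integral>\<^sup>+p. indicator (grp_box m) p * ennreal (cmod (?W (g i) p - L p)) + indicator (grp_box m) p * ennreal (cmod (?W (g j) p - L p)) \<partial>?H)"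
        proof (intro nn_integral_mono)
          fix p assume "p \<in> space ?H"
          then have "?W ?u p = (?W (g i) p - L p) - (?W (g j) p - L p)"
            by (simp add: wavelet_transform_diff \<phi> gL2 grp_iff)
          then have "cmod (?W ?u p) \<le> cmod (?W (g i) p - L p) + cmod (?W (g j) p - L p)"
            by (simp only: norm_triangle_ineq4)
          then show "indicator (grp_box m) p * ennreal (cmod (?W ?u p)) \<le>
              indicator (grp_box m) p * ennreal (cmod (?W (g i) p - L p)) + indicator (grp_box m) p * ennreal (cmod (?W (g j) p - L p))"
            by (auto split: split_indicator simp flip: ennreal_plus intro: ennreal_leI)
        qed
        also have "\<dots> = d m i + d m j" unfolding d_def by (rule nn_integral_add) measurable
        also have "\<dots> \<le> ennreal \<alpha> + ennreal \<alpha>" using M(1)[OF ij(1)] M(1)[OF ij(2)] by (intro add_mono) auto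
        finally show "(\<integral>\<^sup>+p. indicator (grp_box m) p * ennreal (cmod (?W ?u p)) \<partial>haar) \<le> ennreal \<alpha> + ennreal \<alpha>" .
      qed auto
      also have "\<dots> = ennreal (?N\<^sup>2 * (\<alpha> + \<alpha>)\<^sup>2 + \<epsilon> / 4)"
      proof -
        have "ennreal \<alpha> + ennreal \<alpha> = ennreal (\<alpha> + \<alpha>)"
          using \<alpha> by (intro ennreal_plus[symmetric]) auto
        then have "ennreal (?N\<^sup>2) * (ennreal \<alpha> + ennreal \<alpha>)\<^sup>2 = ennreal (?N\<^sup>2 * (\<alpha> + \<alpha>)\<^sup>2)"
          using \<alpha> by (simp only: ennreal_power ennreal_mult[symmetric] zero_le_power2 add_nonneg_nonneg less_imp_le)
        moreover have "ennreal (\<epsilon> / 16) * 4 = ennreal (\<epsilon> / 4)"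
          using \<epsilon> ennreal_mult[of "\<epsilon> / 16" 4] by simp
        moreover have "ennreal (?N\<^sup>2 * (\<alpha> + \<alpha>)\<^sup>2 + \<epsilon> / 4) = ennreal (?N\<^sup>2 * (\<alpha> + \<alpha>)\<^sup>2) + ennreal (\<epsilon> / 4)"
          using \<epsilon> by (intro ennreal_plus) auto
        ultimately show ?thesis by (simp only:)
      qed
      also have "\<dots> \<le> ennreal (\<epsilon> / 2)" using \<alpha>\<epsilon> by (intro ennreal_leI) simp
      finally have e1: "energy \<phi> \<tau> ?u \<le> ennreal (\<epsilon> / 2)" .
      have "energy \<phi> (\<lambda>p. 1 - \<tau> p) ?u \<le> 2 * energy \<phi> (\<lambda>p. 1 - \<rho> i p) (g i) + 2 * energy \<phi> (\<lambda>p. 1 - \<rho> j p) (g j)"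
        using \<tau>01 by (intro energy_diff_le \<phi> gL2) (auto simp: \<tau>_def)
      also have "\<dots> \<le> 2 * ennreal (\<epsilon> / 16) + 2 * ennreal (\<epsilon> / 16)"
        using M(2)[OF ij(1)] M(2)[OF ij(2)] by (intro add_mono mult_left_mono) auto
      also have "\<dots> = ennreal (\<epsilon> / 4)"
        using \<epsilon> ennreal_mult[of 4 "\<epsilon> / 16"] by (simp flip: distrib_right)
      finally have e2: "energy \<phi> (\<lambda>p. 1 - \<tau> p) ?u \<le> ennreal (\<epsilon> / 4)" .
      have "esq lborel ?u = energy \<phi> \<tau> ?u + energy \<phi> (\<lambda>p. 1 - \<tau> p) ?u"
        by (rule energy_complement[OF adm u \<tau>m \<tau>01])
      also have "\<dots> \<le> ennreal (\<epsilon> / 2) + ennreal (\<epsilon> / 4)" by (intro add_mono e1 e2)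
      also have "\<dots> \<le> ennreal \<epsilon>" using \<epsilon> by (simp add: ennreal_leI flip: ennreal_plus)
      finally show "esq lborel ?u \<le> ennreal \<epsilon>" .
    qed
  qed
  obtain G where "G \<in> L2" "(\<lambda>n. esq lborel (\<lambda>x. g n x - G x)) \<longlonglongrightarrow> 0"
    using L2_complete[OF gL2 cauchy] by blast
  then show ?thesis using that[OF k, of G] by (simp add: g_def)
qed

section \<open>Translations acting on the index group\<close>

text \<open>Left multiplication by the inverse of \<open>(1, b)\<close>, the pullback that
  corresponds to translating functions by \<open>b\<close>. It displaces the second coordinate by
  \<open>b / a\<close>, which is unbounded as the scale tends to 0.\<close>

definition shift :: "real ^ 'd \<Rightarrow> real \<times> (real ^ 'd) \<Rightarrow> real \<times> (real ^ 'd)" where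
  "shift b p = grp_mult (1, - b) p"

lemma shift_eq: "shift b p = (fst p, snd p - inverse (fst p) *\<^sub>R b)"
  by (simp add: shift_def grp_mult_eq)

lemma shift_grp: "p \<in> grp \<Longrightarrow> shift b p \<in> grp"
  by (simp add: grp_iff shift_eq)

lemma trans_grp: "(1, b) \<in> grp"
  by (simp add: grp_iff)

lemma shift_cancel: "shift b (grp_mult (1, b) p) = p" "grp_mult (1, b) (shift b p) = p"
  by (simp_all add: shift_eq grp_mult_eq)

lemma shift_measurable:
  "F \<in> borel_measurable M \<Longrightarrow> (\<lambda>x. shift b (F x)) \<in> borel_measurable M"
  unfolding shift_def by (rule grp_mult_measurable) auto

lemma comp_shift_measurable:
  "F \<in> borel_measurable borel \<Longrightarrow> (\<lambda>p. F (shift b p)) \<in> borel_measurable borel"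
  by (rule measurable_compose[of "shift b" borel borel F]) (auto intro: shift_measurable[of "\<lambda>x. x"])

lemma nn_integral_haar_shift:
  fixes F :: "real \<times> (real ^ 'd) \<Rightarrow> ennreal"
  assumes "F \<in> borel_measurable borel"
  shows "(\<integral>\<^sup>+p. F (shift b p) \<partial>haar) = (\<integral>\<^sup>+p. F p \<partial>haar)"
  unfolding shift_def by (rule nn_integral_haar_left_invariant[OF assms trans_grp])

lemma wavelet_transform_translate:
  fixes \<phi> f :: "real ^ 'd \<Rightarrow> complex"
  assumes \<phi>: "\<phi> \<in> L2" and f: "f \<in> L2" and p: "p \<in> grp"
  shows "wavelet_transform \<phi> (\<lambda>x. f (x - b)) p = wavelet_transform \<phi> f (shift b p)"
proof -
  have r: "shift b p \<in> grp" by (rule shift_grp[OF p])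
  have "wavelet_transform \<phi> (\<lambda>x. f (x - b)) p = L2_inner (wavelet f (1, b)) (wavelet \<phi> (grp_mult (1, b) (shift b p)))"
    unfolding wavelet_transform_def wavelet_translate shift_cancel ..
  also have "\<dots> = L2_inner (wavelet f (1, b)) (wavelet (wavelet \<phi> (shift b p)) (1, b))"
    using r by (simp only: wavelet_grp_mult grp_iff fst_conv zero_less_one)
  also have "\<dots> = wavelet_transform \<phi> f (shift b p)"
    unfolding wavelet_transform_def using r by (intro L2_inner_wavelet f wavelet_L2 \<phi>) (auto simp: grp_iff)
  finally show ?thesis .
qed

lemma energy_translate:
  fixes \<phi> f :: "real ^ 'd \<Rightarrow> complex"
  assumes \<phi>: "\<phi> \<in> L2" and f: "f \<in> L2" and \<rho>: "\<rho> \<in> borel_measurable borel"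
  shows "energy \<phi> (\<lambda>p. \<rho> (shift b p)) (\<lambda>x. f (x - b)) = energy \<phi> \<rho> f"
proof -
  note [measurable] = wavelet_transform_measurable[OF \<phi> f] \<rho>
  have "energy \<phi> (\<lambda>p. \<rho> (shift b p)) (\<lambda>x. f (x - b)) =
      (\<integral>\<^sup>+p. ennreal (\<rho> (shift b p) * (cmod (wavelet_transform \<phi> f (shift b p)))\<^sup>2) \<partial>haar)"
    unfolding energy_def by (intro nn_integral_cong) (simp add: wavelet_transform_translate[OF \<phi> f])
  also have "\<dots> = energy \<phi> \<rho> f"
    unfolding energy_def by (rule nn_integral_haar_shift) measurable
  finally show ?thesis .
qed

lemma berezin_shift:
  fixes \<phi> :: "real ^ 'd \<Rightarrow> complex"
  assumes \<phi>: "\<phi> \<in> L2" and \<sigma>: "\<sigma> \<in> borel_measurable borel" and q: "q \<in> grp"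
  shows "berezin \<phi> (\<lambda>p. \<sigma> (shift b p)) q = berezin \<phi> \<sigma> (shift b q)"
proof -
  note [measurable] = kernel_measurable[OF \<phi>] \<sigma>
  have "berezin \<phi> (\<lambda>p. \<sigma> (shift b p)) q =
      (\<integral>\<^sup>+p. ennreal (\<sigma> (shift b p) * (kernel \<phi> (shift b p) (shift b q))\<^sup>2) \<partial>haar)"
    unfolding berezin_def
  proof (intro nn_integral_cong)
    fix p :: "real \<times> (real ^ 'd)" assume "p \<in> space haar"
    then have "p \<in> grp" by simp
    then have "kernel \<phi> (shift b p) (shift b q) = kernel \<phi> p q"
      unfolding shift_def by (intro kernel_left_invariant \<phi> trans_grp q)
    then show "ennreal (\<sigma> (shift b p) * (kernel \<phi> p q)\<^sup>2) = ennreal (\<sigma> (shift b p) * (kernel \<phi> (shift b p) (shift b q))\<^sup>2)"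
      by simp
  qed
  also have "\<dots> = berezin \<phi> \<sigma> (shift b q)"
    unfolding berezin_def by (rule nn_integral_haar_shift) measurable
  finally show ?thesis .
qed

text \<open>In a box the scale is at least \<open>1 / m\<close>, so a shift with
  \<open>norm b \<le> 1\<close> displaces the second coordinate by at most \<open>m\<close>;
  doubling the box absorbs this.\<close>

lemma shift_box:
  assumes "shift b q \<in> grp_box m" "q \<in> grp" "norm b \<le> 1"
  shows "q \<in> grp_box (2 * m)"
proof -
  obtain a c where q: "q = (a, c)" by (cases q)
  have a: "a > 0" using assms(2) by (simp add: q grp_iff)
  have box: "inverse (real m) \<le> a" "a \<le> real m" "norm (c - inverse a *\<^sub>R b) \<le> real m"
    using assms(1) by (auto simp: q shift_eq grp_box_def)
  have m: "real m > 0" using a box(2) by linarith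
  have "inverse a \<le> real m" using le_imp_inverse_le[OF box(1)] m by simp
  then have "norm (inverse a *\<^sub>R b) \<le> real m * 1"
    using assms(3) a unfolding norm_scaleR by (intro mult_mono) auto
  then have "norm c \<le> real m + real m"
    using norm_triangle_ineq[of "c - inverse a *\<^sub>R b" "inverse a *\<^sub>R b"] box(3) by simp
  then have "norm c \<le> real (2 * m)" by simp
  moreover have "inverse (real (2 * m)) \<le> inverse (real m)" using m by (intro le_imp_inverse_le) auto
  then have "inverse (real (2 * m)) \<le> a" using box(1) by linarith
  moreover have "a \<le> real (2 * m)" using box(2) m by simp
  ultimately show ?thesis unfolding q grp_box_def by (simp del: of_nat_mult)
qed

text \<open>Off box \<open>2 * m\<close> neither \<open>q\<close> nor its shift lies in box
  \<open>m\<close>, and the Berezin transform of a maximum is at most the sum of the two. The common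
  bound on the shifts makes the box independent of \<open>n\<close>.\<close>

lemma uniformly_thin_max_shift:
  fixes \<phi> :: "real ^ 'd \<Rightarrow> complex"
  assumes \<phi>: "\<phi> \<in> L2" and thin: "uniformly_thin \<phi> (\<lambda>_. \<sigma>)" and b: "\<And>n. norm (b n) \<le> 1"
  shows "uniformly_thin \<phi> (\<lambda>n p. max (\<sigma> p) (\<sigma> (shift (b n) p)))"
  unfolding uniformly_thin_def
proof (intro conjI allI impI)
  have \<sigma>: "\<sigma> \<in> borel_measurable borel" "0 \<le> \<sigma> p" "\<sigma> p \<le> 1" for p
    using thin unfolding uniformly_thin_def by blast+
  note [measurable] = \<sigma>(1) comp_shift_measurable[OF \<sigma>(1)]
  show "(\<lambda>p. max (\<sigma> p) (\<sigma> (shift (b n) p))) \<in> borel_measurable borel" for n by measurable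
  show "0 \<le> max (\<sigma> p) (\<sigma> (shift (b n) p))" for n p using \<sigma>(2)[of p] by simp
  show "max (\<sigma> p) (\<sigma> (shift (b n) p)) \<le> 1" for n p using \<sigma>(3) by simp
  fix \<delta> :: real assume \<delta>: "\<delta> > 0"
  then have "\<delta> / 2 > 0" by simp
  then obtain m where m: "\<And>q. q \<in> grp - grp_box m \<Longrightarrow> berezin \<phi> \<sigma> q \<le> ennreal (\<delta> / 2)"
    using thin unfolding uniformly_thin_def by blast
  show "\<exists>m. \<forall>n. \<forall>q\<in>grp - grp_box m. berezin \<phi> (\<lambda>p. max (\<sigma> p) (\<sigma> (shift (b n) p))) q \<le> ennreal \<delta>"
  proof (intro exI allI ballI)
    fix n and q :: "real \<times> (real ^ 'd)" assume q: "q \<in> grp - grp_box (2 * m)"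
    \<comment> \<open>Regarding the identity as the zero shift lets \<open>shift_box\<close> handle
      \<open>q\<close> itself.\<close>
    have s0: "shift 0 q = q" by (simp add: shift_eq)
    have "q \<notin> grp_box m" using shift_box[of 0 q m] q s0 by auto
    moreover have "shift (b n) q \<notin> grp_box m" using shift_box[OF _ _ b, of n q m] q by auto
    ultimately have le: "berezin \<phi> \<sigma> q \<le> ennreal (\<delta> / 2)" "berezin \<phi> \<sigma> (shift (b n) q) \<le> ennreal (\<delta> / 2)"
      using q by (auto intro!: m shift_grp)
    have "berezin \<phi> (\<lambda>p. max (\<sigma> p) (\<sigma> (shift (b n) p))) q \<le> berezin \<phi> \<sigma> q + berezin \<phi> (\<lambda>p. \<sigma> (shift (b n) p)) q"
      by (intro berezin_max_le \<phi> \<sigma> comp_shift_measurable)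
    also have "\<dots> \<le> ennreal (\<delta> / 2) + ennreal (\<delta> / 2)"
      using le q by (intro add_mono) (auto simp: berezin_shift[OF \<phi> \<sigma>(1)])
    also have "\<dots> = ennreal \<delta>" using \<delta> by (simp flip: ennreal_plus)
    finally show "berezin \<phi> (\<lambda>p. max (\<sigma> p) (\<sigma> (shift (b n) p))) q \<le> ennreal \<delta>" .
  qed
qed

text \<open>On the slice at scale \<open>a\<close> the shift is a Euclidean translation by
  \<open>b / a\<close>, so the slice error tends to 0 by strong continuity. This is not uniform as
  \<open>a\<close> tends to 0; the bound of the slice error by \<open>4 * E a\<close> permits
  dominated convergence in \<open>a\<close> instead.\<close>

lemma shift_tendsto:
  fixes r :: "real \<times> (real ^ 'd) \<Rightarrow> complex"
  assumes r[measurable]: "r \<in> borel_measurable borel" and fin: "esq haar r < \<infinity>" and b: "b \<longlonglongrightarrow> 0"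
  shows "(\<lambda>n. esq haar (\<lambda>p. r (shift (b n) p) - r p)) \<longlonglongrightarrow> 0"
proof -
  define E where "E a = esq lborel (\<lambda>c. r (a, c))" for a
  define D where "D n a = esq lborel (\<lambda>c. r (a, c - inverse a *\<^sub>R b n) - r (a, c))" for n a
  let ?i = "\<lambda>a. indicator {0<..} a * ennreal (inverse a)"
  have rs[measurable]: "(\<lambda>p. r (shift (b n) p)) \<in> borel_measurable borel" for n
    by (rule comp_shift_measurable[OF r])
  have pm: "F \<in> borel_measurable (lborel \<Otimes>\<^sub>M lborel)" if "F \<in> borel_measurable borel" for F :: "real \<times> (real ^ 'd) \<Rightarrow> ennreal"
    using that by (simp add: lborel_prod)
  have [measurable]: "E \<in> borel_measurable lborel"
    unfolding E_def[abs_def] esq_def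
    using lborel.borel_measurable_nn_integral_fst[OF pm, of "\<lambda>p. ennreal ((cmod (r p))\<^sup>2)"] by simp
  have [measurable]: "D n \<in> borel_measurable lborel" for n
    using lborel.borel_measurable_nn_integral_fst[OF pm, of "\<lambda>p. ennreal ((cmod (r (shift (b n) p) - r p))\<^sup>2)"]
    by (simp add: D_def[abs_def] esq_def shift_eq)
  have slice: "(\<lambda>c. r (a, c)) \<in> borel_measurable lborel" for a using slice_measurable[OF r, of a] by simp
  have sliceT: "(\<lambda>c. r (a, c - t)) \<in> borel_measurable lborel" and esqT: "esq lborel (\<lambda>c. r (a, c - t)) = E a" for a t
  proof -
    note [measurable] = slice_measurable[OF r, of a]
    show "(\<lambda>c. r (a, c - t)) \<in> borel_measurable lborel" using measurable_compose[of "\<lambda>c. c - t" borel borel "\<lambda>c. r (a, c)" borel] by simp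
    show "esq lborel (\<lambda>c. r (a, c - t)) = E a"
      unfolding E_def esq_def using nn_integral_lborel_translate[of "\<lambda>c. ennreal ((cmod (r (a, c)))\<^sup>2)" "- t"] by simp
  qed
  have Efin: "(\<integral>\<^sup>+a. ?i a * E a \<partial>lborel) < \<infinity>"
    using fin nn_integral_haar[of "\<lambda>p. ennreal ((cmod (r p))\<^sup>2)"] by (simp add: esq_def E_def)
  have D4: "D n a \<le> 4 * E a" for n a
    unfolding D_def using esq_diff_le2[OF sliceT[of a "inverse a *\<^sub>R b n"] slice[of a]] by (simp add: esqT E_def flip: distrib_right)
  have "(\<lambda>n. \<integral>\<^sup>+a. ?i a * D n a \<partial>lborel) \<longlonglongrightarrow> (\<integral>\<^sup>+a. 0 \<partial>(lborel :: real measure))"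
  proof (rule nn_integral_dominated_convergence[where w = "\<lambda>a. 4 * (?i a * E a)"])
    show "(\<integral>\<^sup>+a. 4 * (?i a * E a) \<partial>lborel) < \<infinity>"
      using Efin by (subst nn_integral_cmult) (auto simp: ennreal_mult_less_top)
    show "AE a in lborel. ?i a * D n a \<le> 4 * (?i a * E a)" for n
      using mult_left_mono[OF D4, of "?i _"] by (intro AE_I2) (simp add: mult.left_commute)
    have "AE a in lborel. ?i a * E a \<noteq> \<infinity>" using Efin by (intro nn_integral_PInf_AE) auto
    then show "AE a in lborel. (\<lambda>n. ?i a * D n a) \<longlonglongrightarrow> 0"
    proof eventually_elim
      fix a assume fin: "?i a * E a \<noteq> \<infinity>"
      show "(\<lambda>n. ?i a * D n a) \<longlonglongrightarrow> 0"
      proof (cases "a > 0")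
        case True
        then have "E a < \<infinity>" using fin by (auto simp: ennreal_mult_eq_top_iff less_top)
        then have L: "(\<lambda>c. r (a, c)) \<in> L2" using slice[of a] by (simp add: L2_iff E_def)
        have "(\<lambda>n. inverse a *\<^sub>R b n) \<longlonglongrightarrow> inverse a *\<^sub>R 0" by (intro tendsto_scaleR tendsto_const b)
        then have "(\<lambda>n. D n a) \<longlonglongrightarrow> 0" unfolding D_def by (intro translation_tendsto[OF L]) simp
        then have "(\<lambda>n. ennreal (inverse a) * D n a) \<longlonglongrightarrow> ennreal (inverse a) * 0"
          by (rule ennreal_tendsto_cmult[rotated]) simp
        then show ?thesis using True by simp
      qed simp
    qed
  qed measurable
  moreover have "esq haar (\<lambda>p. r (shift (b n) p) - r p) = (\<integral>\<^sup>+a. ?i a * D n a \<partial>lborel)" for n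
  proof -
    have "(\<lambda>p. ennreal ((cmod (r (shift (b n) p) - r p))\<^sup>2)) \<in> borel_measurable borel" by measurable
    from nn_integral_haar[OF this] show ?thesis unfolding esq_def D_def by (simp add: shift_eq)
  qed
  ultimately show ?thesis by simp
qed

section \<open>Injectivity\<close>

lemma power2_le_sum3:
  fixes x y z t :: real
  assumes "0 \<le> t" "t \<le> x + y + z"
  shows "t\<^sup>2 \<le> 3 * x\<^sup>2 + 3 * y\<^sup>2 + 3 * z\<^sup>2"
proof -
  have "t\<^sup>2 \<le> (x + y + z)\<^sup>2" using assms by (intro power_mono) auto
  also have "\<dots> = 3 * x\<^sup>2 + 3 * y\<^sup>2 + 3 * z\<^sup>2 - ((x - y)\<^sup>2 + (y - z)\<^sup>2 + (x - z)\<^sup>2)"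
    by (simp add: power2_eq_square algebra_simps)
  also have "\<dots> \<le> 3 * x\<^sup>2 + 3 * y\<^sup>2 + 3 * z\<^sup>2"
    using zero_le_power2[of "x - y"] zero_le_power2[of "y - z"] zero_le_power2[of "x - z"] by linarith
  finally show ?thesis .
qed

lemma nn_integral_add3:
  fixes F G H :: "'a \<Rightarrow> ennreal"
  assumes [measurable]: "F \<in> borel_measurable M" "G \<in> borel_measurable M" "H \<in> borel_measurable M"
  shows "(\<integral>\<^sup>+p. (3 * F p + 3 * G p) + 3 * H p \<partial>M) =
    3 * (\<integral>\<^sup>+p. F p \<partial>M) + 3 * (\<integral>\<^sup>+p. G p \<partial>M) + 3 * (\<integral>\<^sup>+p. H p \<partial>M)"
  by (simp add: nn_integral_add nn_integral_cmult)

text \<open>A measurable \<open>\<sigma>\<close> gives no pointwise convergence of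
  \<open>\<sigma> (shift (b n) p)\<close>. Instead \<open>sqrt (1 - \<sigma>) * |W u|\<close> and
  \<open>W u\<close> are square integrable over the group, and their shifts converge in the mean;
  this controls the part where the shifted symbol exceeds \<open>\<sigma>\<close>.\<close>

lemma energy_shift_limit:
  fixes \<phi> u :: "real ^ 'd \<Rightarrow> complex"
  assumes adm: "\<phi> \<in> admissible" and u: "u \<in> L2" and \<sigma>: "\<sigma> \<in> borel_measurable borel" "\<And>p. 0 \<le> \<sigma> p \<and> \<sigma> p \<le> 1"
    and b: "b \<longlonglongrightarrow> 0" and lim: "(\<lambda>n. energy \<phi> (\<lambda>p. 1 - max (\<sigma> p) (\<sigma> (shift (b n) p))) u) \<longlonglongrightarrow> 0"
  shows "energy \<phi> (\<lambda>p. 1 - \<sigma> p) u = 0"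
proof -
  have \<phi>: "\<phi> \<in> L2" by (rule admissible_L2[OF adm])
  let ?W = "wavelet_transform \<phi> u"
  have W[measurable]: "?W \<in> borel_measurable borel" by (rule wavelet_transform_measurable[OF \<phi> u])
  note [measurable] = \<sigma>(1)
  \<comment> \<open>The square root is taken so that \<open>esq haar r\<close> is the energy in
    question.\<close>
  define r where "r p = complex_of_real (sqrt (1 - \<sigma> p)) * complex_of_real (cmod (?W p))" for p
  have r[measurable]: "r \<in> borel_measurable borel" unfolding r_def[abs_def] by measurable
  have Wfin: "esq haar ?W < \<infinity>" unfolding wavelet_isometry[OF adm u] by (rule L2_esq[OF u])
  have rn: "cmod (r p) = sqrt (1 - \<sigma> p) * cmod (?W p)" for p
    using \<sigma>(2)[of p] by (simp add: r_def norm_mult)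
  have "esq haar r \<le> esq haar ?W"
  proof (rule esq_mono)
    fix p
    have "sqrt (1 - \<sigma> p) * cmod (?W p) \<le> 1 * cmod (?W p)" using \<sigma>(2)[of p] by (intro mult_right_mono) auto
    then show "cmod (r p) \<le> cmod (?W p)" by (simp add: rn)
  qed
  then have rfin: "esq haar r < \<infinity>" using Wfin by (rule le_less_trans)
  let ?e = "\<lambda>n. energy \<phi> (\<lambda>p. 1 - max (\<sigma> p) (\<sigma> (shift (b n) p))) u"
  let ?A = "\<lambda>n. esq haar (\<lambda>p. r (shift (b n) p) - r p)"
  let ?B = "\<lambda>n. esq haar (\<lambda>p. ?W (shift (b n) p) - ?W p)"
  have le: "energy \<phi> (\<lambda>p. 1 - \<sigma> p) u \<le> 3 * ?e n + 3 * ?A n + 3 * ?B n" for n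
  proof -
    note sm[measurable] = comp_shift_measurable[OF r, of "b n"] comp_shift_measurable[OF W, of "b n"] comp_shift_measurable[OF \<sigma>(1), of "b n"]
    let ?m = "\<lambda>p. 1 - max (\<sigma> p) (\<sigma> (shift (b n) p))"
    have "energy \<phi> (\<lambda>p. 1 - \<sigma> p) u \<le> (\<integral>\<^sup>+p. (3 * ennreal (?m p * (cmod (?W p))\<^sup>2) +
        3 * ennreal ((cmod (r (shift (b n) p) - r p))\<^sup>2)) + 3 * ennreal ((cmod (?W (shift (b n) p) - ?W p))\<^sup>2) \<partial>haar)"
      unfolding energy_def
    proof (intro nn_integral_mono)
      fix p :: "real \<times> (real ^ 'd)"
      let ?s = "shift (b n) p"
      have m0: "?m p \<ge> 0" using \<sigma>(2) by simp
      \<comment> \<open>If \<open>\<sigma>\<close> attains the maximum at \<open>p\<close>, the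
        first term alone is \<open>cmod (r p)\<close>. Otherwise \<open>sqrt (?m p)\<close> is the
        factor of \<open>r\<close> at the shifted point, and the two differences pay for moving
        \<open>r\<close> and \<open>?W\<close> there.\<close>
      have "cmod (r p) \<le> sqrt (?m p) * cmod (?W p) + cmod (r ?s - r p) + cmod (?W ?s - ?W p)"
      proof (cases "\<sigma> ?s \<le> \<sigma> p")
        case True
        then show ?thesis by (simp add: rn)
      next
        case False
        then have mx: "?m p = 1 - \<sigma> ?s" by simp
        have "cmod (r ?s) \<le> sqrt (1 - \<sigma> ?s) * (cmod (?W p) + cmod (?W ?s - ?W p))"
          unfolding rn using \<sigma>(2)[of ?s] norm_triangle_ineq[of "?W p" "?W ?s - ?W p"] by (intro mult_left_mono) auto
        also have "\<dots> = sqrt (?m p) * cmod (?W p) + sqrt (1 - \<sigma> ?s) * cmod (?W ?s - ?W p)"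
          unfolding mx by (simp add: distrib_left)
        also have "sqrt (1 - \<sigma> ?s) * cmod (?W ?s - ?W p) \<le> 1 * cmod (?W ?s - ?W p)"
          using \<sigma>(2)[of ?s] by (intro mult_right_mono) auto
        finally have "cmod (r ?s) \<le> sqrt (?m p) * cmod (?W p) + cmod (?W ?s - ?W p)" by simp
        moreover have "cmod (r p) \<le> cmod (r ?s) + cmod (r ?s - r p)"
          using norm_triangle_ineq4[of "r ?s" "r ?s - r p"] by simp
        ultimately show ?thesis by linarith
      qed
      then have "(cmod (r p))\<^sup>2 \<le> 3 * (sqrt (?m p) * cmod (?W p))\<^sup>2 + 3 * (cmod (r ?s - r p))\<^sup>2 + 3 * (cmod (?W ?s - ?W p))\<^sup>2"
        by (rule power2_le_sum3[rotated]) simp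
      then have "(1 - \<sigma> p) * (cmod (?W p))\<^sup>2 \<le> 3 * (?m p * (cmod (?W p))\<^sup>2) + 3 * (cmod (r ?s - r p))\<^sup>2 + 3 * (cmod (?W ?s - ?W p))\<^sup>2"
        using \<sigma>(2)[of p] m0 unfolding rn power_mult_distrib by (simp only: real_sqrt_pow2 diff_ge_0_iff_ge)
      then have "ennreal ((1 - \<sigma> p) * (cmod (?W p))\<^sup>2) \<le> ennreal (3 * (?m p * (cmod (?W p))\<^sup>2) + 3 * (cmod (r ?s - r p))\<^sup>2 + 3 * (cmod (?W ?s - ?W p))\<^sup>2)"
        by (rule ennreal_leI)
      also have "\<dots> = (3 * ennreal (?m p * (cmod (?W p))\<^sup>2) + 3 * ennreal ((cmod (r ?s - r p))\<^sup>2)) + 3 * ennreal ((cmod (?W ?s - ?W p))\<^sup>2)"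
      proof -
        have three: "3 * ennreal x = ennreal (3 * x)" if "x \<ge> 0" for x using that by (simp add: ennreal_mult)
        have "0 \<le> ?m p * (cmod (?W p))\<^sup>2" using m0 by simp
        then show ?thesis by (simp only: three zero_le_power2 ennreal_plus add_nonneg_nonneg mult_nonneg_nonneg zero_le_numeral)
      qed
      finally show "ennreal ((1 - \<sigma> p) * (cmod (?W p))\<^sup>2) \<le> (3 * ennreal (?m p * (cmod (?W p))\<^sup>2) + 3 * ennreal ((cmod (r ?s - r p))\<^sup>2)) + 3 * ennreal ((cmod (?W ?s - ?W p))\<^sup>2)" .
    qed
    also have "\<dots> = 3 * ?e n + 3 * ?A n + 3 * ?B n"
    proof -
      have 1: "(\<lambda>p. ennreal (?m p * (cmod (?W p))\<^sup>2)) \<in> borel_measurable haar"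
        "(\<lambda>p. ennreal ((cmod (r (shift (b n) p) - r p))\<^sup>2)) \<in> borel_measurable haar"
        "(\<lambda>p. ennreal ((cmod (?W (shift (b n) p) - ?W p))\<^sup>2)) \<in> borel_measurable haar"
        by (rule borel_measurable_haar, measurable)+
      note [measurable] = 1
      show ?thesis unfolding energy_def esq_def
        by (rule nn_integral_add3[OF 1])
    qed
    finally show ?thesis .
  qed
  have A: "?A \<longlonglongrightarrow> 0" by (rule shift_tendsto[OF r rfin b])
  have B: "?B \<longlonglongrightarrow> 0" by (rule shift_tendsto[OF W Wfin b])
  have "(\<lambda>n. 3 * ?e n + 3 * ?A n + 3 * ?B n) \<longlonglongrightarrow> 3 * 0 + 3 * 0 + 3 * 0"
    by (intro tendsto_add ennreal_tendsto_cmult lim A B) auto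
  then have "(\<lambda>n. 3 * ?e n + 3 * ?A n + 3 * ?B n) \<longlonglongrightarrow> 0" by simp
  then have "energy \<phi> (\<lambda>p. 1 - \<sigma> p) u \<le> 0"
    by (rule LIMSEQ_le_const) (use le in blast)
  then show ?thesis by simp
qed

section \<open>The null space of the complementary energy and its translates\<close>

definition null_space :: "(real ^ 'd \<Rightarrow> complex) \<Rightarrow> (real \<times> (real ^ 'd) \<Rightarrow> real) \<Rightarrow> (real ^ 'd \<Rightarrow> complex) set" where
  "null_space \<phi> \<sigma> = {f \<in> L2. energy \<phi> (\<lambda>p. 1 - \<sigma> p) f = 0}"

text \<open>From \<open>f = g - (g - f)\<close>. It carries vanishing of the energy to norm limits,
  also for weights that change along the sequence.\<close>

lemma energy_le_limit:
  fixes \<phi> f g :: "real ^ 'd \<Rightarrow> complex"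
  assumes adm: "\<phi> \<in> admissible" and f: "f \<in> L2" and g: "g \<in> L2"
    and \<rho>: "\<rho> \<in> borel_measurable borel" "\<And>p. 0 \<le> \<rho> p \<and> \<rho> p \<le> 1"
  shows "energy \<phi> \<rho> f \<le> 2 * energy \<phi> \<rho> g + 2 * esq lborel (\<lambda>x. g x - f x)"
proof -
  have \<phi>: "\<phi> \<in> L2" by (rule admissible_L2[OF adm])
  have d: "(\<lambda>x. g x - f x) \<in> L2" by (rule L2_diff[OF g f])
  have "energy \<phi> \<rho> (\<lambda>x. g x - (g x - f x)) \<le> 2 * energy \<phi> \<rho> g + 2 * energy \<phi> \<rho> (\<lambda>x. g x - f x)"
    using \<rho> by (intro energy_diff_le[OF \<phi> g d]) auto
  also have "\<dots> \<le> 2 * energy \<phi> \<rho> g + 2 * esq lborel (\<lambda>x. g x - f x)"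
    using \<rho> by (intro add_mono mult_left_mono energy_le_esq adm d) auto
  finally show ?thesis by simp
qed

lemma null_space_add:
  fixes \<phi> v w :: "real ^ 'd \<Rightarrow> complex"
  assumes \<phi>: "\<phi> \<in> L2" and \<sigma>: "\<sigma> \<in> borel_measurable borel" "\<And>p. 0 \<le> \<sigma> p \<and> \<sigma> p \<le> 1"
    and v: "v \<in> null_space \<phi> \<sigma>" and w: "w \<in> null_space \<phi> \<sigma>"
  shows "(\<lambda>x. v x + c * w x) \<in> null_space \<phi> \<sigma>"
proof -
  have L: "v \<in> L2" "w \<in> L2" using v w by (auto simp: null_space_def)
  note L = L L2_cmult[OF L(2), of "- c"]
  have m: "(\<lambda>p. 1 - \<sigma> p) \<in> borel_measurable borel" using \<sigma>(1) by measurable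
  have "energy \<phi> (\<lambda>p. 1 - \<sigma> p) (\<lambda>x. v x - (- c) * w x) \<le>
      2 * energy \<phi> (\<lambda>p. 1 - \<sigma> p) v + 2 * energy \<phi> (\<lambda>p. 1 - \<sigma> p) (\<lambda>x. (- c) * w x)"
    using \<sigma> by (intro energy_diff_le \<phi> L m) auto
  also have "\<dots> = 0" using v w by (simp only: energy_cmult[OF \<phi> L(2) m]) (simp add: null_space_def)
  finally show ?thesis using L by (simp add: null_space_def L2_add L2_cmult)
qed

text \<open>Riesz's lemma with an almost nearest point instead of a projection: a \<open>v\<close>
  within a factor 2 of the infimum of squared distances gives the constant 1/2. The infimum is
  positive because each \<open>v\<close> in the space satisfies \<open>?e h \<le> 2 * Q v\<close>,
  so the energy of \<open>h\<close> itself bounds the distance from below.\<close>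

lemma null_space_Riesz_lemma:
  fixes \<phi> h :: "real ^ 'd \<Rightarrow> complex"
  assumes adm: "\<phi> \<in> admissible" and \<sigma>: "\<sigma> \<in> borel_measurable borel" "\<And>p. 0 \<le> \<sigma> p \<and> \<sigma> p \<le> 1"
    and h: "h \<in> L2" "h \<notin> null_space \<phi> \<sigma>"
  obtains v c where "v \<in> null_space \<phi> \<sigma>" "L2_norm (\<lambda>x. complex_of_real c * (h x - v x)) = 1"
    "\<And>w. w \<in> null_space \<phi> \<sigma> \<Longrightarrow> esq lborel (\<lambda>x. complex_of_real c * (h x - v x) - w x) \<ge> ennreal (1 / 2)"
proof -
  have \<phi>: "\<phi> \<in> L2" by (rule admissible_L2[OF adm])
  let ?V = "null_space \<phi> \<sigma>" and ?e = "energy \<phi> (\<lambda>p. 1 - \<sigma> p)"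
  have VL: "v \<in> L2" if "v \<in> ?V" for v using that by (simp add: null_space_def)
  have m: "(\<lambda>p. 1 - \<sigma> p) \<in> borel_measurable borel" using \<sigma>(1) by measurable
  have pos: "?e h > 0" using h by (auto simp: null_space_def zero_less_iff_neq_zero)
  have "?e h \<le> esq lborel h" using \<sigma> by (intro energy_le_esq adm h) auto
  also have "\<dots> = ennreal ((L2_norm h)\<^sup>2)" by (rule esq_L2[OF h(1)])
  finally obtain e0 where e0: "?e h = ennreal e0" "e0 > 0"
    using pos by (cases "?e h") (auto simp: top_unique)
  define Q where "Q v = (L2_norm (\<lambda>x. h x - v x))\<^sup>2" for v
  have Q: "e0 / 2 \<le> Q v" if v: "v \<in> ?V" for v
  proof -
    have d: "(\<lambda>x. v x - h x) \<in> L2" by (intro L2_diff VL v h)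
    have "?e h \<le> 2 * ?e v + 2 * esq lborel (\<lambda>x. v x - h x)"
      using \<sigma> by (intro energy_le_limit adm h VL v m) auto
    also have "?e v = 0" using v by (simp add: null_space_def)
    also have "esq lborel (\<lambda>x. v x - h x) = ennreal (Q v)"
      unfolding Q_def esq_diff_commute[of _ v h] by (intro esq_L2 L2_diff VL v h)
    finally have "ennreal e0 \<le> ennreal (2 * Q v)" unfolding e0 by (simp add: ennreal_mult Q_def)
    then have "e0 \<le> 2 * Q v" by (subst (asm) ennreal_le_iff) (auto simp: Q_def)
    then show ?thesis by simp
  qed
  define I where "I = Inf (Q ` ?V)"
  have "(\<lambda>x. 0) \<in> L2" by (simp add: L2_iff)
  then have "(\<lambda>x. 0) \<in> ?V" using energy_cmult[OF \<phi> h(1) m, of 0] by (simp add: null_space_def)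
  then have ne: "Q ` ?V \<noteq> {}" by blast
  have bdd: "bdd_below (Q ` ?V)" by (rule bdd_belowI[of _ 0]) (auto simp: Q_def)
  have I: "I \<ge> e0 / 2" unfolding I_def using Q by (intro cInf_greatest[OF ne]) blast
  then have "I < 2 * I" using e0(2) by simp
  then obtain v where v: "v \<in> ?V" "Q v < 2 * I"
    using cInf_lessD[OF ne, of "2 * I"] by (auto simp: I_def)
  have Qv: "Q v > 0" using Q[OF v(1)] e0(2) by simp
  define c where "c = 1 / L2_norm (\<lambda>x. h x - v x)"
  have nv: "L2_norm (\<lambda>x. h x - v x) > 0" using Qv by (auto simp: Q_def less_le)
  have hv: "(\<lambda>x. h x - v x) \<in> L2" by (intro L2_diff h VL v)
  have c: "c > 0" "c\<^sup>2 * Q v = 1" using nv by (auto simp: c_def Q_def power_divide)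
  show ?thesis
  proof (rule that[OF v(1)])
    show "L2_norm (\<lambda>x. complex_of_real c * (h x - v x)) = 1"
      unfolding L2_norm_cmult[OF hv] norm_of_real using nv by (simp add: c_def)
    fix w assume w: "w \<in> ?V"
    \<comment> \<open>The scaled difference minus \<open>w\<close> is \<open>c\<close> times
      \<open>h - ?z\<close>, and \<open>?z\<close> is again in the null space. Hence the infimum
      \<open>I\<close>, which exceeds half of \<open>Q v\<close>, bounds it from below.\<close>
    let ?z = "\<lambda>x. v x + complex_of_real (1 / c) * w x"
    have z: "?z \<in> ?V" by (intro null_space_add \<phi> \<sigma> v w)
    have hz: "(\<lambda>x. h x - ?z x) \<in> L2" by (intro L2_diff h VL z)
    have "(\<lambda>x. complex_of_real c * (h x - v x) - w x) = (\<lambda>x. complex_of_real c * (h x - ?z x))"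
      using c by (auto simp: fun_eq_iff algebra_simps)
    then have "esq lborel (\<lambda>x. complex_of_real c * (h x - v x) - w x) = ennreal (c\<^sup>2) * ennreal (Q ?z)"
      using esq_cmult[of "\<lambda>x. h x - ?z x" lborel "complex_of_real c"] hz esq_L2[OF hz] by (simp add: Q_def L2_iff)
    also have "\<dots> = ennreal (c\<^sup>2 * Q ?z)" by (simp add: ennreal_mult Q_def)
    also have "\<dots> \<ge> ennreal (1 / 2)"
    proof (rule ennreal_leI)
      have "I \<le> Q ?z" unfolding I_def by (rule cInf_lower[OF _ bdd]) (use z in blast)
      then have "Q v \<le> 2 * Q ?z" using v(2) by simp
      then have "c\<^sup>2 * Q v \<le> c\<^sup>2 * (2 * Q ?z)" by (intro mult_left_mono) auto
      then show "1 / 2 \<le> c\<^sup>2 * Q ?z" using c by simp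
    qed
    finally show "esq lborel (\<lambda>x. complex_of_real c * (h x - v x) - w x) \<ge> ennreal (1 / 2)" .
  qed
qed

text \<open>If arbitrarily small translations left the null space \<open>V\<close>, the normalized components transversal to \<open>V\<close>
  would, by compactness, accumulate at a point of \<open>V\<close>.\<close>

lemma null_space_translation_invariant:
  fixes \<phi> :: "real ^ 'd \<Rightarrow> complex" and e :: "real ^ 'd"
  assumes A1: "\<phi> \<in> A1" and thin: "uniformly_thin \<phi> (\<lambda>_. \<sigma>)" and e: "norm e \<le> 1"
  obtains t where "t > 0" "\<And>f. f \<in> null_space \<phi> \<sigma> \<Longrightarrow> (\<lambda>x. f (x - t *\<^sub>R e)) \<in> null_space \<phi> \<sigma>"
proof (rule ccontr)
  assume "\<not> thesis"
  \<comment> \<open>With \<open>thesis\<close> refuted, every \<open>t > 0\<close> has an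
    \<open>f\<close> in the null space whose translate by \<open>t *\<^sub>R e\<close> leaves it;
    this is applied to the lengths \<open>1 / (n + 1)\<close>.\<close>
  note neg = this that
  have adm: "\<phi> \<in> admissible" by (rule A1_admissible[OF A1])
  have \<phi>: "\<phi> \<in> L2" by (rule admissible_L2[OF adm])
  have \<sigma>: "\<sigma> \<in> borel_measurable borel" "\<And>p. 0 \<le> \<sigma> p \<and> \<sigma> p \<le> 1"
    using thin unfolding uniformly_thin_def by blast+
  let ?V = "null_space \<phi> \<sigma>"
  define b where "b n = inverse (real (Suc n)) *\<^sub>R e" for n
  have "inverse (real (Suc n)) * norm e \<le> 1 * 1" for n using e by (intro mult_mono) (auto simp: inverse_le_1_iff)
  then have b1: "norm (b n) \<le> 1" for n by (simp add: b_def)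
  have b0: "b \<longlonglongrightarrow> 0"
    using tendsto_scaleR[OF LIMSEQ_inverse_real_of_nat tendsto_const[of e]] by (simp add: b_def[abs_def])
  let ?\<tau> = "\<lambda>n p. max (\<sigma> p) (\<sigma> (shift (b n) p))"
  have \<tau>m: "(\<lambda>p. 1 - ?\<tau> n p) \<in> borel_measurable borel" for n
    using \<sigma>(1) comp_shift_measurable[OF \<sigma>(1), of "b n"] by measurable
  have \<tau>01: "0 \<le> 1 - ?\<tau> n p \<and> 1 - ?\<tau> n p \<le> 1" for n p using \<sigma>(2)[of p] \<sigma>(2)[of "shift (b n) p"] by auto
  have m: "(\<lambda>p. 1 - \<sigma> p) \<in> borel_measurable borel" using \<sigma>(1) by measurable
  have "\<exists>u. u \<in> L2 \<and> L2_norm u = 1 \<and> energy \<phi> (\<lambda>p. 1 - ?\<tau> n p) u = 0 \<and>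
      (\<forall>w\<in>?V. esq lborel (\<lambda>x. u x - w x) \<ge> ennreal (1 / 2))" for n
  proof -
    have "inverse (real (Suc n)) > 0" by simp
    then obtain f where f: "f \<in> ?V" "(\<lambda>x. f (x - b n)) \<notin> ?V"
      using neg unfolding b_def by blast
    let ?h = "\<lambda>x. f (x - b n)"
    have fL: "f \<in> L2" using f(1) by (simp add: null_space_def)
    have h: "?h \<in> L2" by (rule translate_L2[OF fL])
    obtain v c where v: "v \<in> ?V" and one: "L2_norm (\<lambda>x. complex_of_real c * (?h x - v x)) = 1"
      and far: "\<And>w. w \<in> ?V \<Longrightarrow> esq lborel (\<lambda>x. complex_of_real c * (?h x - v x) - w x) \<ge> ennreal (1 / 2)"
      using null_space_Riesz_lemma[OF adm \<sigma> h f(2)] by blast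
    have vL: "v \<in> L2" using v by (simp add: null_space_def)
    have d: "(\<lambda>x. ?h x - v x) \<in> L2" by (rule L2_diff[OF h vL])
    \<comment> \<open>The translate carries no energy for the shifted symbol and \<open>v\<close>
      none for \<open>\<sigma>\<close>, so their difference carries none for the maximum: it lies in
      the null space of a slightly larger symbol.\<close>
    have "energy \<phi> (\<lambda>p. 1 - ?\<tau> n p) (\<lambda>x. ?h x - v x) \<le>
        2 * energy \<phi> (\<lambda>p. 1 - \<sigma> (shift (b n) p)) ?h + 2 * energy \<phi> (\<lambda>p. 1 - \<sigma> p) v"
      using \<tau>01[of _ n] comp_shift_measurable[OF m, of "b n"] by (intro energy_diff_le \<phi> h vL m) auto
    also have "energy \<phi> (\<lambda>p. 1 - \<sigma> (shift (b n) p)) ?h = 0"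
      using energy_translate[OF \<phi> fL m, of "b n"] f(1) by (simp add: null_space_def)
    also have "energy \<phi> (\<lambda>p. 1 - \<sigma> p) v = 0" using v by (simp add: null_space_def)
    finally have "energy \<phi> (\<lambda>p. 1 - ?\<tau> n p) (\<lambda>x. ?h x - v x) = 0" by simp
    then have "energy \<phi> (\<lambda>p. 1 - ?\<tau> n p) (\<lambda>x. complex_of_real c * (?h x - v x)) = 0"
      by (simp only: energy_cmult[OF \<phi> d \<tau>m] mult_zero_right)
    moreover have "(\<lambda>x. complex_of_real c * (?h x - v x)) \<in> L2" by (rule L2_cmult[OF d])
    ultimately show ?thesis using one far by blast
  qed
  then have "\<forall>n. \<exists>u. u \<in> L2 \<and> L2_norm u = 1 \<and> energy \<phi> (\<lambda>p. 1 - ?\<tau> n p) u = 0 \<and>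
      (\<forall>w\<in>?V. esq lborel (\<lambda>x. u x - w x) \<ge> ennreal (1 / 2))" by blast
  from choice[OF this] obtain u where u': "\<forall>n. u n \<in> L2 \<and> L2_norm (u n) = 1 \<and> energy \<phi> (\<lambda>p. 1 - ?\<tau> n p) (u n) = 0 \<and>
      (\<forall>w\<in>?V. esq lborel (\<lambda>x. u n x - w x) \<ge> ennreal (1 / 2))" by blast
  then have u: "u n \<in> L2" "L2_norm (u n) = 1" "energy \<phi> (\<lambda>p. 1 - ?\<tau> n p) (u n) = 0"
      "w \<in> ?V \<Longrightarrow> esq lborel (\<lambda>x. u n x - w x) \<ge> ennreal (1 / 2)" for n w
    by blast+
  have thin': "uniformly_thin \<phi> ?\<tau>" by (rule uniformly_thin_max_shift[OF \<phi> thin b1])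
  have u1: "L2_norm (u n) \<le> 1" for n by (simp add: u(2))
  have ulim: "(\<lambda>n. energy \<phi> (\<lambda>p. 1 - ?\<tau> n p) (u n)) \<longlonglongrightarrow> 0" by (simp add: u(3))
  obtain k g where k: "strict_mono (k :: nat \<Rightarrow> nat)" and g: "g \<in> L2" and conv: "(\<lambda>n. esq lborel (\<lambda>x. u (k n) x - g x)) \<longlonglongrightarrow> 0"
    using thin_compactness[OF A1 thin' u(1) u1 ulim] by blast
  have bk: "(\<lambda>n. b (k n)) \<longlonglongrightarrow> 0" using LIMSEQ_subseq_LIMSEQ[OF b0 k] by (simp add: comp_def)
  \<comment> \<open>Each \<open>u (k n)\<close> has zero energy for its own enlarged symbol, so the
    energy of the limit for that symbol is at most twice the squared distance. As the shifts tend to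
    0, this passes on to \<open>\<sigma>\<close>.\<close>
  have "energy \<phi> (\<lambda>p. 1 - \<sigma> p) g = 0"
  proof (rule energy_shift_limit[OF adm g \<sigma> bk])
    show "(\<lambda>n. energy \<phi> (\<lambda>p. 1 - max (\<sigma> p) (\<sigma> (shift (b (k n)) p))) g) \<longlonglongrightarrow> 0"
    proof (rule tendsto_sandwich[OF always_eventually always_eventually tendsto_const])
      show "\<forall>n. energy \<phi> (\<lambda>p. 1 - ?\<tau> (k n) p) g \<le> 2 * esq lborel (\<lambda>x. u (k n) x - g x)"
      proof
        fix n
        show "energy \<phi> (\<lambda>p. 1 - ?\<tau> (k n) p) g \<le> 2 * esq lborel (\<lambda>x. u (k n) x - g x)"
          using energy_le_limit[OF adm g u(1)[of "k n"] \<tau>m[of "k n"] \<tau>01[of _ "k n"]] by (simp only: u(3) mult_zero_right add_0_left)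
      qed
      have "(\<lambda>n. 2 * esq lborel (\<lambda>x. u (k n) x - g x)) \<longlonglongrightarrow> 2 * 0"
        by (rule ennreal_tendsto_cmult[OF _ conv]) simp
      then show "(\<lambda>n. 2 * esq lborel (\<lambda>x. u (k n) x - g x)) \<longlonglongrightarrow> 0" by simp
    qed simp
  qed
  then have "g \<in> ?V" using g by (simp add: null_space_def)
  \<comment> \<open>Every \<open>u n\<close> keeps its distance from the whole null space, in
    particular from \<open>g\<close>, to which a subsequence converges.\<close>
  then have "ennreal (1 / 2) \<le> 0"
    by (intro LIMSEQ_le_const[OF conv]) (use u(4) in blast)
  then show False by simp
qed

text \<open>Large translates of an element of the null space leave every box, where the energy estimate applies.\<close>

lemma null_space_escape:
  fixes \<phi> :: "real ^ 'd \<Rightarrow> complex"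
  assumes A1: "\<phi> \<in> A1" and thin: "uniformly_thin \<phi> (\<lambda>_. \<sigma>)" and b: "b \<noteq> 0"
    and inv: "\<And>f. f \<in> null_space \<phi> \<sigma> \<Longrightarrow> (\<lambda>x. f (x - b)) \<in> null_space \<phi> \<sigma>" and f: "f \<in> null_space \<phi> \<sigma>"
  shows "esq lborel f = 0"
proof -
  have adm: "\<phi> \<in> admissible" by (rule A1_admissible[OF A1])
  have \<phi>: "\<phi> \<in> L2" by (rule admissible_L2[OF adm])
  have \<sigma>: "\<sigma> \<in> borel_measurable borel" "\<And>p. 0 \<le> \<sigma> p \<and> \<sigma> p \<le> 1"
    using thin unfolding uniformly_thin_def by blast+
  let ?H = "haar :: (real \<times> (real ^ 'd)) measure"
  have fL: "f \<in> L2" using f by (simp add: null_space_def)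
  define g where "g n x = f (x - real n *\<^sub>R b)" for n x
  have gV: "g n \<in> null_space \<phi> \<sigma>" for n
  proof (induction n)
    case (Suc n)
    have "g (Suc n) = (\<lambda>x. g n (x - b))" by (simp add: g_def fun_eq_iff scaleR_left_distrib algebra_simps)
    then show ?case using inv[OF Suc] by simp
  qed (use f in \<open>simp add: g_def[abs_def]\<close>)
  have gL: "g n \<in> L2" for n using gV[of n] by (simp add: null_space_def)
  have gn: "esq lborel (g n) = esq lborel f" for n
    unfolding g_def[abs_def] using fL by (simp add: esq_L2 translate_L2 L2_norm_translate)
  \<comment> \<open>The Schur term has to absorb a fixed fraction below 1 of the norm; the box term
    will tend to 0.\<close>
  have half: "(1 / 2 :: real) > 0" by simp
  obtain \<delta> :: real where \<delta>: "\<delta> > 0" and est: "\<And>\<sigma> K f. \<sigma> \<in> borel_measurable borel \<Longrightarrow> (\<And>p. 0 \<le> \<sigma> p \<and> \<sigma> p \<le> 1) \<Longrightarrow> K \<in> sets borel \<Longrightarrow>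
      (\<And>q. q \<in> grp \<Longrightarrow> q \<notin> K \<Longrightarrow> berezin \<phi> \<sigma> q \<le> ennreal \<delta>) \<Longrightarrow> f \<in> L2 \<Longrightarrow>
      (\<integral>\<^sup>+p. ennreal (\<sigma> p * (cmod (wavelet_transform \<phi> f p))\<^sup>2) \<partial>haar) \<le>
        ennreal ((L2_norm \<phi>)\<^sup>2) * (\<integral>\<^sup>+p. indicator K p * ennreal (cmod (wavelet_transform \<phi> f p)) \<partial>haar)\<^sup>2 + ennreal (1 / 2) * esq lborel f"
    using thin_energy_estimate[OF A1 half] by blast
  obtain m where m: "\<And>q. q \<in> grp - grp_box m \<Longrightarrow> berezin \<phi> \<sigma> q \<le> ennreal \<delta>"
    using thin \<delta> unfolding uniformly_thin_def by blast
  let ?K = "grp_box m :: (real \<times> (real ^ 'd)) set"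
  let ?C = "\<integral>\<^sup>+p. indicator ?K p \<partial>?H"
  \<comment> \<open>The translation is undone: \<open>J n\<close> is the energy of the fixed
    transform of \<open>f\<close> in the box moved by the inverse of \<open>(1, n b)\<close>. Every
    point eventually leaves the moved box, so \<open>J n\<close> tends to 0 by dominated
    convergence.\<close>
  define J where "J n = (\<integral>\<^sup>+p. indicator ?K (grp_mult (1, real n *\<^sub>R b) p) * ennreal ((cmod (wavelet_transform \<phi> f p))\<^sup>2) \<partial>?H)" for n
  have Wm[measurable]: "wavelet_transform \<phi> f \<in> borel_measurable borel" by (rule wavelet_transform_measurable[OF \<phi> fL])
  have gm: "(\<lambda>p. indicator ?K (grp_mult (1, real n *\<^sub>R b) p) :: ennreal) \<in> borel_measurable borel" for n
    by (rule measurable_compose[of _ borel borel "indicator ?K"])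
       (auto intro: grp_mult_measurable[of "\<lambda>_. (1, real n *\<^sub>R b)" borel "\<lambda>p. p"])
  note [measurable] = gm
  have Jlim: "J \<longlonglongrightarrow> 0"
  proof -
    have "J \<longlonglongrightarrow> (\<integral>\<^sup>+p. 0 \<partial>?H)"
      unfolding J_def
    proof (rule nn_integral_dominated_convergence[where w = "\<lambda>p. ennreal ((cmod (wavelet_transform \<phi> f p))\<^sup>2)"])
      show "(\<lambda>p. indicator ?K (grp_mult (1, real n *\<^sub>R b) p) * ennreal ((cmod (wavelet_transform \<phi> f p))\<^sup>2)) \<in> borel_measurable ?H" for n
        by (rule borel_measurable_haar) measurable
      show "(\<lambda>p. ennreal ((cmod (wavelet_transform \<phi> f p))\<^sup>2)) \<in> borel_measurable ?H" by (rule borel_measurable_haar) measurable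
      show "(\<integral>\<^sup>+p. ennreal ((cmod (wavelet_transform \<phi> f p))\<^sup>2) \<partial>?H) < \<infinity>"
        using wavelet_isometry[OF adm fL] L2_esq[OF fL] by (simp add: esq_def)
      show "AE p in ?H. indicator ?K (grp_mult (1, real n *\<^sub>R b) p) * ennreal ((cmod (wavelet_transform \<phi> f p))\<^sup>2) \<le> ennreal ((cmod (wavelet_transform \<phi> f p))\<^sup>2)" for n
        by (intro AE_I2) (auto split: split_indicator)
      show "AE p in ?H. (\<lambda>n. indicator ?K (grp_mult (1, real n *\<^sub>R b) p) * ennreal ((cmod (wavelet_transform \<phi> f p))\<^sup>2)) \<longlonglongrightarrow> 0"
      proof (rule AE_I2, rule tendsto_eventually)
        fix p assume "p \<in> space ?H"
        then have a: "fst p > 0" by (simp add: grp_iff)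
        \<comment> \<open>From this index on the displacement \<open>n * norm b / fst p\<close>
          exceeds \<open>m\<close> plus the norm of \<open>snd p\<close>, which excludes the
          box.\<close>
        obtain N :: nat where N: "fst p * (real m + norm (snd p)) / norm b < real N"
          using reals_Archimedean2 by blast
        show "\<forall>\<^sub>F n in sequentially. indicator ?K (grp_mult (1, real n *\<^sub>R b) p) * ennreal ((cmod (wavelet_transform \<phi> f p))\<^sup>2) = 0"
          using eventually_ge_at_top[of N]
        proof eventually_elim
          fix n assume "N \<le> n"
          then have "fst p * (real m + norm (snd p)) / norm b < real n" using N by simp
          then have "real m + norm (snd p) < norm (inverse (fst p) *\<^sub>R (real n *\<^sub>R b))"
            using a b by (simp add: field_simps)
          also have "\<dots> \<le> norm (inverse (fst p) *\<^sub>R (real n *\<^sub>R b) + snd p) + norm (snd p)"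
            using norm_triangle_ineq4[of "inverse (fst p) *\<^sub>R (real n *\<^sub>R b) + snd p" "snd p"] by simp
          finally have "grp_mult (1, real n *\<^sub>R b) p \<notin> ?K"
            unfolding grp_mult_eq grp_box_def by auto
          then show "indicator ?K (grp_mult (1, real n *\<^sub>R b) p) * ennreal ((cmod (wavelet_transform \<phi> f p))\<^sup>2) = 0"
            by simp
        qed
      qed
    qed simp
    then show ?thesis by simp
  qed
  \<comment> \<open>Cauchy-Schwarz on the box, whose Haar measure \<open>?C\<close> is finite, leads
    from the L1 integral of the energy estimate to \<open>J n\<close>.\<close>
  have box: "(\<integral>\<^sup>+p. indicator ?K p * ennreal (cmod (wavelet_transform \<phi> (g n) p)) \<partial>?H)\<^sup>2 \<le> ?C * J n" for n
  proof -
    have [measurable]: "wavelet_transform \<phi> (g n) \<in> borel_measurable borel" by (rule wavelet_transform_measurable[OF \<phi> gL])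
    let ?G = "\<lambda>p. indicator ?K p * ennreal (cmod (wavelet_transform \<phi> (g n) p))"
    have "(\<integral>\<^sup>+p. indicator ?K p * ?G p \<partial>?H)\<^sup>2 \<le> (\<integral>\<^sup>+p. (indicator ?K p)\<^sup>2 \<partial>?H) * (\<integral>\<^sup>+p. (?G p)\<^sup>2 \<partial>?H)"
      by (rule Cauchy_Schwarz_nn_integral) (rule borel_measurable_haar, measurable)+
    also have "(\<integral>\<^sup>+p. (indicator ?K p)\<^sup>2 \<partial>?H) = ?C"
      by (intro nn_integral_cong) (auto split: split_indicator)
    also have "(\<integral>\<^sup>+p. (?G p)\<^sup>2 \<partial>?H) = J n"
    proof -
      let ?F = "\<lambda>p. indicator ?K (grp_mult (1, real n *\<^sub>R b) p) * ennreal ((cmod (wavelet_transform \<phi> f p))\<^sup>2)"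
      have "(\<integral>\<^sup>+p. (?G p)\<^sup>2 \<partial>?H) = (\<integral>\<^sup>+p. ?F (shift (real n *\<^sub>R b) p) \<partial>?H)"
      proof (intro nn_integral_cong)
        fix p assume "p \<in> space ?H"
        then have "wavelet_transform \<phi> (g n) p = wavelet_transform \<phi> f (shift (real n *\<^sub>R b) p)"
          unfolding g_def[abs_def] by (intro wavelet_transform_translate \<phi> fL) simp
        then show "(?G p)\<^sup>2 = ?F (shift (real n *\<^sub>R b) p)"
          by (simp add: shift_cancel power_mult_distrib ennreal_power split: split_indicator)
      qed
      also have "\<dots> = J n" unfolding J_def by (rule nn_integral_haar_shift) measurable
      finally show ?thesis .
    qed
    also have "(\<integral>\<^sup>+p. indicator ?K p * ?G p \<partial>?H) = (\<integral>\<^sup>+p. ?G p \<partial>?H)"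
      by (intro nn_integral_cong) (auto split: split_indicator)
    finally show ?thesis .
  qed
  have le: "esq lborel f \<le> ennreal ((L2_norm \<phi>)\<^sup>2) * (?C * J n) + ennreal (1 / 2) * esq lborel f" for n
  proof -
    have "esq lborel f = energy \<phi> \<sigma> (g n) + energy \<phi> (\<lambda>p. 1 - \<sigma> p) (g n)"
      unfolding gn[symmetric, of n] using \<sigma> by (intro energy_complement adm gL) auto
    also have "energy \<phi> (\<lambda>p. 1 - \<sigma> p) (g n) = 0" using gV[of n] by (simp add: null_space_def)
    also have "energy \<phi> \<sigma> (g n) \<le> ennreal ((L2_norm \<phi>)\<^sup>2) * (\<integral>\<^sup>+p. indicator ?K p * ennreal (cmod (wavelet_transform \<phi> (g n) p)) \<partial>?H)\<^sup>2 + ennreal (1 / 2) * esq lborel (g n)"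
      unfolding energy_def by (rule est[OF \<sigma> grp_box_borel _ gL]) (use m in blast)
    also have "\<dots> \<le> ennreal ((L2_norm \<phi>)\<^sup>2) * (?C * J n) + ennreal (1 / 2) * esq lborel f"
      unfolding gn by (intro add_mono mult_left_mono box order_refl) simp
    finally show ?thesis by simp
  qed
  have "(\<lambda>n. ennreal ((L2_norm \<phi>)\<^sup>2) * (?C * J n) + ennreal (1 / 2) * esq lborel f) \<longlonglongrightarrow>
      ennreal ((L2_norm \<phi>)\<^sup>2) * (?C * 0) + ennreal (1 / 2) * esq lborel f"
    using emeasure_haar_box[of m, where 'd = 'd] by (intro tendsto_add ennreal_tendsto_cmult tendsto_const Jlim) auto
  then have "esq lborel f \<le> ennreal ((L2_norm \<phi>)\<^sup>2) * (?C * 0) + ennreal (1 / 2) * esq lborel f"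
    by (rule LIMSEQ_le_const) (use le in blast)
  then have "ennreal ((L2_norm f)\<^sup>2) \<le> ennreal (1 / 2 * (L2_norm f)\<^sup>2)"
    unfolding esq_L2[OF fL] by (subst ennreal_mult) auto
  then have "(L2_norm f)\<^sup>2 \<le> 1 / 2 * (L2_norm f)\<^sup>2" by (subst (asm) ennreal_le_iff) auto
  then have "(L2_norm f)\<^sup>2 = 0" using zero_le_power2[of "L2_norm f"] by linarith
  then show ?thesis unfolding esq_L2[OF fL] by simp
qed

theorem null_space_trivial:
  fixes \<phi> :: "real ^ 'd \<Rightarrow> complex"
  assumes A1: "\<phi> \<in> A1" and thin: "uniformly_thin \<phi> (\<lambda>_. \<sigma>)" and f: "f \<in> null_space \<phi> \<sigma>"
  shows "esq lborel f = 0"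
proof -
  obtain e :: "real ^ 'd" where e: "norm e = 1" using vector_choose_size[of 1] by auto
  obtain t where t: "t > 0" "\<And>f. f \<in> null_space \<phi> \<sigma> \<Longrightarrow> (\<lambda>x. f (x - t *\<^sub>R e)) \<in> null_space \<phi> \<sigma>"
    using null_space_translation_invariant[OF A1 thin, of e] e by auto
  have "t *\<^sub>R e \<noteq> 0" using t(1) e by auto
  then show ?thesis by (rule null_space_escape[OF A1 thin _ t(2) f])
qed

text \<open>If no constant worked, there would be unit vectors with energy tending to 0. By
  compactness a subsequence converges, and its limit lies in the null space, hence has norm 0,
  against the norm 1 of the sequence.\<close>

theorem energy_coercive:
  fixes \<phi> :: "real ^ 'd \<Rightarrow> complex"
  assumes A1: "\<phi> \<in> A1" and thin: "uniformly_thin \<phi> (\<lambda>_. \<sigma>)"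
  shows "\<exists>c>0. \<forall>f\<in>L2. ennreal (c * (L2_norm f)\<^sup>2) \<le> energy \<phi> (\<lambda>p. 1 - \<sigma> p) f"
proof (rule ccontr)
  assume neg: "\<not> ?thesis"
  have adm: "\<phi> \<in> admissible" by (rule A1_admissible[OF A1])
  have \<phi>: "\<phi> \<in> L2" by (rule admissible_L2[OF adm])
  have \<sigma>: "\<sigma> \<in> borel_measurable borel" "\<And>p. 0 \<le> \<sigma> p \<and> \<sigma> p \<le> 1"
    using thin unfolding uniformly_thin_def by blast+
  have m: "(\<lambda>p. 1 - \<sigma> p) \<in> borel_measurable borel" using \<sigma>(1) by measurable
  let ?e = "energy \<phi> (\<lambda>p. 1 - \<sigma> p)"
  have "\<exists>g. g \<in> L2 \<and> L2_norm g = 1 \<and> ?e g \<le> ennreal (inverse (real (Suc n)))" for n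
  proof -
    let ?c = "inverse (real (Suc n))"
    have "?c > 0" by simp
    then obtain f where f: "f \<in> L2" "?e f < ennreal (?c * (L2_norm f)\<^sup>2)" using neg by (meson not_le)
    have nz: "L2_norm f > 0"
    proof (rule ccontr)
      assume "\<not> L2_norm f > 0"
      then have "L2_norm f = 0" using L2_norm_nonneg[of f] by linarith
      with f(2) show False by simp
    qed
    let ?k = "complex_of_real (1 / L2_norm f)"
    have "?e (\<lambda>x. ?k * f x) = ennreal ((1 / L2_norm f)\<^sup>2) * ?e f"
      unfolding energy_cmult[OF \<phi> f(1) m] norm_of_real power2_abs ..
    also have "\<dots> \<le> ennreal ((1 / L2_norm f)\<^sup>2) * ennreal (?c * (L2_norm f)\<^sup>2)"
      using f(2) by (intro mult_left_mono) auto
    also have "\<dots> = ennreal ((1 / L2_norm f)\<^sup>2 * (?c * (L2_norm f)\<^sup>2))"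
      by (rule ennreal_mult[symmetric]) auto
    also have "(1 / L2_norm f)\<^sup>2 * (?c * (L2_norm f)\<^sup>2) = ?c"
      using nz by (simp add: power_divide)
    finally have "?e (\<lambda>x. ?k * f x) \<le> ennreal ?c" .
    moreover have "L2_norm (\<lambda>x. ?k * f x) = 1" using nz by (subst L2_norm_cmult[OF f(1)]) (simp add: norm_divide)
    ultimately show ?thesis using L2_cmult[OF f(1)] by blast
  qed
  then have "\<forall>n. \<exists>g. g \<in> L2 \<and> L2_norm g = 1 \<and> ?e g \<le> ennreal (inverse (real (Suc n)))" by blast
  from choice[OF this] obtain g where "\<forall>n. g n \<in> L2 \<and> L2_norm (g n) = 1 \<and> ?e (g n) \<le> ennreal (inverse (real (Suc n)))" by blast
  then have g: "g n \<in> L2" "L2_norm (g n) = 1" "?e (g n) \<le> ennreal (inverse (real (Suc n)))" for n by blast+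
  have glim: "(\<lambda>n. ?e (g n)) \<longlonglongrightarrow> 0"
  proof (rule tendsto_sandwich[OF always_eventually always_eventually tendsto_const])
    show "(\<lambda>n. ennreal (inverse (real (Suc n)))) \<longlonglongrightarrow> 0"
      using tendsto_ennrealI[OF LIMSEQ_inverse_real_of_nat] by simp
  qed (use g(3) in auto)
  have g1: "L2_norm (g n) \<le> 1" for n by (simp add: g(2))
  obtain k u where k: "strict_mono (k :: nat \<Rightarrow> nat)" and u: "u \<in> L2" and conv: "(\<lambda>n. esq lborel (\<lambda>x. g (k n) x - u x)) \<longlonglongrightarrow> 0"
    using thin_compactness[OF A1 thin g(1) g1 glim] by blast
  have "(\<lambda>n. 2 * ?e (g (k n)) + 2 * esq lborel (\<lambda>x. g (k n) x - u x)) \<longlonglongrightarrow> 2 * 0 + 2 * 0"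
    using LIMSEQ_subseq_LIMSEQ[OF glim k] by (intro tendsto_add ennreal_tendsto_cmult conv) (auto simp: comp_def)
  then have "?e u \<le> 2 * 0 + 2 * 0"
  proof (rule LIMSEQ_le_const)
    show "\<exists>N. \<forall>n\<ge>N. ?e u \<le> 2 * ?e (g (k n)) + 2 * esq lborel (\<lambda>x. g (k n) x - u x)"
      using \<sigma> by (auto intro!: energy_le_limit adm u g m)
  qed
  then have "u \<in> null_space \<phi> \<sigma>" using u by (simp add: null_space_def)
  then have u0: "esq lborel u = 0" by (rule null_space_trivial[OF A1 thin])
  \<comment> \<open>As \<open>u\<close> has norm 0, the norm 1 of \<open>g (k n)\<close> must come
    from the distance to \<open>u\<close> alone.\<close>
  have "1 \<le> 2 * esq lborel (\<lambda>x. g (k n) x - u x)" for n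
  proof -
    have "esq lborel (\<lambda>x. (g (k n) x - u x) + u x) \<le> 2 * esq lborel (\<lambda>x. g (k n) x - u x) + 2 * esq lborel u"
      using g(1)[of "k n"] u by (intro esq_add_le2) (auto simp: L2_iff)
    then show ?thesis using esq_L2[OF g(1)[of "k n"]] by (simp add: u0 g(2))
  qed
  moreover have "(\<lambda>n. 2 * esq lborel (\<lambda>x. g (k n) x - u x)) \<longlonglongrightarrow> 2 * 0"
    by (rule ennreal_tendsto_cmult[OF _ conv]) simp
  ultimately have "(1 :: ennreal) \<le> 2 * 0" by (intro LIMSEQ_le_const) auto
  then show False by simp
qed

section \<open>The Riesz representation theorem on \<open>L2\<close>\<close>

lemma L2_norm_add_sq:
  assumes u: "u \<in> L2" and v: "v \<in> L2"
  shows "(L2_norm (\<lambda>x. u x + c * v x))\<^sup>2 = (L2_norm u)\<^sup>2 + 2 * Re (cnj c * L2_inner u v) + (cmod c)\<^sup>2 * (L2_norm v)\<^sup>2"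
proof -
  let ?s = "\<lambda>x. u x + c * v x"
  have "L2_inner ?s ?s = L2_inner u u + cnj c * L2_inner u v + c * cnj (L2_inner u v) + c * cnj c * L2_inner v v"
    using u v by (simp add: L2_inner_add_left L2_inner_add_right L2_add L2_cmult L2_inner_cmult_left L2_inner_cmult_right
        L2_inner_commute[of v u] algebra_simps)
  then have "Re (L2_inner ?s ?s) = Re (L2_inner u u + cnj c * L2_inner u v + c * cnj (L2_inner u v) + c * cnj c * L2_inner v v)"
    by (rule arg_cong)
  moreover have "c * cnj c = complex_of_real ((cmod c)\<^sup>2)" by (rule complex_norm_square[symmetric])
  moreover have "Re (c * cnj (L2_inner u v)) = Re (cnj c * L2_inner u v)" by simp
  ultimately show ?thesis unfolding L2_inner_self
    by (simp only: plus_complex.sel Re_complex_of_real of_real_mult[symmetric])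
qed

text \<open>Variational proof: minimize \<open>J u\<close>, the squared norm minus twice the real
  part of \<open>l u\<close>. The parallelogram law makes minimizing sequences Cauchy, and varying
  the minimizer in direction \<open>u\<close> gives the representation. The functional is conjugate
  linear because \<open>L2_inner h\<close> is.\<close>

theorem L2_Riesz_representation:
  fixes l :: "(real ^ 'd \<Rightarrow> complex) \<Rightarrow> complex"
  assumes add: "\<And>u v. u \<in> L2 \<Longrightarrow> v \<in> L2 \<Longrightarrow> l (\<lambda>x. u x + v x) = l u + l v"
    and cmult: "\<And>u c. u \<in> L2 \<Longrightarrow> l (\<lambda>x. c * u x) = cnj c * l u"
    and bd: "\<And>u. u \<in> L2 \<Longrightarrow> cmod (l u) \<le> C * L2_norm u"
  obtains h where "h \<in> L2" "\<And>g. g \<in> L2 \<Longrightarrow> L2_inner h g = l g"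
proof -
  define J where "J u = (L2_norm u)\<^sup>2 - 2 * Re (l u)" for u
  define j where "j = Inf (J ` (L2 :: (real ^ 'd \<Rightarrow> complex) set))"
  have Jlow: "J u \<ge> - C\<^sup>2" if u: "u \<in> L2" for u
  proof -
    have "Re (l u) \<le> C * L2_norm u" using complex_Re_le_cmod[of "l u"] bd[OF u] by linarith
    moreover have "(L2_norm u)\<^sup>2 - 2 * (C * L2_norm u) = (L2_norm u - C)\<^sup>2 - C\<^sup>2"
      by (simp add: power2_eq_square algebra_simps)
    ultimately show ?thesis using zero_le_power2[of "L2_norm u - C"] unfolding J_def by linarith
  qed
  then have bdd: "bdd_below (J ` (L2 :: (real ^ 'd \<Rightarrow> complex) set))" by (intro bdd_belowI[of _ "- C\<^sup>2"]) blast
  have jle: "j \<le> J u" if "u \<in> L2" for u unfolding j_def using that by (intro cInf_lower bdd) blast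
  have "(\<lambda>x. 0) \<in> (L2 :: (real ^ 'd \<Rightarrow> complex) set)" by (simp add: L2_iff)
  then have ne: "J ` (L2 :: (real ^ 'd \<Rightarrow> complex) set) \<noteq> {}" by blast
  have "\<exists>u\<in>L2. J u < j + inverse (real (Suc n))" for n
  proof -
    have "j < j + inverse (real (Suc n))" by simp
    then show ?thesis using cInf_lessD[OF ne, of "j + inverse (real (Suc n))"] unfolding j_def by blast
  qed
  then have "\<forall>n. \<exists>u. u \<in> L2 \<and> J u < j + inverse (real (Suc n))" by blast
  from choice[OF this] obtain g where "\<forall>n. g n \<in> L2 \<and> J (g n) < j + inverse (real (Suc n))" by blast
  then have g: "g n \<in> L2" "J (g n) < j + inverse (real (Suc n))" for n by blast+
  \<comment> \<open>Parallelogram law with the midpoint \<open>?m\<close>: the linear parts cancel,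
    so \<open>|u - v|^2 = 2 * J u + 2 * J v - 4 * J ?m\<close>, and \<open>J ?m\<close> is at least
    \<open>j\<close>.\<close>
  have par: "(L2_norm (\<lambda>x. u x - v x))\<^sup>2 \<le> 2 * (J u - j) + 2 * (J v - j)" if u: "u \<in> L2" and v: "v \<in> L2" for u v
  proof -
    let ?m = "\<lambda>x. (1 / 2) * (u x + 1 * v x)"
    have uv: "(\<lambda>x. u x + 1 * v x) \<in> L2" using L2_add[OF u v] by simp
    have m: "?m \<in> L2" by (rule L2_cmult[OF uv])
    have "L2_norm ?m = 1 / 2 * L2_norm (\<lambda>x. u x + 1 * v x)" using L2_norm_cmult[OF uv, of "1 / 2"] by simp
    then have "(L2_norm ?m)\<^sup>2 = (1 / 2 * L2_norm (\<lambda>x. u x + 1 * v x))\<^sup>2" by (rule arg_cong)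
    also have "\<dots> = 1 / 4 * (L2_norm (\<lambda>x. u x + 1 * v x))\<^sup>2"
      by (simp only: power_mult_distrib) (simp add: power_divide)
    also have "(L2_norm (\<lambda>x. u x + 1 * v x))\<^sup>2 = (L2_norm u)\<^sup>2 + 2 * Re (L2_inner u v) + (L2_norm v)\<^sup>2"
      using L2_norm_add_sq[OF u v, of 1] by simp
    finally have nm: "4 * (L2_norm ?m)\<^sup>2 = (L2_norm u)\<^sup>2 + 2 * Re (L2_inner u v) + (L2_norm v)\<^sup>2" by simp
    have "l ?m = (1 / 2) * (l u + l v)" using cmult[OF uv, of "1 / 2"] add[OF u v] by simp
    moreover have "Re ((1 / 2) * z) = Re z / 2" for z by simp
    ultimately have "Re (l ?m) = (Re (l u) + Re (l v)) / 2" by (simp only: plus_complex.sel)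
    then have lm: "4 * Re (l ?m) = 2 * (Re (l u) + Re (l v))" by linarith
    have "(L2_norm (\<lambda>x. u x - v x))\<^sup>2 = (L2_norm u)\<^sup>2 - 2 * Re (L2_inner u v) + (L2_norm v)\<^sup>2"
      using L2_norm_add_sq[OF u v, of "-1"] by simp
    also have "\<dots> = 2 * J u + 2 * J v - 4 * J ?m"
      using nm lm unfolding J_def by (simp add: algebra_simps)
    finally show ?thesis using jle[OF m] by simp
  qed
  have inv_small: "\<exists>N. \<forall>n\<ge>N. inverse (real (Suc n)) < e" if "e > 0" for e :: real
    using order_tendstoD(2)[OF LIMSEQ_inverse_real_of_nat that] by (simp add: eventually_sequentially)
  have cauchy: "\<exists>N. \<forall>m\<ge>N. \<forall>n\<ge>N. esq lborel (\<lambda>x. g m x - g n x) \<le> ennreal \<epsilon>" if e: "\<epsilon> > 0" for \<epsilon> :: real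
  proof -
    have "\<epsilon> / 4 > 0" using e by simp
    then obtain N where N: "\<And>n. n \<ge> N \<Longrightarrow> inverse (real (Suc n)) < \<epsilon> / 4" using inv_small by blast
    have JN: "J (g k) < j + \<epsilon> / 4" if "k \<ge> N" for k
      by (rule less_trans[OF g(2)[of k] add_strict_left_mono[OF N[OF that]]])
    show ?thesis
    proof (rule exI[of _ N], intro allI impI)
      fix m n assume mn: "N \<le> m" "N \<le> n"
      have "(L2_norm (\<lambda>x. g m x - g n x))\<^sup>2 \<le> 2 * (J (g m) - j) + 2 * (J (g n) - j)"
        by (rule par[OF g(1) g(1)])
      also have "\<dots> \<le> 2 * (\<epsilon> / 4) + 2 * (\<epsilon> / 4)"
        using JN[OF mn(1)] JN[OF mn(2)] by (intro add_mono mult_left_mono) auto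
      finally have "(L2_norm (\<lambda>x. g m x - g n x))\<^sup>2 \<le> \<epsilon>" by simp
      then show "esq lborel (\<lambda>x. g m x - g n x) \<le> ennreal \<epsilon>"
        unfolding esq_L2[OF L2_diff[OF g(1) g(1)]] by (rule ennreal_leI)
    qed
  qed
  obtain h where h: "h \<in> L2" and lim: "(\<lambda>n. esq lborel (\<lambda>x. g n x - h x)) \<longlonglongrightarrow> 0"
    using L2_complete[OF g(1) cauchy] by blast
  have nlim: "(\<lambda>n. L2_norm (\<lambda>x. g n x - h x)) \<longlonglongrightarrow> 0"
    using nrm_diff_tendsto_0[OF lim] by (simp add: L2_norm_eq_nrm[OF L2_diff[OF g(1) h]])
  have Nlim: "(\<lambda>n. L2_norm (g n)) \<longlonglongrightarrow> L2_norm h"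
  proof -
    have "(\<lambda>n. L2_norm (g n) - L2_norm h) \<longlonglongrightarrow> 0"
    proof (rule Lim_null_comparison[OF _ nlim], rule always_eventually, rule allI)
      fix n
      show "norm (L2_norm (g n) - L2_norm h) \<le> L2_norm (\<lambda>x. g n x - h x)"
        using nrm_diff_triangle[of "g n" lborel h] g(1)[of n] h L2_esq[OF g(1)[of n]] L2_esq[OF h]
        by (simp add: L2_norm_eq_nrm[OF L2_diff[OF g(1) h]] L2_norm_eq_nrm[OF g(1)] L2_norm_eq_nrm[OF h] L2_measurable)
    qed
    then show ?thesis by (simp add: LIM_zero_iff)
  qed
  have llim: "(\<lambda>n. l (g n)) \<longlonglongrightarrow> l h"
  proof -
    have "(\<lambda>n. l (g n) - l h) \<longlonglongrightarrow> 0"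
    proof (rule Lim_null_comparison)
      show "(\<lambda>n. C * L2_norm (\<lambda>x. g n x - h x)) \<longlonglongrightarrow> 0" by (rule tendsto_mult_right_zero[OF nlim])
      show "\<forall>\<^sub>F n in sequentially. norm (l (g n) - l h) \<le> C * L2_norm (\<lambda>x. g n x - h x)"
      proof (rule always_eventually, rule allI)
        fix n
        have "l (\<lambda>x. g n x - h x) = l (g n) - l h"
          using add[OF g(1) L2_cmult[OF h, of "-1"], of n] cmult[OF h, of "-1"] by simp
        then show "norm (l (g n) - l h) \<le> C * L2_norm (\<lambda>x. g n x - h x)"
          using bd[OF L2_diff[OF g(1) h], of n] by simp
      qed
    qed
    then show ?thesis by (simp add: LIM_zero_iff)
  qed
  have "(\<lambda>n. J (g n)) \<longlonglongrightarrow> J h"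
    unfolding J_def by (intro tendsto_diff tendsto_power tendsto_mult tendsto_const tendsto_Re Nlim llim)
  moreover have "(\<lambda>n. j + inverse (real (Suc n))) \<longlonglongrightarrow> j + 0"
    by (intro tendsto_add tendsto_const LIMSEQ_inverse_real_of_nat)
  ultimately have "J h \<le> j + 0"
    by (rule LIMSEQ_le) (use g(2) less_imp_le in blast)
  then have Jh: "J h \<le> j" by simp
  have "L2_inner h u = l u" if u: "u \<in> L2" for u
  proof -
    define z where "z = L2_inner h u - l u"
    \<comment> \<open>Step length for the competitor \<open>h - s * z * u\<close>: the linear term
      contributes \<open>- 2 * s * |z|^2\<close>, and this \<open>s\<close> keeps the quadratic term
      at most \<open>s * |z|^2\<close>. The summand 1 avoids a zero denominator.\<close>
    define s where "s = 1 / ((L2_norm u)\<^sup>2 + 1)"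
    let ?N = "(L2_norm u)\<^sup>2"
    have N: "?N + 1 > 0" using zero_le_power2[of "L2_norm u"] by linarith
    have s: "s > 0" "s * ?N \<le> 1" using N by (auto simp: s_def divide_le_eq_1)
    define c where "c = complex_of_real (- s) * z"
    have cu: "(\<lambda>x. c * u x) \<in> L2" by (rule L2_cmult[OF u])
    have "J h \<le> J (\<lambda>x. h x + c * u x)" using Jh jle[OF L2_add[OF h cu]] by linarith
    also have "\<dots> = J h + 2 * Re (cnj c * z) + (cmod c)\<^sup>2 * ?N"
      unfolding J_def L2_norm_add_sq[OF h u] add[OF h cu] cmult[OF u] z_def by (simp add: algebra_simps)
    finally have "0 \<le> 2 * Re (cnj c * z) + (cmod c)\<^sup>2 * ?N" by simp
    also have "cnj c * z = complex_of_real (- s) * (z * cnj z)" by (simp add: c_def)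
    also have "\<dots> = complex_of_real (- s * (cmod z)\<^sup>2)" unfolding complex_norm_square[symmetric] by simp
    also have "cmod c = s * cmod z" using s by (simp add: c_def norm_mult)
    finally have "0 \<le> - 2 * s * (cmod z)\<^sup>2 + (s * ?N) * s * (cmod z)\<^sup>2"
      by (simp add: power_mult_distrib power2_eq_square algebra_simps)
    also have "(s * ?N) * s * (cmod z)\<^sup>2 \<le> 1 * s * (cmod z)\<^sup>2" using s by (intro mult_right_mono) auto
    finally have "s * (cmod z)\<^sup>2 \<le> 0" by simp
    then have "z = 0" using s by (simp add: mult_le_0_iff)
    then show ?thesis by (simp add: z_def)
  qed
  with h show ?thesis by (rule that)
qed

section \<open>Localization operators and the main theorem\<close>

lemma localization_integrable:
  fixes \<phi> f g :: "real ^ 'd \<Rightarrow> complex"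
  assumes adm: "\<phi> \<in> admissible" and f: "f \<in> L2" and g: "g \<in> L2"
    and \<rho>: "\<rho> \<in> borel_measurable haar" "\<And>p. p \<in> grp \<Longrightarrow> 0 \<le> \<rho> p \<and> \<rho> p \<le> 1"
  shows "integrable haar (\<lambda>p. complex_of_real (\<rho> p) * wavelet_transform \<phi> f p * cnj (wavelet_transform \<phi> g p))"
proof (rule Bochner_Integration.integrable_bound[OF wavelet_parseval(1)[OF adm f g]])
  have \<phi>: "\<phi> \<in> L2" by (rule admissible_L2[OF adm])
  note [measurable] = \<rho>(1) borel_measurable_haar[OF wavelet_transform_measurable[OF \<phi> f]]
    borel_measurable_haar[OF wavelet_transform_measurable[OF \<phi> g]]
  show "(\<lambda>p. complex_of_real (\<rho> p) * wavelet_transform \<phi> f p * cnj (wavelet_transform \<phi> g p)) \<in> borel_measurable haar"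
    by measurable
  show "AE p in haar. norm (complex_of_real (\<rho> p) * wavelet_transform \<phi> f p * cnj (wavelet_transform \<phi> g p)) \<le>
      norm (wavelet_transform \<phi> f p * cnj (wavelet_transform \<phi> g p))"
  proof (rule AE_I2)
    fix p :: "real \<times> (real ^ 'd)" assume "p \<in> space haar"
    then have "\<bar>\<rho> p\<bar> \<le> 1" using \<rho>(2)[of p] by auto
    then have "\<bar>\<rho> p\<bar> * (cmod (wavelet_transform \<phi> f p) * cmod (wavelet_transform \<phi> g p)) \<le> 1 * (cmod (wavelet_transform \<phi> f p) * cmod (wavelet_transform \<phi> g p))"
      by (intro mult_right_mono) auto
    then show "norm (complex_of_real (\<rho> p) * wavelet_transform \<phi> f p * cnj (wavelet_transform \<phi> g p)) \<le>
      norm (wavelet_transform \<phi> f p * cnj (wavelet_transform \<phi> g p))"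
      by (simp add: norm_mult mult.assoc)
  qed
qed

text \<open>The operator is introduced by \<open>SOME\<close>, so its defining property rests on
  existence. The weak integral is a conjugate linear functional of \<open>g\<close>, bounded by
  Cauchy-Schwarz on the group and the isometry, and Riesz representation supplies the
  element.\<close>

theorem localization_exists:
  fixes \<phi> f :: "real ^ 'd \<Rightarrow> complex"
  assumes adm: "\<phi> \<in> admissible" and f: "f \<in> L2"
    and \<rho>: "\<rho> \<in> borel_measurable haar" "\<And>p. p \<in> grp \<Longrightarrow> 0 \<le> \<rho> p \<and> \<rho> p \<le> 1"
  shows "\<exists>h. is_localization \<phi> \<rho> f h"
proof -
  have \<phi>: "\<phi> \<in> L2" by (rule admissible_L2[OF adm])
  let ?W = "wavelet_transform \<phi>"
  define F where "F g p = complex_of_real (\<rho> p) * ?W f p * cnj (?W g p)" for g p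
  define l where "l g = (LINT p|haar. F g p)" for g
  have int: "integrable haar (F g)" if "g \<in> L2" for g
    unfolding F_def[abs_def] by (intro localization_integrable adm f that \<rho>)
  have "l (\<lambda>x. u x + v x) = l u + l v" if u: "u \<in> L2" and v: "v \<in> L2" for u v
  proof -
    have "l (\<lambda>x. u x + v x) = (LINT p|haar. F u p + F v p)"
      unfolding l_def F_def
      by (intro Bochner_Integration.integral_cong) (auto simp: wavelet_transform_add[OF \<phi> u v] grp_iff algebra_simps)
    then show ?thesis unfolding l_def using int[OF u] int[OF v] by simp
  qed
  moreover have "l (\<lambda>x. c * u x) = cnj c * l u" if u: "u \<in> L2" for u c
    unfolding l_def F_def by (simp add: wavelet_transform_cmult mult.left_commute)
  moreover have "cmod (l u) \<le> L2_norm f * L2_norm u" if u: "u \<in> L2" for u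
  proof -
    have m: "?W g \<in> borel_measurable haar" if "g \<in> L2" for g
      by (rule borel_measurable_haar[OF wavelet_transform_measurable[OF \<phi> that]])
    have "ennreal (cmod (l u)) \<le> (\<integral>\<^sup>+p. ennreal (norm (F u p)) \<partial>haar)"
      unfolding l_def by (rule integral_norm_bound_ennreal[OF int[OF u]])
    also have "\<dots> \<le> (\<integral>\<^sup>+p. ennreal (cmod (?W f p)) * ennreal (cmod (?W u p)) \<partial>haar)"
    proof (intro nn_integral_mono)
      fix p :: "real \<times> (real ^ 'd)" assume "p \<in> space haar"
      then have "\<bar>\<rho> p\<bar> * (cmod (?W f p) * cmod (?W u p)) \<le> 1 * (cmod (?W f p) * cmod (?W u p))"
        using \<rho>(2)[of p] by (intro mult_right_mono) auto
      then show "ennreal (norm (F u p)) \<le> ennreal (cmod (?W f p)) * ennreal (cmod (?W u p))"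
        by (simp add: F_def norm_mult mult.assoc ennreal_leI flip: ennreal_mult)
    qed
    finally have "(ennreal (cmod (l u)))\<^sup>2 \<le> esq haar (?W f) * esq haar (?W u)"
      by (intro order.trans[OF power_mono_ennreal nn_integral_mult_le_esq] m f u)
    then have "(ennreal (cmod (l u)))\<^sup>2 \<le> ennreal ((L2_norm f)\<^sup>2) * ennreal ((L2_norm u)\<^sup>2)"
      by (simp only: wavelet_isometry[OF adm] f u esq_L2)
    also have "\<dots> = (ennreal (L2_norm f * L2_norm u))\<^sup>2"
      by (simp add: ennreal_power power_mult_distrib flip: ennreal_mult)
    finally have "ennreal (cmod (l u)) \<le> ennreal (L2_norm f * L2_norm u)" by (rule ennreal_power2_le_imp_le)
    then show ?thesis by (subst (asm) ennreal_le_iff) auto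
  qed
  ultimately obtain h where h: "h \<in> L2" "\<And>g. g \<in> L2 \<Longrightarrow> L2_inner h g = l g"
    using L2_Riesz_representation[of l "L2_norm f"] by blast
  have "L2_inner (wavelet \<phi> p) g = cnj (?W g p)" for g p
    unfolding wavelet_transform_def by (rule L2_inner_commute)
  then have "is_localization \<phi> \<rho> f h"
    using h int unfolding is_localization_def l_def F_def[abs_def] by simp
  then show ?thesis by blast
qed

text \<open>The largest of \<open>a\<close>, \<open>1 / a\<close> and \<open>norm b\<close> is
  continuous on \<open>grp\<close>, hence bounded on compact subsets.\<close>

lemma compact_subset_grp_box:
  fixes C :: "(real \<times> (real ^ 'd)) set"
  assumes C: "compact C" "C \<subseteq> grp"
  obtains m where "C \<subseteq> grp_box m"
proof -
  have pos: "fst p > 0" if "p \<in> C" for p using that C(2) by (auto simp: grp_iff)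
  have "continuous_on C (\<lambda>p. max (max (fst p) (inverse (fst p))) (norm (snd p)))"
    using pos by (intro continuous_intros continuous_on_max) force
  then have "bounded ((\<lambda>p. max (max (fst p) (inverse (fst p))) (norm (snd p))) ` C)"
    by (intro compact_imp_bounded compact_continuous_image C)
  then obtain B where B: "\<And>p. p \<in> C \<Longrightarrow> norm (max (max (fst p) (inverse (fst p))) (norm (snd p))) \<le> B"
    by (auto simp: bounded_iff)
  obtain m :: nat where m: "B \<le> real m" using real_arch_simple by blast
  have "p \<in> grp_box m" if p: "p \<in> C" for p
  proof -
    have "max (max (fst p) (inverse (fst p))) (norm (snd p)) \<le> real m"
      using order.trans[OF abs_ge_self B[OF p, unfolded real_norm_def]] m by (rule order.trans)
    then have le: "fst p \<le> real m" "inverse (fst p) \<le> real m" "norm (snd p) \<le> real m" by auto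
    have "inverse (real m) \<le> inverse (inverse (fst p))" using le(2) pos[OF p] by (intro le_imp_inverse_le) auto
    then show ?thesis using le by (cases p) (simp add: grp_box_def)
  qed
  then show ?thesis by (intro that[of m]) blast
qed

text \<open>Here the metric is traded for boxes: a ball around the identity has compact closure
  inside \<open>grp\<close> and so lies in a box, and off that box the distance is at least the
  radius beyond which the Berezin transform is small.\<close>

lemma thin_box:
  fixes D :: "real \<times> (real ^ 'd) \<Rightarrow> real \<times> (real ^ 'd) \<Rightarrow> real"
  assumes D: "proper_left_invariant_metric D" and thin: "thin D \<phi> \<sigma>" and \<delta>: "\<delta> > 0"
  obtains m where "\<And>q. q \<in> grp - grp_box m \<Longrightarrow> berezin \<phi> \<sigma> q \<le> ennreal \<delta>"
proof -
  interpret Metric_space grp D using D by (simp add: proper_left_invariant_metric_def)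
  have "(berezin \<phi> \<sigma> \<longlongrightarrow> 0) (at_grp_infinity D)"
    using thin by (simp add: thin_def berezin_def[abs_def] kernel_def)
  then have "\<forall>\<^sub>F q in at_grp_infinity D. berezin \<phi> \<sigma> q < ennreal \<delta>"
    by (rule order_tendstoD(2)) (use \<delta> in simp)
  then obtain R where R: "\<And>q. D q grp_one \<ge> R \<Longrightarrow> q \<in> grp \<Longrightarrow> berezin \<phi> \<sigma> q < ennreal \<delta>"
    unfolding at_grp_infinity_def eventually_inf_principal eventually_filtercomap_at_top_linorder by blast
  let ?C = "top_of_set grp closure_of mball grp_one R"
  have "compactin (top_of_set grp) ?C"
    using D grp_one_grp unfolding proper_left_invariant_metric_def by blast
  then have "compact ?C" "?C \<subseteq> grp" by (auto simp: compactin_subtopology)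
  then obtain m where m: "?C \<subseteq> grp_box m" by (rule compact_subset_grp_box)
  have "mball grp_one R \<subseteq> ?C" by (intro closure_of_subset) (auto simp: mball_def)
  with m have ball: "mball grp_one R \<subseteq> grp_box m" by blast
  show ?thesis
  proof (rule that)
    fix q :: "real \<times> (real ^ 'd)" assume q: "q \<in> grp - grp_box m"
    then have "q \<notin> mball grp_one R" using ball by blast
    then have "D q grp_one \<ge> R" using q grp_one_grp by (auto simp: commute[of q grp_one])
    then show "berezin \<phi> \<sigma> q \<le> ennreal \<delta>" using R[of q] q by (auto intro: less_imp_le)
  qed
qed

theorem theorem7:
  fixes \<phi> :: "real ^ 'd \<Rightarrow> complex"
    and \<sigma> :: "real \<times> (real ^ 'd) \<Rightarrow> real"
    and D :: "real \<times> (real ^ 'd) \<Rightarrow> real \<times> (real ^ 'd) \<Rightarrow> real"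
  assumes "proper_left_invariant_metric D"
    and "\<phi> \<in> A1"
    and "\<sigma> \<in> borel_measurable haar"
    and "\<And>p. p \<in> grp \<Longrightarrow> \<sigma> p \<in> {0..1}"
    and "thin D \<phi> \<sigma>"
  shows "\<exists>c>0. \<forall>f\<in>L2.
    L2_inner (localization_op \<phi> (\<lambda>p. 1 - \<sigma> p) f) f =
      complex_of_real (LINT p|haar. (1 - \<sigma> p) * (cmod (wavelet_transform \<phi> f p))\<^sup>2) \<and>
    (LINT p|haar. (1 - \<sigma> p) * (cmod (wavelet_transform \<phi> f p))\<^sup>2) \<ge> c * (L2_norm f)\<^sup>2"
proof -
  have adm: "\<phi> \<in> admissible" by (rule A1_admissible[OF assms(2)])
  \<comment> \<open>\<open>\<sigma>\<close> is measurable and bounded only on \<open>grp\<close>,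
    whereas the estimates use Borel functions with values in \<open>[0, 1]\<close> on the whole
    product. Extension by 0 changes no integral over the group.\<close>
  define \<tau> where "\<tau> p = indicator grp p *\<^sub>R \<sigma> p" for p
  have \<tau>eq: "\<tau> p = \<sigma> p" if "p \<in> grp" for p using that by (simp add: \<tau>_def)
  have "\<sigma> \<in> borel_measurable (restrict_space lborel grp)"
    using assms(3) unfolding haar_def measurable_density_eq1 .
  then have "\<tau> \<in> borel_measurable borel"
    by (subst (asm) borel_measurable_restrict_space_iff) (auto simp: \<tau>_def[abs_def])
  moreover have "0 \<le> \<tau> p \<and> \<tau> p \<le> 1" for p using assms(4)[of p] by (auto simp: \<tau>_def split: split_indicator)
  moreover have "\<exists>m. \<forall>n::nat. \<forall>q\<in>grp - grp_box m. berezin \<phi> \<tau> q \<le> ennreal \<delta>" if \<delta>: "\<delta> > 0" for \<delta>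
  proof -
    obtain m where m: "\<And>q. q \<in> grp - grp_box m \<Longrightarrow> berezin \<phi> \<sigma> q \<le> ennreal \<delta>"
      by (rule thin_box[OF assms(1,5) \<delta>]) blast
    have "berezin \<phi> \<tau> q = berezin \<phi> \<sigma> q" for q
      unfolding berezin_def by (intro nn_integral_cong) (simp add: \<tau>eq)
    then show ?thesis using m by (intro exI[of _ m] allI ballI) (simp only:)
  qed
  ultimately have "uniformly_thin \<phi> (\<lambda>_. \<tau>)" unfolding uniformly_thin_def by blast
  from energy_coercive[OF assms(2) this] obtain c where c: "c > 0"
    and le: "\<And>f. f \<in> L2 \<Longrightarrow> ennreal (c * (L2_norm f)\<^sup>2) \<le> energy \<phi> (\<lambda>p. 1 - \<tau> p) f"
    by blast
  have \<rho>: "(\<lambda>p. 1 - \<sigma> p) \<in> borel_measurable haar" using assms(3) by measurable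
  have \<rho>01: "0 \<le> 1 - \<sigma> p \<and> 1 - \<sigma> p \<le> 1" if "p \<in> grp" for p using assms(4)[OF that] by simp
  show ?thesis
  proof (rule exI[of _ c], intro conjI c ballI)
    fix f :: "real ^ 'd \<Rightarrow> complex" assume f: "f \<in> L2"
    let ?W = "wavelet_transform \<phi> f"
    let ?I = "\<lambda>p. (1 - \<sigma> p) * (cmod (?W p))\<^sup>2"
    have eq: "complex_of_real (1 - \<sigma> p) * ?W p * cnj (?W p) = complex_of_real (?I p)" for p
      unfolding mult.assoc complex_norm_square[symmetric] by (simp only: of_real_mult)
    have nonneg: "0 \<le> ?I p" if "p \<in> space haar" for p
      using \<rho>01[of p] that by (intro mult_nonneg_nonneg) auto
    have int: "integrable haar ?I"
      using localization_integrable[OF adm f f \<rho> \<rho>01] unfolding eq complex_of_real_integrable_eq .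
    have "is_localization \<phi> (\<lambda>p. 1 - \<sigma> p) f (localization_op \<phi> (\<lambda>p. 1 - \<sigma> p) f)"
      unfolding localization_op_def by (rule someI_ex[OF localization_exists[OF adm f \<rho> \<rho>01]])
    then have "L2_inner (localization_op \<phi> (\<lambda>p. 1 - \<sigma> p) f) f =
        (LINT p|haar. complex_of_real (1 - \<sigma> p) * ?W p * L2_inner (wavelet \<phi> p) f)"
      using f unfolding is_localization_def by blast
    also have "\<dots> = (LINT p|haar. complex_of_real (?I p))"
    proof -
      have "L2_inner (wavelet \<phi> p) f = cnj (?W p)" for p
        unfolding wavelet_transform_def by (rule L2_inner_commute)
      then show ?thesis by (simp only: eq)
    qed
    also have "\<dots> = complex_of_real (LINT p|haar. ?I p)" by (rule integral_complex_of_real)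
    finally show "L2_inner (localization_op \<phi> (\<lambda>p. 1 - \<sigma> p) f) f = complex_of_real (LINT p|haar. ?I p)" .
    have "energy \<phi> (\<lambda>p. 1 - \<tau> p) f = (\<integral>\<^sup>+p. ennreal (?I p) \<partial>haar)"
      unfolding energy_def by (intro nn_integral_cong) (simp add: \<tau>eq)
    also have "\<dots> = ennreal (LINT p|haar. ?I p)"
      by (rule nn_integral_eq_integral[OF int]) (intro AE_I2 nonneg)
    finally have "ennreal (c * (L2_norm f)\<^sup>2) \<le> ennreal (LINT p|haar. ?I p)" using le[OF f] by simp
    \<comment> \<open>\<open>ennreal\<close> sends negative reals to 0, so this sign is what allows
      the comparison to return to the reals.\<close>
    moreover have "(LINT p|haar. ?I p) \<ge> 0"
      by (rule integral_nonneg_AE) (intro AE_I2 nonneg)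
    ultimately show "c * (L2_norm f)\<^sup>2 \<le> (LINT p|haar. ?I p)" by (subst (asm) ennreal_le_iff) auto
  qed
qed

end
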